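(* The full subcategory $\mathbf{HDA}^\Sigma$ of $\square_S^{op}\mathbf{Set}\downarrow{!^S\Sigma}$ containing the objects satisfying the HDA paradigm is a full reflective locally presentable category of the category $\square_S^{op}\mathbf{Set}\downarrow{!^S\Sigma}$ of labelled symmetric precubical sets. In other terms, the inclusion functor $i_\Sigma:\mathbf{HDA}^\Sigma\subset\square_S^{op}\mathbf{Set}\downarrow{!^S\Sigma}$ has a left adjoint $\mathrm{Sh}_\Sigma:\square_S^{op}\mathbf{Set}\downarrow{!^S\Sigma}\to\mathbf{HDA}^\Sigma$.
   Context: $\Sigma$ is a fixed nonempty set of labels. $\square_S$ is the category with objects $[n]=\{0,1\}^n$, $n\ge0$, whose morphisms are the set maps generated by the face maps $\delta_i^\alpha(\epsilon_1,\dots,\epsilon_{n-1})=(\epsilon_1,\dots,\epsilon_{i-1},\alpha,\epsilon_i,\dots,\epsilon_{n-1})$ ($\alpha\in\{0,1\}$) and the symmetry maps $\sigma_i:[n]\to[n]$ exchanging coordinates $i$ and $i+1$. A symmetric precubical set is a presheaf on $\square_S$; $\square_S[n]=\square_S(-,[n])$; $\partial\square_S[n]\subset\square_S[n]$ has the same $k$-cubes for $k<n$ and none for $k\ge n$. The symmetric precubical set $!^S\Sigma$ has $(!^S\Sigma)_n=\Sigma^n$, where $(\delta_i^0)^*=(\delta_i^1)^*$ removes the $i$-th letter and $\sigma_i^*$ exchanges letters $i$ and $i+1$. A labelled symmetric precubical set is an object of the comma category $\square_S^{op}\mathbf{Set}\downarrow{!^S\Sigma}$. A labelled symmetric precubical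 set $K\to{!^S\Sigma}$ satisfies the HDA paradigm if for every $p\ge2$, every commutative square with sides $\partial\square_S[p]\subset\square_S[p]$, $\partial\square_S[p]\to K$, $\square_S[p]\to{!^S\Sigma}$ and $K\to{!^S\Sigma}$ admits at most one lift $k:\square_S[p]\to K$ making the two triangles commutative. *)

theory Defs
  imports Main "HOL-Library.FuncSet"
begin

unbundle cardinal_syntax

section \<open>Smallness\<close>

text \<open>
  The category of sets is modelled inside a type \<open>'u\<close>: a set (over any type) is small when its
  cardinality is less than that of \<open>'u\<close>, and "Set" is the category of small sets of elements of
  \<open>'u\<close>.  The cardinality of \<open>'u\<close> is only required to be regular and uncountable.  When it is
  strongly inaccessible the small sets are, up to bijection, the elements of a Grothendieck
  universe, and everything below is the usual notion relative to that universe.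
\<close>

definition small :: "'u itself \<Rightarrow> 'a set \<Rightarrow> bool" where
  "small U A \<longleftrightarrow> |A| <o |UNIV :: 'u set|"

definition size_universe :: "'u itself \<Rightarrow> bool" where
  "size_universe U \<longleftrightarrow> natLeq <o |UNIV :: 'u set| \<and> regularCard |UNIV :: 'u set|"

definition power_closed :: "'u itself \<Rightarrow> bool" where
  "power_closed U \<longleftrightarrow> (\<forall>A :: 'u set. small U A \<longrightarrow> small U (Pow A))"


section \<open>Categories, functors, adjunctions\<close>

text \<open>
  Hom-sets are indexed by their end points and need not be disjoint.  \<open>Comp C a b c g f\<close> is the
  composite of \<open>f : a \<rightarrow> b\<close> followed by \<open>g : b \<rightarrow> c\<close>.
\<close>

record ('o, 'm) cat =
  Obj  :: "'o set"
  Hom  :: "'o \<Rightarrow> 'o \<Rightarrow> 'm set"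
  Ide  :: "'o \<Rightarrow> 'm"
  Comp :: "'o \<Rightarrow> 'o \<Rightarrow> 'o \<Rightarrow> 'm \<Rightarrow> 'm \<Rightarrow> 'm"

definition category :: "('o, 'm) cat \<Rightarrow> bool" where
  "category C \<longleftrightarrow>
     (\<forall>a\<in>Obj C. Ide C a \<in> Hom C a a) \<and>
     (\<forall>a\<in>Obj C. \<forall>b\<in>Obj C. \<forall>c\<in>Obj C. \<forall>f\<in>Hom C a b. \<forall>g\<in>Hom C b c.
        Comp C a b c g f \<in> Hom C a c) \<and>
     (\<forall>a\<in>Obj C. \<forall>b\<in>Obj C. \<forall>f\<in>Hom C a b.
        Comp C a b b (Ide C b) f = f \<and> Comp C a a b f (Ide C a) = f) \<and>
     (\<forall>a\<in>Obj C. \<forall>b\<in>Obj C. \<forall>c\<in>Obj C. \<forall>d\<in>Obj C.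
        \<forall>f\<in>Hom C a b. \<forall>g\<in>Hom C b c. \<forall>h\<in>Hom C c d.
        Comp C a c d h (Comp C a b c g f) = Comp C a b d (Comp C b c d h g) f)"

record ('o, 'm, 'p, 'n) fnctr =
  on_ob :: "'o \<Rightarrow> 'p"
  on_ar :: "'o \<Rightarrow> 'o \<Rightarrow> 'm \<Rightarrow> 'n"

definition is_functor ::
    "('o, 'm) cat \<Rightarrow> ('p, 'n) cat \<Rightarrow> ('o, 'm, 'p, 'n) fnctr \<Rightarrow> bool" where
  "is_functor C D F \<longleftrightarrow>
     category C \<and> category D \<and>
     (\<forall>a\<in>Obj C. on_ob F a \<in> Obj D) \<and>
     (\<forall>a\<in>Obj C. \<forall>b\<in>Obj C. \<forall>f\<in>Hom C a b. on_ar F a b f \<in> Hom D (on_ob F a) (on_ob F b)) \<and>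
     (\<forall>a\<in>Obj C. on_ar F a a (Ide C a) = Ide D (on_ob F a)) \<and>
     (\<forall>a\<in>Obj C. \<forall>b\<in>Obj C. \<forall>c\<in>Obj C. \<forall>f\<in>Hom C a b. \<forall>g\<in>Hom C b c.
        on_ar F a c (Comp C a b c g f) =
        Comp D (on_ob F a) (on_ob F b) (on_ob F c) (on_ar F b c g) (on_ar F a b f))"

definition functor_comp ::
    "('p, 'n, 'q, 'k) fnctr \<Rightarrow> ('o, 'm, 'p, 'n) fnctr \<Rightarrow> ('o, 'm, 'q, 'k) fnctr" where
  "functor_comp G F =
     \<lparr> on_ob = (\<lambda>a. on_ob G (on_ob F a)),
       on_ar = (\<lambda>a b f. on_ar G (on_ob F a) (on_ob F b) (on_ar F a b f)) \<rparr>"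

text \<open>\<open>F : C \<rightarrow> D\<close> is left adjoint to \<open>G : D \<rightarrow> C\<close>.\<close>

definition left_adjoint ::
    "('o, 'm) cat \<Rightarrow> ('p, 'n) cat \<Rightarrow> ('o, 'm, 'p, 'n) fnctr \<Rightarrow> ('p, 'n, 'o, 'm) fnctr \<Rightarrow> bool"
  where
  "left_adjoint C D F G \<longleftrightarrow>
     is_functor C D F \<and> is_functor D C G \<and>
     (\<exists>\<phi> :: 'o \<Rightarrow> 'p \<Rightarrow> 'n \<Rightarrow> 'm.
       (\<forall>x\<in>Obj C. \<forall>y\<in>Obj D. bij_betw (\<phi> x y) (Hom D (on_ob F x) y) (Hom C x (on_ob G y))) \<and>
       (\<forall>x\<in>Obj C. \<forall>x'\<in>Obj C. \<forall>y\<in>Obj D. \<forall>f\<in>Hom C x' x. \<forall>h\<in>Hom D (on_ob F x) y.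
          \<phi> x' y (Comp D (on_ob F x') (on_ob F x) y h (on_ar F x' x f)) =
          Comp C x' x (on_ob G y) (\<phi> x y h) f) \<and>
       (\<forall>x\<in>Obj C. \<forall>y\<in>Obj D. \<forall>y'\<in>Obj D. \<forall>g\<in>Hom D y y'. \<forall>h\<in>Hom D (on_ob F x) y.
          \<phi> x y' (Comp D (on_ob F x) y y' g h) =
          Comp C x (on_ob G y) (on_ob G y') (on_ar G y y' g) (\<phi> x y h)))"

definition full_subcategory :: "('o, 'm) cat \<Rightarrow> ('o, 'm) cat \<Rightarrow> bool" where
  "full_subcategory D C \<longleftrightarrow>
     category C \<and> category D \<and> Obj D \<subseteq> Obj C \<and>
     (\<forall>a\<in>Obj D. Ide D a = Ide C a) \<and>
     (\<forall>a\<in>Obj D. \<forall>b\<in>Obj D. Hom D a b = Hom C a b) \<and>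
     (\<forall>a\<in>Obj D. \<forall>b\<in>Obj D. \<forall>c\<in>Obj D. \<forall>f\<in>Hom D a b. \<forall>g\<in>Hom D b c.
        Comp D a b c g f = Comp C a b c g f)"

definition full_subcat_on :: "('o, 'm) cat \<Rightarrow> ('o \<Rightarrow> bool) \<Rightarrow> ('o, 'm) cat" where
  "full_subcat_on C P = C \<lparr> Obj := {a \<in> Obj C. P a} \<rparr>"

definition inclusion :: "('o, 'm, 'o, 'm) fnctr" where
  "inclusion = \<lparr> on_ob = (\<lambda>a. a), on_ar = (\<lambda>a b f. f) \<rparr>"


section \<open>Colimits and locally presentable categories\<close>

definition is_cocone ::
    "('j, 'k) cat \<Rightarrow> ('o, 'm) cat \<Rightarrow> ('j, 'k, 'o, 'm) fnctr \<Rightarrow> 'o \<Rightarrow> ('j \<Rightarrow> 'm) \<Rightarrow> bool" where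
  "is_cocone J C D X c \<longleftrightarrow>
     X \<in> Obj C \<and> (\<forall>j\<in>Obj J. c j \<in> Hom C (on_ob D j) X) \<and>
     (\<forall>i\<in>Obj J. \<forall>j\<in>Obj J. \<forall>f\<in>Hom J i j.
        Comp C (on_ob D i) (on_ob D j) X (c j) (on_ar D i j f) = c i)"

definition is_colimit ::
    "('j, 'k) cat \<Rightarrow> ('o, 'm) cat \<Rightarrow> ('j, 'k, 'o, 'm) fnctr \<Rightarrow> 'o \<Rightarrow> ('j \<Rightarrow> 'm) \<Rightarrow> bool" where
  "is_colimit J C D X c \<longleftrightarrow>
     is_cocone J C D X c \<and>
     (\<forall>Y d. is_cocone J C D Y d \<longrightarrow>
        (\<exists>!u. u \<in> Hom C X Y \<and> (\<forall>j\<in>Obj J. Comp C (on_ob D j) X Y u (c j) = d j)))"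

definition small_category :: "'u itself \<Rightarrow> ('j, 'k) cat \<Rightarrow> bool" where
  "small_category U J \<longleftrightarrow>
     category J \<and> small U (Obj J) \<and> (\<forall>a\<in>Obj J. \<forall>b\<in>Obj J. small U (Hom J a b))"

definition cocomplete :: "'u itself \<Rightarrow> ('o, 'm) cat \<Rightarrow> bool" where
  "cocomplete U C \<longleftrightarrow> category C \<and>
     (\<forall>(J :: ('u, 'u) cat) D. small_category U J \<and> is_functor J C D \<longrightarrow>
        (\<exists>X c. is_colimit J C D X c))"

definition locally_small :: "'u itself \<Rightarrow> ('o, 'm) cat \<Rightarrow> bool" where
  "locally_small U C \<longleftrightarrow> (\<forall>a\<in>Obj C. \<forall>b\<in>Obj C. small U (Hom C a b))"

text \<open>The sets of elements of \<open>'a\<close> with no size bound; it receives the functors \<open>Hom(P, -)\<close>.\<close>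

definition sets_cat :: "('a set, 'a \<Rightarrow> 'a) cat" where
  "sets_cat =
     \<lparr> Obj = UNIV, Hom = (\<lambda>A B. A \<rightarrow>\<^sub>E B), Ide = (\<lambda>A. \<lambda>x\<in>A. x),
       Comp = (\<lambda>A B E g f. compose A g f) \<rparr>"

definition hom_functor ::
    "('o, 'm) cat \<Rightarrow> 'o \<Rightarrow> ('o, 'm, 'm set, 'm \<Rightarrow> 'm) fnctr" where
  "hom_functor C P =
     \<lparr> on_ob = (\<lambda>X. Hom C P X), on_ar = (\<lambda>X Y f. \<lambda>g\<in>Hom C P X. Comp C P X Y f g) \<rparr>"

definition poset_cat :: "'i set \<Rightarrow> 'i rel \<Rightarrow> ('i, unit) cat" where
  "poset_cat I r =
     \<lparr> Obj = I, Hom = (\<lambda>i j. if (i, j) \<in> r then {()} else {}), Ide = (\<lambda>i. ()),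
       Comp = (\<lambda>i j k g f. ()) \<rparr>"

text \<open>Every regular cardinal that is small has a representative among the orders on \<open>'u\<close>.\<close>

definition small_regular_cardinal :: "'u rel \<Rightarrow> bool" where
  "small_regular_cardinal lam \<longleftrightarrow>
     Card_order lam \<and> infinite (Field lam) \<and> regularCard lam \<and> lam <o |UNIV :: 'u set|"

definition directed_poset :: "'u rel \<Rightarrow> 'i set \<Rightarrow> 'i rel \<Rightarrow> bool" where
  "directed_poset lam I r \<longleftrightarrow>
     partial_order_on I r \<and>
     (\<forall>S. S \<subseteq> I \<and> |S| <o lam \<longrightarrow> (\<exists>u\<in>I. \<forall>s\<in>S. (s, u) \<in> r))"

text \<open>The functor \<open>Hom(P, -)\<close> preserves colimits of small \<open>lam\<close>-directed diagrams.\<close>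

definition presentable :: "'u rel \<Rightarrow> ('o, 'm) cat \<Rightarrow> 'o \<Rightarrow> bool" where
  "presentable lam C P \<longleftrightarrow> P \<in> Obj C \<and>
     (\<forall>(I :: 'u set) r D X c.
        small TYPE('u) I \<and> directed_poset lam I r \<and>
        is_functor (poset_cat I r) C D \<and> is_colimit (poset_cat I r) C D X c \<longrightarrow>
        is_colimit (poset_cat I r) sets_cat (functor_comp (hom_functor C P) D)
          (Hom C P X) (\<lambda>i. on_ar (hom_functor C P) (on_ob D i) X (c i)))"

text \<open>
  A locally presentable category is by convention locally small.  This is demanded as soon as the
  universe is closed under power sets, that is, for a Grothendieck universe; otherwise not even
  the category of small sets has small hom-sets.
\<close>

definition locally_presentable :: "'u itself \<Rightarrow> ('o, 'm) cat \<Rightarrow> bool" where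
  "locally_presentable U C \<longleftrightarrow>
     category C \<and> (power_closed U \<longrightarrow> locally_small U C) \<and> cocomplete U C \<and>
     (\<exists>(lam :: 'u rel) A.
        small_regular_cardinal lam \<and> A \<subseteq> Obj C \<and> small U A \<and> (\<forall>P\<in>A. presentable lam C P) \<and>
        (\<forall>X\<in>Obj C. \<exists>(I :: 'u set) r D c.
           small U I \<and> directed_poset lam I r \<and> is_functor (poset_cat I r) C D \<and>
           (\<forall>i\<in>I. on_ob D i \<in> A) \<and> is_colimit (poset_cat I r) C D X c))"


section \<open>The category of cubes with symmetries\<close>

definition cube :: "nat \<Rightarrow> bool list set" where
  "cube n = {x. length x = n}"

text \<open>Coordinates are numbered from 0, so \<open>face n i\<close> is the face map inserting before position \<open>i\<close>.\<close>

definition face :: "nat \<Rightarrow> nat \<Rightarrow> bool \<Rightarrow> bool list \<Rightarrow> bool list" where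
  "face n i \<alpha> = (\<lambda>x\<in>cube n. take i x @ \<alpha> # drop i x)"

definition symm :: "nat \<Rightarrow> nat \<Rightarrow> bool list \<Rightarrow> bool list" where
  "symm n i = (\<lambda>x\<in>cube n. x[i := x ! Suc i, Suc i := x ! i])"

inductive box_map :: "nat \<Rightarrow> nat \<Rightarrow> (bool list \<Rightarrow> bool list) \<Rightarrow> bool" where
  ident: "box_map n n (\<lambda>x\<in>cube n. x)"
| face: "i \<le> n \<Longrightarrow> box_map n (Suc n) (face n i \<alpha>)"
| symm: "Suc i < n \<Longrightarrow> box_map n n (symm n i)"
| comp: "box_map l m f \<Longrightarrow> box_map m n g \<Longrightarrow> box_map l n (compose (cube l) g f)"

definition box :: "(nat, bool list \<Rightarrow> bool list) cat" where
  "box =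
     \<lparr> Obj = UNIV, Hom = (\<lambda>m n. {f. box_map m n f}), Ide = (\<lambda>n. \<lambda>x\<in>cube n. x),
       Comp = (\<lambda>l m n g f. compose (cube l) g f) \<rparr>"


section \<open>Symmetric precubical sets\<close>

text \<open>
  \<open>act K m n f\<close> is the map from \<open>n\<close>-cubes to \<open>m\<close>-cubes induced by \<open>f : [m] \<rightarrow> [n]\<close>.  The cubes may
  be elements of any type, and morphisms may go between presheaves over different types.
\<close>

record 'a psh =
  cells :: "nat \<Rightarrow> 'a set"
  act   :: "nat \<Rightarrow> nat \<Rightarrow> (bool list \<Rightarrow> bool list) \<Rightarrow> 'a \<Rightarrow> 'a"

definition sym_precubical_set :: "'a psh \<Rightarrow> bool" where
  "sym_precubical_set K \<longleftrightarrow>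
     (\<forall>m n. act K m n \<in> Hom box m n \<rightarrow>\<^sub>E (cells K n \<rightarrow>\<^sub>E cells K m)) \<and>
     (\<forall>n. \<forall>x\<in>cells K n. act K n n (Ide box n) x = x) \<and>
     (\<forall>l m n. \<forall>f\<in>Hom box l m. \<forall>g\<in>Hom box m n. \<forall>x\<in>cells K n.
        act K l n (Comp box l m n g f) x = act K l m f (act K m n g x))"

definition psh_hom :: "'a psh \<Rightarrow> 'b psh \<Rightarrow> (nat \<Rightarrow> 'a \<Rightarrow> 'b) set" where
  "psh_hom K L = {\<phi>.
     (\<forall>n. \<phi> n \<in> cells K n \<rightarrow>\<^sub>E cells L n) \<and>
     (\<forall>m n. \<forall>f\<in>Hom box m n. \<forall>x\<in>cells K n. \<phi> m (act K m n f x) = act L m n f (\<phi> n x))}"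

definition psh_comp ::
    "'a psh \<Rightarrow> (nat \<Rightarrow> 'b \<Rightarrow> 'c) \<Rightarrow> (nat \<Rightarrow> 'a \<Rightarrow> 'b) \<Rightarrow> nat \<Rightarrow> 'a \<Rightarrow> 'c" where
  "psh_comp K \<psi> \<phi> = (\<lambda>n. compose (cells K n) (\<psi> n) (\<phi> n))"

definition psh_incl :: "'a psh \<Rightarrow> nat \<Rightarrow> 'a \<Rightarrow> 'a" where
  "psh_incl K = (\<lambda>n. \<lambda>x\<in>cells K n. x)"

definition std_cube :: "nat \<Rightarrow> (bool list \<Rightarrow> bool list) psh" where
  "std_cube n =
     \<lparr> cells = (\<lambda>k. Hom box k n),
       act = (\<lambda>l k. \<lambda>f\<in>Hom box l k. \<lambda>g\<in>Hom box k n. Comp box l k n g f) \<rparr>"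

definition boundary_cells :: "nat \<Rightarrow> nat \<Rightarrow> (bool list \<Rightarrow> bool list) set" where
  "boundary_cells n k = (if k < n then Hom box k n else {})"

definition boundary :: "nat \<Rightarrow> (bool list \<Rightarrow> bool list) psh" where
  "boundary n =
     \<lparr> cells = boundary_cells n,
       act = (\<lambda>l k. \<lambda>f\<in>Hom box l k. \<lambda>g\<in>boundary_cells n k. Comp box l k n g f) \<rparr>"

text \<open>
  The presheaf of words of labels.  A map \<open>f : [m] \<rightarrow> [n]\<close> of cubes copies each coordinate \<open>i < m\<close> of
  its argument to exactly one coordinate \<open>dir m n f i < n\<close> of its value (the other ones being
  constant), and sends a word of length \<open>n\<close> to the word of length \<open>m\<close> whose \<open>i\<close>-th letter is the
  letter in position \<open>dir m n f i\<close>.  On the generators these are the deletion of a letter and the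
  exchange of two adjacent letters, see \<open>act_bang_face\<close> and \<open>act_bang_symm\<close> below.
\<close>

definition dir :: "nat \<Rightarrow> nat \<Rightarrow> (bool list \<Rightarrow> bool list) \<Rightarrow> nat \<Rightarrow> nat" where
  "dir m n f i = (THE j. j < n \<and> (\<forall>x\<in>cube m. f x ! j = x ! i))"

definition words :: "'l set \<Rightarrow> nat \<Rightarrow> 'l list set" where
  "words \<Sigma> n = {w. length w = n \<and> set w \<subseteq> \<Sigma>}"

definition bang :: "'l set \<Rightarrow> 'l list psh" where
  "bang \<Sigma> =
     \<lparr> cells = words \<Sigma>,
       act = (\<lambda>m n. \<lambda>f\<in>Hom box m n. \<lambda>w\<in>words \<Sigma> n. map (\<lambda>i. w ! dir m n f i) [0..<m]) \<rparr>"


lemma box_map_cube: "box_map m n f \<Longrightarrow> x \<in> cube m \<Longrightarrow> f x \<in> cube n"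
  by (induction arbitrary: x rule: box_map.induct)
    (auto simp: cube_def face_def symm_def compose_def)

lemma box_map_extensional: "box_map m n f \<Longrightarrow> f \<in> extensional (cube m)"
  by (induction rule: box_map.induct) (auto simp: face_def symm_def extensional_def compose_def)

lemma category_box: "category box"
proof -
  have unit: "compose (cube a) (\<lambda>x\<in>cube b. x) f = f" "compose (cube a) f (\<lambda>x\<in>cube a. x) = f"
    if "box_map a b f" for a b f
    using box_map_extensional[OF that] box_map_cube[OF that]
    by (auto simp: compose_def extensional_def fun_eq_iff restrict_def)
  have assoc: "compose (cube a) h (compose (cube a) g f) = compose (cube a) (compose (cube b) h g) f"
    if "box_map a b f" for a b f g h
    using box_map_cube[OF that] by (auto simp: compose_def restrict_def fun_eq_iff)
  show ?thesis
    unfolding category_def box_def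
    using box_map.ident box_map.comp unit assoc by auto
qed

lemma cube_nth_eq_iff:
  assumes "i < m" "i' < m"
  shows "(\<forall>x\<in>cube m. x ! i = x ! i') \<longleftrightarrow> i = i'"
proof
  assume *: "\<forall>x\<in>cube m. x ! i = x ! i'"
  have "map (\<lambda>j. j = i) [0..<m] \<in> cube m" by (simp add: cube_def)
  with * have "map (\<lambda>j. j = i) [0..<m] ! i = map (\<lambda>j. j = i) [0..<m] ! i'" by blast
  with assms show "i = i'" by simp
qed simp

lemma cube_nth_not_const:
  assumes "i < m"
  shows "\<not> (\<forall>x\<in>cube m. x ! i = b)"
proof
  assume *: "\<forall>x\<in>cube m. x ! i = b"
  have "replicate m (\<not> b) \<in> cube m" by (simp add: cube_def)
  with * have "replicate m (\<not> b) ! i = b" by blast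
  with assms show False by simp
qed

definition coord_map :: "nat \<Rightarrow> nat \<Rightarrow> (bool list \<Rightarrow> bool list) \<Rightarrow> (nat \<Rightarrow> nat) \<Rightarrow> bool" where
  "coord_map m n f d \<longleftrightarrow>
     (\<forall>i<m. d i < n \<and> (\<forall>x\<in>cube m. f x ! d i = x ! i)) \<and>
     (\<forall>j<n. j \<notin> d ` {..<m} \<longrightarrow> (\<exists>b. \<forall>x\<in>cube m. f x ! j = b))"

lemma coord_map_dir:
  assumes "coord_map m n f d" "i < m"
  shows "dir m n f i = d i"
  unfolding dir_def
proof (rule the_equality)
  show "d i < n \<and> (\<forall>x\<in>cube m. f x ! d i = x ! i)"
    using assms by (auto simp: coord_map_def)
next
  fix j assume j: "j < n \<and> (\<forall>x\<in>cube m. f x ! j = x ! i)"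
  show "j = d i"
  proof (cases "j \<in> d ` {..<m}")
    case True
    then obtain i' where i': "i' < m" "j = d i'" by auto
    with assms(1) have "\<forall>x\<in>cube m. f x ! j = x ! i'" by (auto simp: coord_map_def)
    with j have "\<forall>x\<in>cube m. x ! i = x ! i'" by simp
    then have "i = i'" using cube_nth_eq_iff[OF assms(2) i'(1)] by blast
    with i' show ?thesis by simp
  next
    case False
    with assms(1) j obtain b where "\<forall>x\<in>cube m. f x ! j = b"
      unfolding coord_map_def by blast
    with j have "\<forall>x\<in>cube m. x ! i = b" by simp
    with cube_nth_not_const[OF assms(2)] show ?thesis by blast
  qed
qed

lemma coord_map_ident: "coord_map n n (\<lambda>x\<in>cube n. x) (\<lambda>i. i)"
  by (auto simp: coord_map_def)

lemma coord_map_face: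
  assumes "i \<le> n"
  shows "coord_map n (Suc n) (face n i \<alpha>) (\<lambda>k. if k < i then k else Suc k)"
proof -
  have *: "j = i" if "j < Suc n" "j \<notin> (\<lambda>k. if k < i then k else Suc k) ` {..<n}" for j
  proof (rule ccontr)
    assume "j \<noteq> i"
    then consider "j < i" | "j > i" by linarith
    then have "j \<in> (\<lambda>k. if k < i then k else Suc k) ` {..<n}"
    proof cases
      case 1
      then show ?thesis using assms by (intro image_eqI[of _ _ j]) auto
    next
      case 2
      then show ?thesis using that(1) by (intro image_eqI[of _ _ "j - 1"]) auto
    qed
    with that(2) show False by blast
  qed
  show ?thesis
    unfolding coord_map_def
  proof (intro conjI allI impI)
    fix j assume "j < Suc n" "j \<notin> (\<lambda>k. if k < i then k else Suc k) ` {..<n}"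
    with * have "j = i" by blast
    then show "\<exists>b. \<forall>x\<in>cube n. face n i \<alpha> x ! j = b"
      using assms by (intro exI[of _ \<alpha>]) (auto simp: face_def cube_def nth_append)
  qed (use assms in \<open>auto simp: face_def cube_def nth_append min_def Suc_diff_le\<close>)
qed

lemma coord_map_symm:
  assumes "Suc i < n"
  shows "coord_map n n (symm n i) (\<lambda>k. if k = i then Suc i else if k = Suc i then i else k)"
proof -
  have "j \<in> (\<lambda>k. if k = i then Suc i else if k = Suc i then i else k) ` {..<n}" if "j < n" for j
    using assms that
    by (intro image_eqI[of _ _ "if j = i then Suc i else if j = Suc i then i else j"]) auto
  with assms show ?thesis
    by (auto simp: coord_map_def symm_def cube_def nth_list_update)
qed

lemma coord_map_comp:
  assumes f: "coord_map l m f d" and g: "coord_map m n g e" and "box_map l m f"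
  shows "coord_map l n (compose (cube l) g f) (\<lambda>i. e (d i))"
  unfolding coord_map_def
proof (intro conjI allI impI)
  fix j assume j: "j < n" "j \<notin> (\<lambda>i. e (d i)) ` {..<l}"
  show "\<exists>b. \<forall>x\<in>cube l. compose (cube l) g f x ! j = b"
  proof (cases "j \<in> e ` {..<m}")
    case True
    then obtain k where k: "k < m" "j = e k" by auto
    with j have "k \<notin> d ` {..<l}" by auto
    with f k obtain b where "\<forall>x\<in>cube l. f x ! k = b"
      unfolding coord_map_def by blast
    with g k box_map_cube[OF assms(3)] show ?thesis by (auto simp: coord_map_def compose_def)
  next
    case False
    with g j obtain b where "\<forall>x\<in>cube m. g x ! j = b"
      unfolding coord_map_def by blast
    with box_map_cube[OF assms(3)] show ?thesis by (auto simp: compose_def)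
  qed
qed (use f g box_map_cube[OF assms(3)] in \<open>auto simp: coord_map_def compose_def\<close>)

lemma box_map_coord_map: "box_map m n f \<Longrightarrow> coord_map m n f (dir m n f)"
proof -
  assume "box_map m n f"
  then have "\<exists>d. coord_map m n f d"
    by (induction rule: box_map.induct)
      (blast intro: coord_map_ident coord_map_face coord_map_symm coord_map_comp)+
  then obtain d where d: "coord_map m n f d" ..
  have eq: "dir m n f i = d i" if "i < m" for i
    by (rule coord_map_dir[OF d that])
  then have "dir m n f ` {..<m} = d ` {..<m}"
    by (intro image_cong) auto
  with d eq show ?thesis by (simp add: coord_map_def)
qed

lemma act_bang_face:
  assumes "i \<le> n" "w \<in> words \<Sigma> (Suc n)"
  shows "act (bang \<Sigma>) n (Suc n) (face n i \<alpha>) w = take i w @ drop (Suc i) w"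
proof -
  have "face n i \<alpha> \<in> Hom box n (Suc n)"
    using assms(1) by (simp add: box_def box_map.face)
  moreover have "dir n (Suc n) (face n i \<alpha>) k = (if k < i then k else Suc k)" if "k < n" for k
    by (rule coord_map_dir[OF coord_map_face[OF assms(1)] that])
  ultimately show ?thesis
    using assms by (auto simp: bang_def words_def nth_append min_def intro!: nth_equalityI)
qed

lemma act_bang_symm:
  assumes "Suc i < n" "w \<in> words \<Sigma> n"
  shows "act (bang \<Sigma>) n n (symm n i) w = w[i := w ! Suc i, Suc i := w ! i]"
proof -
  have "symm n i \<in> Hom box n n"
    using assms(1) by (simp add: box_def box_map.symm)
  moreover have "dir n n (symm n i) k = (if k = i then Suc i else if k = Suc i then i else k)"
    if "k < n" for k
    by (rule coord_map_dir[OF coord_map_symm[OF assms(1)] that])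
  ultimately show ?thesis
    using assms by (auto simp: bang_def words_def nth_list_update intro!: nth_equalityI)
qed

lemma sym_precubical_set_bang: "sym_precubical_set (bang \<Sigma>)"
  unfolding sym_precubical_set_def
proof (intro conjI allI ballI)
  fix m n
  have "map (\<lambda>i. w ! dir m n f i) [0..<m] \<in> words \<Sigma> m"
    if "f \<in> Hom box m n" "w \<in> words \<Sigma> n" for f w
    using box_map_coord_map[of m n f] that
    by (fastforce simp: box_def words_def coord_map_def)
  then show "act (bang \<Sigma>) m n \<in> Hom box m n \<rightarrow>\<^sub>E cells (bang \<Sigma>) n \<rightarrow>\<^sub>E cells (bang \<Sigma>) m"
    by (auto simp: bang_def)
next
  fix n w assume "w \<in> cells (bang \<Sigma>) n"
  moreover have "dir n n (\<lambda>x\<in>cube n. x) i = i" if "i < n" for i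
    by (rule coord_map_dir[OF coord_map_ident that])
  ultimately show "act (bang \<Sigma>) n n (Ide box n) w = w"
    by (auto simp: bang_def words_def box_def box_map.ident intro!: nth_equalityI)
next
  fix l m n f g w
  assume f: "f \<in> Hom box l m" and g: "g \<in> Hom box m n" and w: "w \<in> cells (bang \<Sigma>) n"
  have fg: "box_map l m f" "box_map m n g" using f g by (auto simp: box_def)
  have "dir l n (compose (cube l) g f) i = dir m n g (dir l m f i)" if "i < l" for i
    by (rule coord_map_dir[OF coord_map_comp that]) (auto intro: box_map_coord_map fg)
  moreover have "dir l m f i < m" if "i < l" for i
    using box_map_coord_map[OF fg(1)] that by (auto simp: coord_map_def)
  moreover have "map (\<lambda>i. w ! dir m n g i) [0..<m] \<in> words \<Sigma> m"
    using box_map_coord_map[OF fg(2)] w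
    by (fastforce simp: bang_def words_def coord_map_def)
  ultimately show "act (bang \<Sigma>) l n (Comp box l m n g f) w =
      act (bang \<Sigma>) l m f (act (bang \<Sigma>) m n g w)"
    using w fg box_map.comp[OF fg] by (auto simp: bang_def box_def)
qed


section \<open>Labelled symmetric precubical sets and the HDA paradigm\<close>

type_synonym ('u, 'l) lpsh = "'u psh \<times> (nat \<Rightarrow> 'u \<Rightarrow> 'l list)"

definition labelled_sets ::
    "'u itself \<Rightarrow> 'l set \<Rightarrow> (('u, 'l) lpsh, nat \<Rightarrow> 'u \<Rightarrow> 'u) cat" where
  "labelled_sets U \<Sigma> =
     \<lparr> Obj = {(K, lab). sym_precubical_set K \<and> (\<forall>n. small U (cells K n)) \<and>
                     lab \<in> psh_hom K (bang \<Sigma>)},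
       Hom = (\<lambda>(K, lab) (L, lab'). {\<phi> \<in> psh_hom K L. psh_comp K lab' \<phi> = lab}),
       Ide = (\<lambda>(K, lab). psh_incl K),
       Comp = (\<lambda>(K, lab) (L, lab') (M, lab'') \<psi> \<phi>. psh_comp K \<psi> \<phi>) \<rparr>"

definition lifts ::
    "('u, 'l) lpsh \<Rightarrow> nat \<Rightarrow> (nat \<Rightarrow> (bool list \<Rightarrow> bool list) \<Rightarrow> 'u) \<Rightarrow>
     (nat \<Rightarrow> (bool list \<Rightarrow> bool list) \<Rightarrow> 'l list) \<Rightarrow>
     (nat \<Rightarrow> (bool list \<Rightarrow> bool list) \<Rightarrow> 'u) set" where
  "lifts = (\<lambda>(K, lab) p b t.
     {k \<in> psh_hom (std_cube p) K.
        psh_comp (boundary p) k (psh_incl (boundary p)) = b \<and> psh_comp (std_cube p) lab k = t})"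

definition HDA_paradigm :: "'l set \<Rightarrow> ('u, 'l) lpsh \<Rightarrow> bool" where
  "HDA_paradigm \<Sigma> = (\<lambda>(K, lab).
     \<forall>p\<ge>2. \<forall>b\<in>psh_hom (boundary p) K. \<forall>t\<in>psh_hom (std_cube p) (bang \<Sigma>).
       psh_comp (boundary p) lab b = psh_comp (boundary p) t (psh_incl (boundary p)) \<longrightarrow>
       (\<forall>k\<in>lifts (K, lab) p b t. \<forall>k'\<in>lifts (K, lab) p b t. k = k'))"

definition HDA ::
    "'u itself \<Rightarrow> 'l set \<Rightarrow> (('u, 'l) lpsh, nat \<Rightarrow> 'u \<Rightarrow> 'u) cat" where
  "HDA U \<Sigma> = full_subcat_on (labelled_sets U \<Sigma>) (HDA_paradigm \<Sigma>)"

end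

theory Submission
  imports Defs
begin

text \<open>
  The HDA paradigm is a separation condition. A lift of a \<open>p\<close>-cube against its boundary and its label is,
  by the Yoneda lemma, a \<open>p\<close>-cube with prescribed proper faces and prescribed label; so the paradigm says
  that a cube of dimension at least two is determined by its label and its proper faces. By induction on
  the dimension, this holds if and only if every cube is determined by its label, its vertices and its
  edges (\<open>Obj_HDA\<close>). In this form the condition no longer mentions faces of higher dimension.

  \<^emph>\<open>Reflection.\<close> Being of the same shape, that is, having the same label, vertices and edges, is a
  congruence on any labelled symmetric precubical set. It is trivial in dimensions zero and one, so the
  quotient by it is separated, and every morphism to a separated object factors through this quotient
  (\<open>ex_reflection\<close>). A choice of universal arrows yields the left adjoint.

  \<^emph>\<open>Colimits.\<close> The colimit of a small diagram of separated objects is the quotient of the coproduct that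
  identifies two cells with the same label if all cocones with separated vertex do (\<open>HDA_has_colimit\<close>).
  The quotient is again small, and it is in bijection with a subset of \<open>'u\<close>.

  \<^emph>\<open>Presentability.\<close> Separatedness involves only finitely many faces of a given cube, hence is
  inherited by the colimit of a directed diagram formed in all labelled presheaves. So in a directed
  colimit of separated objects every cell comes from a stage, and two cells that are identified are
  identified at a stage (\<open>colimit_cover_and_identify\<close>). It follows that an object with finitely many
  cells in total is finitely presentable: a morphism out of it amounts to finitely many cells that satisfy
  finitely many equations. Every cell has finitely many faces, so every object is the directed
  union of its finite subobjects, which are separated because the ambient object is. Up to isomorphism,
  the finite objects form a small set, and the category is locally finitely presentable
  (\<open>locally_presentable_HDA\<close>).
\<close>

section \<open>Small sets\<close>

lemma small_subset: "small U B \<Longrightarrow> A \<subseteq> B \<Longrightarrow> small U A"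
  unfolding small_def by (meson card_of_mono1 ordLeq_ordLess_trans)

lemma small_image: "small U A \<Longrightarrow> small U (f ` A)"
  unfolding small_def by (meson card_of_image ordLeq_ordLess_trans)

lemma small_inj_on: "small U (f ` A) \<Longrightarrow> inj_on f A \<Longrightarrow> small U A"
  using small_image[of U "f ` A" "inv_into A f"] by (simp add: inj_on_def)

lemma small_imp_inj_on:
  assumes "small TYPE('u) (A :: 'a set)"
  shows "\<exists>g :: 'a \<Rightarrow> 'u. inj_on g A"
  using assms unfolding small_def by (meson card_of_ordLeq ordLess_imp_ordLeq)

lemma small_countable:
  assumes "size_universe TYPE('u)" and "\<exists>f :: 'a \<Rightarrow> nat. inj_on f A"
  shows "small TYPE('u) A"
proof -
  have "|A| \<le>o natLeq"
    using assms(2) by (metis card_of_nat card_of_ordLeq ordLeq_ordIso_trans top_greatest)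
  with assms(1) show ?thesis
    unfolding small_def size_universe_def using ordLeq_ordLess_trans by blast
qed

lemma small_nat: "size_universe TYPE('u) \<Longrightarrow> small TYPE('u) (A :: nat set)"
  by (rule small_countable) (auto intro: inj_on_id)

lemma small_finite: "size_universe TYPE('u) \<Longrightarrow> finite A \<Longrightarrow> small TYPE('u) A"
  by (rule small_countable) (auto dest: finite_imp_inj_to_nat_seg)

lemma small_UNION:
  assumes "size_universe TYPE('u)" "small TYPE('u) I" "\<And>i. i \<in> I \<Longrightarrow> small TYPE('u) (A i)"
  shows "small TYPE('u) (\<Union>i\<in>I. A i)"
proof -
  have "Cinfinite |UNIV :: 'u set|"
    using assms(1) unfolding size_universe_def cinfinite_def
    by (metis Field_card_of card_of_Card_order infinite_iff_natLeq_ordLeq ordLess_imp_ordLeq)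
  with assms show ?thesis
    unfolding small_def size_universe_def using regularCard_UNION_bound by blast
qed

lemma small_Sigma:
  assumes "size_universe TYPE('u)" "small TYPE('u) I" "\<And>i. i \<in> I \<Longrightarrow> small TYPE('u) (A i)"
  shows "small TYPE('u) (Sigma I A)"
proof -
  have "Sigma I A = (\<Union>i\<in>I. Pair i ` A i)" by auto
  with assms show ?thesis by (simp add: small_UNION small_image)
qed

lemma small_lists:
  assumes U: "size_universe TYPE('u)" and A: "small TYPE('u) A"
  shows "small TYPE('u) (lists A)"
proof -
  have "small TYPE('u) {xs \<in> lists A. length xs = n}" for n
  proof (induction n)
    case 0
    have "finite {xs \<in> lists A. length xs = 0}"
      by (rule finite_subset[of _ "{[]}"]) auto
    then show ?case by (rule small_finite[OF U])
  next
    case (Suc n)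
    have "xs \<in> (\<lambda>(x, xs). x # xs) ` (A \<times> {xs \<in> lists A. length xs = n})"
      if "xs \<in> lists A" "length xs = Suc n" for xs
    proof (cases xs)
      case (Cons y ys)
      then show ?thesis using that by (intro image_eqI[of _ _ "(y, ys)"]) simp_all
    qed (use that in simp)
    then have "{xs \<in> lists A. length xs = Suc n} \<subseteq>
        (\<lambda>(x, xs). x # xs) ` (A \<times> {xs \<in> lists A. length xs = n})"
      by blast
    moreover have "small TYPE('u) (A \<times> {xs \<in> lists A. length xs = n})"
      by (rule small_Sigma[OF U A Suc])
    ultimately show ?case by (blast intro: small_subset[OF small_image])
  qed
  then have "small TYPE('u) (\<Union>n. {xs \<in> lists A. length xs = n})"
    by (intro small_UNION[OF U small_nat[OF U]])
  then show ?thesis by (rule small_subset) blast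
qed

lemma small_Fpow:
  assumes "size_universe TYPE('u)" "small TYPE('u) A"
  shows "small TYPE('u) (Fpow A)"
proof -
  have "Fpow A \<subseteq> set ` lists A"
    proof
    fix B assume "B \<in> Fpow A"
    then have "finite B" "B \<subseteq> A" by (auto simp: Fpow_def)
    from finite_list[OF this(1)] obtain xs where xs: "set xs = B" by blast
    with \<open>B \<subseteq> A\<close> have "xs \<in> lists A" by (simp add: subset_iff in_lists_conv_set)
    with xs show "B \<in> set ` lists A" by blast
  qed
  then show ?thesis by (rule small_subset[OF small_image[OF small_lists[OF assms]]])
qed

lemma small_Pow:
  assumes "power_closed TYPE('u)" "small TYPE('u) (A :: 'a set)"
  shows "small TYPE('u) (Pow A)"
proof -
  obtain g :: "'a \<Rightarrow> 'u" where g: "inj_on g A" using small_imp_inj_on[OF assms(2)] by blast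
  have "small TYPE('u) (Pow (g ` A))"
    using assms(1) small_image[OF assms(2)] unfolding power_closed_def by blast
  then have "small TYPE('u) ((\<lambda>B. g ` B) ` Pow A)" by (simp add: image_Pow_surj)
  then show ?thesis by (rule small_inj_on[OF _ inj_on_image_Pow[OF g]])
qed

section \<open>Categories, functors and universal arrows\<close>

lemma
  assumes "category C"
  shows category_Ide: "a \<in> Obj C \<Longrightarrow> Ide C a \<in> Hom C a a"
    and category_Comp: "a \<in> Obj C \<Longrightarrow> b \<in> Obj C \<Longrightarrow> c \<in> Obj C \<Longrightarrow> f \<in> Hom C a b \<Longrightarrow>
      g \<in> Hom C b c \<Longrightarrow> Comp C a b c g f \<in> Hom C a c"
    and category_Ide_Comp: "a \<in> Obj C \<Longrightarrow> b \<in> Obj C \<Longrightarrow> f \<in> Hom C a b \<Longrightarrow> Comp C a b b (Ide C b) f = f"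
    and category_Comp_Ide: "a \<in> Obj C \<Longrightarrow> b \<in> Obj C \<Longrightarrow> f \<in> Hom C a b \<Longrightarrow> Comp C a a b f (Ide C a) = f"
    and category_assoc: "a \<in> Obj C \<Longrightarrow> b \<in> Obj C \<Longrightarrow> c \<in> Obj C \<Longrightarrow> d \<in> Obj C \<Longrightarrow>
      f \<in> Hom C a b \<Longrightarrow> g \<in> Hom C b c \<Longrightarrow> h \<in> Hom C c d \<Longrightarrow>
      Comp C a c d h (Comp C a b c g f) = Comp C a b d (Comp C b c d h g) f"
proof -
  note * = assms[unfolded category_def]
  show "a \<in> Obj C \<Longrightarrow> Ide C a \<in> Hom C a a"
    using conjunct1[OF *] by blast
  show "a \<in> Obj C \<Longrightarrow> b \<in> Obj C \<Longrightarrow> c \<in> Obj C \<Longrightarrow> f \<in> Hom C a b \<Longrightarrow>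
      g \<in> Hom C b c \<Longrightarrow> Comp C a b c g f \<in> Hom C a c"
    using conjunct1[OF conjunct2[OF *]] by blast
  show "a \<in> Obj C \<Longrightarrow> b \<in> Obj C \<Longrightarrow> f \<in> Hom C a b \<Longrightarrow> Comp C a b b (Ide C b) f = f"
    and "a \<in> Obj C \<Longrightarrow> b \<in> Obj C \<Longrightarrow> f \<in> Hom C a b \<Longrightarrow> Comp C a a b f (Ide C a) = f"
    using conjunct1[OF conjunct2[OF conjunct2[OF *]]] by blast+
  show "a \<in> Obj C \<Longrightarrow> b \<in> Obj C \<Longrightarrow> c \<in> Obj C \<Longrightarrow> d \<in> Obj C \<Longrightarrow>
      f \<in> Hom C a b \<Longrightarrow> g \<in> Hom C b c \<Longrightarrow> h \<in> Hom C c d \<Longrightarrow>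
      Comp C a c d h (Comp C a b c g f) = Comp C a b d (Comp C b c d h g) f"
    using conjunct2[OF conjunct2[OF conjunct2[OF *]]] by blast
qed

lemma
  assumes "full_subcategory D C"
  shows full_subcategoryD: "category C" "category D" "a \<in> Obj D \<Longrightarrow> a \<in> Obj C"
    "a \<in> Obj D \<Longrightarrow> Ide D a = Ide C a"
    "a \<in> Obj D \<Longrightarrow> b \<in> Obj D \<Longrightarrow> Hom D a b = Hom C a b"
    "a \<in> Obj D \<Longrightarrow> b \<in> Obj D \<Longrightarrow> c \<in> Obj D \<Longrightarrow> f \<in> Hom C a b \<Longrightarrow>
      g \<in> Hom C b c \<Longrightarrow> Comp D a b c g f = Comp C a b c g f"
proof -
  note * = assms[unfolded full_subcategory_def]
  show "category C" "category D" using * by blast+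
  show "a \<in> Obj D \<Longrightarrow> a \<in> Obj C" using * by blast
  show "a \<in> Obj D \<Longrightarrow> Ide D a = Ide C a" using * by simp
  show "a \<in> Obj D \<Longrightarrow> b \<in> Obj D \<Longrightarrow> Hom D a b = Hom C a b" using * by simp
  show "a \<in> Obj D \<Longrightarrow> b \<in> Obj D \<Longrightarrow> c \<in> Obj D \<Longrightarrow> f \<in> Hom C a b \<Longrightarrow>
      g \<in> Hom C b c \<Longrightarrow> Comp D a b c g f = Comp C a b c g f" using * by simp
qed

lemma is_functorD:
  assumes "is_functor C D F"
  shows "category C" "category D" "a \<in> Obj C \<Longrightarrow> on_ob F a \<in> Obj D"
    "a \<in> Obj C \<Longrightarrow> b \<in> Obj C \<Longrightarrow> f \<in> Hom C a b \<Longrightarrow> on_ar F a b f \<in> Hom D (on_ob F a) (on_ob F b)"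
    "a \<in> Obj C \<Longrightarrow> on_ar F a a (Ide C a) = Ide D (on_ob F a)"
    "a \<in> Obj C \<Longrightarrow> b \<in> Obj C \<Longrightarrow> c \<in> Obj C \<Longrightarrow> f \<in> Hom C a b \<Longrightarrow> g \<in> Hom C b c \<Longrightarrow>
      on_ar F a c (Comp C a b c g f) =
      Comp D (on_ob F a) (on_ob F b) (on_ob F c) (on_ar F b c g) (on_ar F a b f)"
proof -
  note * = assms[unfolded is_functor_def]
  show "category C" "category D" using * by blast+
  show "a \<in> Obj C \<Longrightarrow> on_ob F a \<in> Obj D" using * by blast
  show "a \<in> Obj C \<Longrightarrow> b \<in> Obj C \<Longrightarrow> f \<in> Hom C a b \<Longrightarrow> on_ar F a b f \<in> Hom D (on_ob F a) (on_ob F b)"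
    using * by blast
  show "a \<in> Obj C \<Longrightarrow> on_ar F a a (Ide C a) = Ide D (on_ob F a)" using * by blast
  show "a \<in> Obj C \<Longrightarrow> b \<in> Obj C \<Longrightarrow> c \<in> Obj C \<Longrightarrow> f \<in> Hom C a b \<Longrightarrow> g \<in> Hom C b c \<Longrightarrow>
      on_ar F a c (Comp C a b c g f) =
      Comp D (on_ob F a) (on_ob F b) (on_ob F c) (on_ar F b c g) (on_ar F a b f)"
    using * by blast
qed

text \<open>
  Universal arrows assemble into a left adjoint: the functor sends \<open>f : x \<rightarrow> y\<close> to the factorisation
  of \<open>\<eta> y \<circ> f\<close> through \<open>\<eta> x\<close>, and precomposition with \<open>\<eta>\<close> is the bijection of hom-sets.
  Functoriality holds because two maps from \<open>R x\<close> into an object of \<open>D\<close> are equal if they are so after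
  composition with \<open>\<eta> x\<close>.
\<close>

lemma left_adjoint_of_universal_arrows:
  assumes DC: "full_subcategory D C"
    and ex: "\<And>x. x \<in> Obj C \<Longrightarrow> \<exists>r \<eta>. r \<in> Obj D \<and> \<eta> \<in> Hom C x r \<and>
      (\<forall>y\<in>Obj D. \<forall>h\<in>Hom C x y. \<exists>!u. u \<in> Hom C r y \<and> Comp C x r y u \<eta> = h)"
  shows "\<exists>F. left_adjoint C D F inclusion"
proof -
  note C = full_subcategoryD(1)[OF DC] and D = full_subcategoryD(2)[OF DC]
  note sub = full_subcategoryD(3)[OF DC] and Ide = full_subcategoryD(4)[OF DC]
    and Hom = full_subcategoryD(5)[OF DC] and Comp = full_subcategoryD(6)[OF DC]
  note ide = category_Ide[OF C] and comp = category_Comp[OF C] and assoc = category_assoc[OF C]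
    and unit = category_Ide_Comp[OF C] category_Comp_Ide[OF C]
  obtain R \<eta> where R: "\<And>x. x \<in> Obj C \<Longrightarrow> R x \<in> Obj D" and \<eta>: "\<And>x. x \<in> Obj C \<Longrightarrow> \<eta> x \<in> Hom C x (R x)"
    and univ: "\<And>x y h. x \<in> Obj C \<Longrightarrow> y \<in> Obj D \<Longrightarrow> h \<in> Hom C x y \<Longrightarrow>
      \<exists>!u. u \<in> Hom C (R x) y \<and> Comp C x (R x) y u (\<eta> x) = h"
    using ex by metis
  have RC: "\<And>x. x \<in> Obj C \<Longrightarrow> R x \<in> Obj C" using R sub by blast
  have uniq: "u = v" if "x \<in> Obj C" "y \<in> Obj D" "u \<in> Hom C (R x) y" "v \<in> Hom C (R x) y"
    "Comp C x (R x) y u (\<eta> x) = Comp C x (R x) y v (\<eta> x)" for x y u v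
    using univ[OF that(1,2) comp[OF that(1) RC sub \<eta> that(3)]] that by auto
  define F where "F x y f = (THE u. u \<in> Hom C (R x) (R y) \<and>
      Comp C x (R x) (R y) u (\<eta> x) = Comp C x y (R y) (\<eta> y) f)" for x y f
  have F: "F x y f \<in> Hom C (R x) (R y)"
      "Comp C x (R x) (R y) (F x y f) (\<eta> x) = Comp C x y (R y) (\<eta> y) f"
    if "x \<in> Obj C" "y \<in> Obj C" "f \<in> Hom C x y" for x y f
    using theI'[OF univ[OF that(1) R[OF that(2)] comp[OF that(1,2) RC[OF that(2)] that(3) \<eta>[OF that(2)]]]]
    by (auto simp: F_def)
  let ?F = "\<lparr>on_ob = R, on_ar = F\<rparr>"
  have F_id: "F x x (Ide C x) = Ide C (R x)" if x: "x \<in> Obj C" for x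
    by (rule uniq[OF x R[OF x]]) (simp_all add: F x ide RC unit \<eta>)
  have F_comp: "F x z (Comp C x y z g f) = Comp C (R x) (R y) (R z) (F y z g) (F x y f)"
    if x: "x \<in> Obj C" and y: "y \<in> Obj C" and z: "z \<in> Obj C" and f: "f \<in> Hom C x y"
      and g: "g \<in> Hom C y z" for x y z f g
  proof (rule uniq[OF x R[OF z]])
    note [simp] = x y z RC
    have gf: "Comp C x y z g f \<in> Hom C x z" by (rule comp[OF x y z f g])
    show "F x z (Comp C x y z g f) \<in> Hom C (R x) (R z)" by (rule F(1)[OF x z gf])
    show "Comp C (R x) (R y) (R z) (F y z g) (F x y f) \<in> Hom C (R x) (R z)"
      by (intro comp F f g RC x y z)
    have "Comp C x (R x) (R z) (Comp C (R x) (R y) (R z) (F y z g) (F x y f)) (\<eta> x) =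
        Comp C x (R y) (R z) (F y z g) (Comp C x (R x) (R y) (F x y f) (\<eta> x))"
      by (rule assoc[symmetric]) (simp_all add: F f g \<eta>)
    also have "\<dots> = Comp C x (R y) (R z) (F y z g) (Comp C x y (R y) (\<eta> y) f)"
      by (simp add: F f)
    also have "\<dots> = Comp C x y (R z) (Comp C y (R y) (R z) (F y z g) (\<eta> y)) f"
      by (rule assoc) (simp_all add: F f g \<eta>)
    also have "\<dots> = Comp C x y (R z) (Comp C y z (R z) (\<eta> z) g) f"
      by (simp add: F g)
    also have "\<dots> = Comp C x z (R z) (\<eta> z) (Comp C x y z g f)"
      by (rule assoc[symmetric]) (simp_all add: f g \<eta>)
    also have "\<dots> = Comp C x (R x) (R z) (F x z (Comp C x y z g f)) (\<eta> x)"
      by (simp add: F gf)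
    finally show "Comp C x (R x) (R z) (F x z (Comp C x y z g f)) (\<eta> x) =
        Comp C x (R x) (R z) (Comp C (R x) (R y) (R z) (F y z g) (F x y f)) (\<eta> x)" ..
  qed
  have F_functor: "is_functor C D ?F"
    using C D by (auto simp: is_functor_def R F F_id F_comp Ide Hom Comp)
  have incl: "is_functor D C inclusion"
    using C D by (auto simp: is_functor_def inclusion_def sub Ide Hom Comp)
  define \<phi> where "\<phi> x y u = Comp C x (R x) y u (\<eta> x)" for x y u
  have bij: "bij_betw (\<phi> x y) (Hom C (R x) y) (Hom C x y)" if x: "x \<in> Obj C" and y: "y \<in> Obj D" for x y
  proof (rule bij_betw_imageI)
    show "inj_on (\<phi> x y) (Hom C (R x) y)"
      using uniq[OF x y] by (auto simp: inj_on_def \<phi>_def)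
    show "\<phi> x y ` Hom C (R x) y = Hom C x y"
    proof (intro equalityI subsetI)
      fix h assume "h \<in> Hom C x y"
      from univ[OF x y this] show "h \<in> \<phi> x y ` Hom C (R x) y" by (auto simp: \<phi>_def)
    qed (auto simp: \<phi>_def intro: comp x sub[OF y] RC \<eta>)
  qed
  have nat_dom: "\<phi> x' y (Comp D (R x') (R x) y h (F x' x f)) = Comp C x' x y (\<phi> x y h) f"
    if x: "x \<in> Obj C" and x': "x' \<in> Obj C" and y: "y \<in> Obj D" and f: "f \<in> Hom C x' x"
      and h: "h \<in> Hom C (R x) y" for x x' y f h
  proof -
    note [simp] = x x' y RC R sub[OF y]
    have "\<phi> x' y (Comp D (R x') (R x) y h (F x' x f)) =
        Comp C x' (R x') y (Comp C (R x') (R x) y h (F x' x f)) (\<eta> x')"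
      by (simp add: \<phi>_def Comp F f h)
    also have "\<dots> = Comp C x' (R x) y h (Comp C x' (R x') (R x) (F x' x f) (\<eta> x'))"
      by (rule assoc[symmetric]) (simp_all add: F f h \<eta>)
    also have "\<dots> = Comp C x' (R x) y h (Comp C x' x (R x) (\<eta> x) f)"
      by (simp add: F f)
    also have "\<dots> = Comp C x' x y (Comp C x (R x) y h (\<eta> x)) f"
      by (rule assoc) (simp_all add: f h \<eta>)
    finally show ?thesis by (simp add: \<phi>_def)
  qed
  have nat_cod: "\<phi> x y' (Comp D (R x) y y' g h) = Comp C x y y' g (\<phi> x y h)"
    if x: "x \<in> Obj C" and y: "y \<in> Obj D" and y': "y' \<in> Obj D" and g: "g \<in> Hom C y y'"
      and h: "h \<in> Hom C (R x) y" for x y y' g h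
    using assoc[OF x RC[OF x] sub[OF y] sub[OF y'] \<eta>[OF x] h g]
    by (simp add: \<phi>_def Comp[OF R[OF x] y y' h g])
  have "left_adjoint C D ?F inclusion"
    unfolding left_adjoint_def
    by (intro conjI F_functor incl exI[of _ \<phi>] ballI)
      (simp_all add: inclusion_def Hom R bij nat_dom nat_cod)
  then show ?thesis by blast
qed

section \<open>Labelled presheaves over arbitrary types\<close>

lemma Hom_box_le: "f \<in> Hom box m n \<Longrightarrow> m \<le> n"
proof -
  have "box_map m n f \<Longrightarrow> m \<le> n"
    by (induction rule: box_map.induct) auto
  then show "f \<in> Hom box m n \<Longrightarrow> m \<le> n" by (simp add: box_def)
qed

lemma finite_Hom_box: "finite (Hom box m n)"
proof (rule finite_subset)
  show "Hom box m n \<subseteq> cube m \<rightarrow>\<^sub>E cube n"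
    by (rule subsetI, rule PiE_I)
      (auto simp: box_def intro: box_map_cube extensional_arb[OF box_map_extensional])
  have "finite (cube k)" for k
    using finite_lists_length_eq[of "UNIV :: bool set" k] by (simp add: cube_def)
  then show "finite (cube m \<rightarrow>\<^sub>E cube n)" by (intro finite_PiE)
qed

lemma
  shows Ide_box: "Ide box n \<in> Hom box n n"
    and Comp_box: "f \<in> Hom box l m \<Longrightarrow> g \<in> Hom box m n \<Longrightarrow> Comp box l m n g f \<in> Hom box l n"
    and Comp_box_Ide: "f \<in> Hom box m n \<Longrightarrow> Comp box m n n (Ide box n) f = f"
    and Comp_Ide_box: "f \<in> Hom box m n \<Longrightarrow> Comp box m m n f (Ide box m) = f"
    and Comp_box_assoc: "f \<in> Hom box k l \<Longrightarrow> g \<in> Hom box l m \<Longrightarrow> h \<in> Hom box m n \<Longrightarrow>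
        Comp box k m n h (Comp box k l m g f) = Comp box k l n (Comp box l m n h g) f"
proof -
  have obj: "k \<in> Obj box" for k by (simp add: box_def)
  show "Ide box n \<in> Hom box n n"
    and "f \<in> Hom box l m \<Longrightarrow> g \<in> Hom box m n \<Longrightarrow> Comp box l m n g f \<in> Hom box l n"
    and "f \<in> Hom box m n \<Longrightarrow> Comp box m n n (Ide box n) f = f"
    and "f \<in> Hom box m n \<Longrightarrow> Comp box m m n f (Ide box m) = f"
    and "f \<in> Hom box k l \<Longrightarrow> g \<in> Hom box l m \<Longrightarrow> h \<in> Hom box m n \<Longrightarrow>
        Comp box k m n h (Comp box k l m g f) = Comp box k l n (Comp box l m n h g) f"
    using category_Ide[OF category_box obj] category_Comp[OF category_box obj obj obj]
      category_Ide_Comp[OF category_box obj obj] category_Comp_Ide[OF category_box obj obj]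
      category_assoc[OF category_box obj obj obj obj]
    by simp_all
qed

text \<open>
  The objects of \<open>labelled_sets\<close> have their cells in \<open>'u\<close>, but coproducts of them, from which
  colimits are made, have not. Objects and morphisms are therefore considered over any type.
\<close>

abbreviation cell :: "('a, 'l) lpsh \<Rightarrow> nat \<Rightarrow> 'a set" where
  "cell X \<equiv> cells (fst X)"

abbreviation pull :: "('a, 'l) lpsh \<Rightarrow> nat \<Rightarrow> nat \<Rightarrow> (bool list \<Rightarrow> bool list) \<Rightarrow> 'a \<Rightarrow> 'a" where
  "pull X \<equiv> act (fst X)"

definition labelled :: "'l set \<Rightarrow> ('a, 'l) lpsh \<Rightarrow> bool" where
  "labelled \<Sigma> X \<longleftrightarrow> sym_precubical_set (fst X) \<and> snd X \<in> psh_hom (fst X) (bang \<Sigma>)"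

definition lhom :: "('a, 'l) lpsh \<Rightarrow> ('b, 'l) lpsh \<Rightarrow> (nat \<Rightarrow> 'a \<Rightarrow> 'b) set" where
  "lhom X Y = {\<phi> \<in> psh_hom (fst X) (fst Y). psh_comp (fst X) (snd Y) \<phi> = snd X}"

lemma labelled_iff:
  "labelled \<Sigma> X \<longleftrightarrow>
     (\<forall>m n. pull X m n \<in> Hom box m n \<rightarrow>\<^sub>E (cell X n \<rightarrow>\<^sub>E cell X m)) \<and>
     (\<forall>n. \<forall>x\<in>cell X n. pull X n n (Ide box n) x = x) \<and>
     (\<forall>l m n. \<forall>f\<in>Hom box l m. \<forall>g\<in>Hom box m n. \<forall>x\<in>cell X n.
        pull X l n (Comp box l m n g f) x = pull X l m f (pull X m n g x)) \<and>
     (\<forall>n. snd X n \<in> cell X n \<rightarrow>\<^sub>E words \<Sigma> n) \<and>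
     (\<forall>m n. \<forall>f\<in>Hom box m n. \<forall>x\<in>cell X n.
        snd X m (pull X m n f x) = act (bang \<Sigma>) m n f (snd X n x))"
proof -
  have "cells (bang \<Sigma>) = words \<Sigma>" by (simp add: bang_def)
  then show ?thesis unfolding labelled_def sym_precubical_set_def psh_hom_def by auto
qed

lemma PiE_PiE_mem: "F \<in> A \<rightarrow>\<^sub>E (B \<rightarrow>\<^sub>E C) \<Longrightarrow> f \<in> A \<Longrightarrow> x \<in> B \<Longrightarrow> F f x \<in> C"
  by (auto simp: PiE_iff)

lemma
  assumes "labelled \<Sigma> X"
  shows pull_in: "f \<in> Hom box m n \<Longrightarrow> x \<in> cell X n \<Longrightarrow> pull X m n f x \<in> cell X m"
    and pull_Ide: "x \<in> cell X n \<Longrightarrow> pull X n n (Ide box n) x = x"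
    and pull_Comp: "f \<in> Hom box l m \<Longrightarrow> g \<in> Hom box m n \<Longrightarrow> x \<in> cell X n \<Longrightarrow>
        pull X l n (Comp box l m n g f) x = pull X l m f (pull X m n g x)"
    and label_in: "x \<in> cell X n \<Longrightarrow> snd X n x \<in> words \<Sigma> n"
    and label_pull: "f \<in> Hom box m n \<Longrightarrow> x \<in> cell X n \<Longrightarrow>
        snd X m (pull X m n f x) = act (bang \<Sigma>) m n f (snd X n x)"
proof -
  have maps: "pull X m n \<in> Hom box m n \<rightarrow>\<^sub>E (cell X n \<rightarrow>\<^sub>E cell X m)"
    "snd X n \<in> cell X n \<rightarrow>\<^sub>E words \<Sigma> n" for m n
    using assms by (simp_all only: labelled_iff)
  show "f \<in> Hom box m n \<Longrightarrow> x \<in> cell X n \<Longrightarrow> pull X m n f x \<in> cell X m"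
    by (rule PiE_PiE_mem[OF maps(1)])
  show "x \<in> cell X n \<Longrightarrow> snd X n x \<in> words \<Sigma> n"
    by (rule PiE_mem[OF maps(2)])
qed (use assms in \<open>simp_all only: labelled_iff\<close>)

lemma psh_comp_apply [simp]: "x \<in> cells K n \<Longrightarrow> psh_comp K \<psi> \<phi> n x = \<psi> n (\<phi> n x)"
  by (simp add: psh_comp_def compose_def)

lemma psh_incl_apply [simp]: "x \<in> cells K n \<Longrightarrow> psh_incl K n x = x"
  by (simp add: psh_incl_def)

lemma psh_comp_extensional: "psh_comp K \<psi> \<phi> n \<in> extensional (cells K n)"
  by (simp add: psh_comp_def compose_def)

lemma psh_homI:
  assumes "\<And>n. \<phi> n \<in> extensional (cells K n)"
    and "\<And>n x. x \<in> cells K n \<Longrightarrow> \<phi> n x \<in> cells L n"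
    and "\<And>m n f x. f \<in> Hom box m n \<Longrightarrow> x \<in> cells K n \<Longrightarrow> \<phi> m (act K m n f x) = act L m n f (\<phi> n x)"
  shows "\<phi> \<in> psh_hom K L"
  using assms by (simp add: psh_hom_def PiE_iff)

lemma
  assumes "\<phi> \<in> psh_hom K L"
  shows psh_hom_in: "x \<in> cells K n \<Longrightarrow> \<phi> n x \<in> cells L n"
    and psh_hom_act: "f \<in> Hom box m n \<Longrightarrow> x \<in> cells K n \<Longrightarrow> \<phi> m (act K m n f x) = act L m n f (\<phi> n x)"
    and psh_hom_extensional: "\<phi> n \<in> extensional (cells K n)"
  using assms by (auto simp: psh_hom_def PiE_iff)

lemma psh_hom_eqI:
  assumes "\<phi> \<in> psh_hom K L" "\<psi> \<in> psh_hom K M" "\<And>n x. x \<in> cells K n \<Longrightarrow> \<phi> n x = \<psi> n x"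
  shows "\<phi> = \<psi>"
proof
  show "\<phi> n = \<psi> n" for n
    by (rule extensionalityI[of _ "cells K n"]) (use assms psh_hom_extensional in blast)+
qed

lemma psh_hom_comp: "\<phi> \<in> psh_hom K L \<Longrightarrow> \<psi> \<in> psh_hom L M \<Longrightarrow> sym_precubical_set K \<Longrightarrow>
    psh_comp K \<psi> \<phi> \<in> psh_hom K M"
proof (rule psh_homI)
  fix m n f x assume *: "\<phi> \<in> psh_hom K L" "\<psi> \<in> psh_hom L M" "sym_precubical_set K"
    "f \<in> Hom box m n" "x \<in> cells K n"
  then have "act K m n f x \<in> cells K m" 
    by (intro PiE_PiE_mem[of "act K m n" "Hom box m n"]) (auto simp: sym_precubical_set_def)
  with * show "psh_comp K \<psi> \<phi> m (act K m n f x) = act M m n f (psh_comp K \<psi> \<phi> n x)"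
    by (simp add: psh_hom_act psh_hom_in)
qed (auto simp: psh_comp_extensional psh_hom_in)

lemma lhomI:
  assumes "labelled \<Sigma> X"
    and "\<And>n. \<phi> n \<in> extensional (cell X n)"
    and "\<And>n x. x \<in> cell X n \<Longrightarrow> \<phi> n x \<in> cell Y n"
    and "\<And>m n f x. f \<in> Hom box m n \<Longrightarrow> x \<in> cell X n \<Longrightarrow>
      \<phi> m (pull X m n f x) = pull Y m n f (\<phi> n x)"
    and "\<And>n x. x \<in> cell X n \<Longrightarrow> snd Y n (\<phi> n x) = snd X n x"
  shows "\<phi> \<in> lhom X Y"
proof -
  have "psh_comp (fst X) (snd Y) \<phi> n = snd X n" for n
    by (rule extensionalityI[of _ "cell X n"])
      (use assms in \<open>auto simp: psh_comp_extensional labelled_iff PiE_iff\<close>)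
  with assms show ?thesis by (auto simp: lhom_def intro!: psh_homI)
qed

lemma
  assumes "\<phi> \<in> lhom X Y"
  shows lhom_in: "x \<in> cell X n \<Longrightarrow> \<phi> n x \<in> cell Y n"
    and lhom_pull: "f \<in> Hom box m n \<Longrightarrow> x \<in> cell X n \<Longrightarrow>
        \<phi> m (pull X m n f x) = pull Y m n f (\<phi> n x)"
    and lhom_extensional: "\<phi> n \<in> extensional (cell X n)"
    and lhom_label: "x \<in> cell X n \<Longrightarrow> snd Y n (\<phi> n x) = snd X n x"
proof -
  have \<phi>: "\<phi> \<in> psh_hom (fst X) (fst Y)" and lab: "psh_comp (fst X) (snd Y) \<phi> = snd X"
    using assms by (auto simp: lhom_def)
  show "x \<in> cell X n \<Longrightarrow> \<phi> n x \<in> cell Y n" by (rule psh_hom_in[OF \<phi>])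
  show "f \<in> Hom box m n \<Longrightarrow> x \<in> cell X n \<Longrightarrow> \<phi> m (pull X m n f x) = pull Y m n f (\<phi> n x)"
    by (rule psh_hom_act[OF \<phi>])
  show "\<phi> n \<in> extensional (cell X n)" by (rule psh_hom_extensional[OF \<phi>])
  show "x \<in> cell X n \<Longrightarrow> snd Y n (\<phi> n x) = snd X n x"
    by (subst lab[symmetric]) simp
qed

lemma lhom_eqI:
  assumes "\<phi> \<in> lhom X Y" "\<psi> \<in> lhom X Z" "\<And>n x. x \<in> cell X n \<Longrightarrow> \<phi> n x = \<psi> n x"
  shows "\<phi> = \<psi>"
  by (rule psh_hom_eqI[of _ "fst X"]) (use assms in \<open>auto simp: lhom_def\<close>)

lemma lhom_incl:
  assumes "labelled \<Sigma> X"
  shows "psh_incl (fst X) \<in> lhom X X"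
  by (rule lhomI[OF assms]) (auto simp: psh_incl_def pull_in[OF assms])

lemma lhom_comp:
  assumes "labelled \<Sigma> X" "\<phi> \<in> lhom X Y" "\<psi> \<in> lhom Y Z"
  shows "psh_comp (fst X) \<psi> \<phi> \<in> lhom X Z"
  by (rule lhomI[OF assms(1)])
    (simp_all add: psh_comp_extensional lhom_in[OF assms(2)] lhom_in[OF assms(3)]
      pull_in[OF assms(1)] lhom_pull[OF assms(2)] lhom_pull[OF assms(3)]
      lhom_label[OF assms(2)] lhom_label[OF assms(3)])

lemma psh_comp_assoc:
  assumes "\<phi> \<in> lhom X Y"
  shows "psh_comp (fst X) \<chi> (psh_comp (fst X) \<psi> \<phi>) = psh_comp (fst X) (psh_comp (fst Y) \<chi> \<psi>) \<phi>"
  by (rule ext, rule extensionalityI) (auto intro: psh_comp_extensional simp: lhom_in[OF assms])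

lemma
  assumes "\<phi> \<in> lhom X Y"
  shows psh_comp_incl: "psh_comp (fst X) \<phi> (psh_incl (fst X)) = \<phi>"
    and psh_incl_comp: "psh_comp (fst X) (psh_incl (fst Y)) \<phi> = \<phi>"
  by (rule ext, rule extensionalityI,
      auto intro: psh_comp_extensional lhom_extensional[OF assms] simp: lhom_in[OF assms])+

lemma labelled_sets_simps:
  "Obj (labelled_sets U \<Sigma>) = {X. labelled \<Sigma> X \<and> (\<forall>n. small U (cell X n))}"
  "Hom (labelled_sets U \<Sigma>) = lhom"
  "Ide (labelled_sets U \<Sigma>) = (\<lambda>X. psh_incl (fst X))"
  "Comp (labelled_sets U \<Sigma>) = (\<lambda>X Y Z \<psi> \<phi>. psh_comp (fst X) \<psi> \<phi>)"
  by (auto simp: labelled_sets_def labelled_def lhom_def fun_eq_iff)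

lemma HDA_simps:
  "Obj (HDA U \<Sigma>) = {X. labelled \<Sigma> X \<and> (\<forall>n. small U (cell X n)) \<and> HDA_paradigm \<Sigma> X}"
  "Hom (HDA U \<Sigma>) = lhom"
  "Ide (HDA U \<Sigma>) = (\<lambda>X. psh_incl (fst X))"
  "Comp (HDA U \<Sigma>) = (\<lambda>X Y Z \<psi> \<phi>. psh_comp (fst X) \<psi> \<phi>)"
  unfolding HDA_def full_subcat_on_def using labelled_sets_simps[of U \<Sigma>] by auto

lemma category_lhom:
  assumes "\<And>X. X \<in> Obj C \<Longrightarrow> labelled \<Sigma> X" and "Hom C = lhom"
    and "Ide C = (\<lambda>X. psh_incl (fst X))" and "Comp C = (\<lambda>X Y Z \<psi> \<phi>. psh_comp (fst X) \<psi> \<phi>)"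
  shows "category C"
  unfolding category_def assms(2-)
proof (intro conjI ballI)
  fix X Y Z \<phi> \<psi> assume "X \<in> Obj C" "\<phi> \<in> lhom X Y" "\<psi> \<in> lhom Y Z"
  then show "psh_comp (fst X) \<psi> \<phi> \<in> lhom X Z" by (intro lhom_comp) (auto intro: assms(1))
qed (auto simp: psh_comp_incl psh_incl_comp psh_comp_assoc intro: assms(1) lhom_incl)

lemma category_labelled_sets: "category (labelled_sets U \<Sigma>)"
  by (rule category_lhom[of _ \<Sigma>]) (auto simp: labelled_sets_simps)

lemma category_HDA: "category (HDA U \<Sigma>)"
  by (rule category_lhom[of _ \<Sigma>]) (auto simp: HDA_simps)

lemma full_subcategory_HDA: "full_subcategory (HDA U \<Sigma>) (labelled_sets U \<Sigma>)"
  by (auto simp: full_subcategory_def category_labelled_sets category_HDA HDA_simps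
      labelled_sets_simps)

section \<open>The HDA paradigm as separatedness\<close>

text \<open>
  Since \<open>f\<close> may be the identity, two vertices or two edges of the same shape are equal.
\<close>

definition same_shape :: "('a, 'l) lpsh \<Rightarrow> nat \<Rightarrow> 'a \<Rightarrow> 'a \<Rightarrow> bool" where
  "same_shape X n x y \<longleftrightarrow>
     snd X n x = snd X n y \<and> (\<forall>m\<le>1. \<forall>f\<in>Hom box m n. pull X m n f x = pull X m n f y)"

definition separated :: "('a, 'l) lpsh \<Rightarrow> bool" where
  "separated X \<longleftrightarrow> (\<forall>n. \<forall>x\<in>cell X n. \<forall>y\<in>cell X n. same_shape X n x y \<longrightarrow> x = y)"

lemma separatedD:
  "separated X \<Longrightarrow> x \<in> cell X n \<Longrightarrow> y \<in> cell X n \<Longrightarrow> same_shape X n x y \<Longrightarrow> x = y"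
  by (auto simp: separated_def)

lemma same_shape_pull:
  assumes X: "labelled \<Sigma> X" and f: "f \<in> Hom box m n" and x: "x \<in> cell X n" and y: "y \<in> cell X n"
    and "same_shape X n x y"
  shows "same_shape X m (pull X m n f x) (pull X m n f y)"
  using assms(5) f x y
  by (auto simp: same_shape_def label_pull[OF X] pull_Comp[OF X, symmetric] Comp_box)

text \<open>
  The map \<open>std_cube p \<rightarrow> X\<close> that corresponds to a \<open>p\<close>-cube \<open>x\<close> of \<open>X\<close> by the Yoneda lemma.
\<close>

definition cube_map :: "('a, 'l) lpsh \<Rightarrow> nat \<Rightarrow> 'a \<Rightarrow> nat \<Rightarrow> (bool list \<Rightarrow> bool list) \<Rightarrow> 'a" where
  "cube_map X p x = (\<lambda>n. \<lambda>f\<in>Hom box n p. pull X n p f x)"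

lemma std_cube_simps:
  "cells (std_cube p) n = Hom box n p"
  "f \<in> Hom box m n \<Longrightarrow> g \<in> Hom box n p \<Longrightarrow> act (std_cube p) m n f g = Comp box m n p g f"
  by (auto simp: std_cube_def)

lemma boundary_simps:
  "cells (boundary p) n = (if n < p then Hom box n p else {})"
  "f \<in> Hom box m n \<Longrightarrow> g \<in> cells (boundary p) n \<Longrightarrow> act (boundary p) m n f g = Comp box m n p g f"
  by (auto simp: boundary_def boundary_cells_def)

lemma cube_map_psh_hom:
  assumes X: "labelled \<Sigma> X" and x: "x \<in> cell X p"
  shows "cube_map X p x \<in> psh_hom (std_cube p) (fst X)"
  by (rule psh_homI)
    (auto simp: cube_map_def std_cube_simps Comp_box pull_in[OF X _ x] pull_Comp[OF X _ _ x])

lemma sym_precubical_set_std_cube: "sym_precubical_set (std_cube p)"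
  by (auto simp: sym_precubical_set_def std_cube_def Ide_box Comp_box Comp_Ide_box Comp_box_assoc)

lemma boundary_restrict:
  assumes "k \<in> psh_hom (std_cube p) K"
  shows "psh_comp (boundary p) k (psh_incl (boundary p)) \<in> psh_hom (boundary p) K"
proof (rule psh_homI)
  fix m n f x assume f: "f \<in> Hom box m n" and x: "x \<in> cells (boundary p) n"
  then have "n < p" and x': "x \<in> Hom box n p" by (auto simp: boundary_simps split: if_splits)
  with Hom_box_le[OF f] have "Comp box m n p x f \<in> cells (boundary p) m"
    using f by (auto simp: boundary_simps Comp_box)
  then show "psh_comp (boundary p) k (psh_incl (boundary p)) m (act (boundary p) m n f x) =
      act K m n f (psh_comp (boundary p) k (psh_incl (boundary p)) n x)"
    using psh_hom_act[OF assms, of f m n x] f x x' by (simp add: boundary_simps(2) std_cube_simps)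
next
  fix n x assume x: "x \<in> cells (boundary p) n"
  then have "x \<in> cells (std_cube p) n" by (auto simp: boundary_simps std_cube_simps split: if_splits)
  then show "psh_comp (boundary p) k (psh_incl (boundary p)) n x \<in> cells K n"
    using x by (simp add: psh_hom_in[OF assms])
qed (auto intro: psh_comp_extensional)

text \<open>
  A lift is determined by the \<open>p\<close>-cube that is the image of the identity of \<open>[p]\<close>. Two lifts in the
  same square give cubes with the same label and the same proper faces; as \<open>p \<ge> 2\<close>, all vertices and
  edges are among these faces.
\<close>

lemma separated_imp_HDA_paradigm:
  assumes X: "labelled \<Sigma> X" and sep: "separated X"
  shows "HDA_paradigm \<Sigma> X"
proof -
  obtain K lab where XK: "X = (K, lab)" by (cases X)
  have "k = k'" if p: "p \<ge> 2" and k: "k \<in> lifts (K, lab) p b t" and k': "k' \<in> lifts (K, lab) p b t"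
    for p b t k k'
  proof -
    have hom: "k \<in> psh_hom (std_cube p) K" "k' \<in> psh_hom (std_cube p) K"
      and bd: "psh_comp (boundary p) k (psh_incl (boundary p)) =
        psh_comp (boundary p) k' (psh_incl (boundary p))"
      and lab: "psh_comp (std_cube p) lab k = psh_comp (std_cube p) lab k'"
      using k k' by (auto simp: lifts_def)
    let ?id = "Ide box p"
    have id: "?id \<in> cells (std_cube p) p" by (simp add: std_cube_simps Ide_box)
    have faces: "l m f = act K m p f (l p ?id)"
      if "l \<in> psh_hom (std_cube p) K" "f \<in> Hom box m p" for l m f
      using psh_hom_act[OF that(1) that(2) id] that(2)
      by (simp add: std_cube_simps Ide_box Comp_box_Ide)
    have "k p ?id = k' p ?id"
    proof (rule separatedD[OF sep])
      show "k p ?id \<in> cell X p" "k' p ?id \<in> cell X p"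
        using hom id by (auto simp: XK psh_hom_in)
      have "lab p (k p ?id) = lab p (k' p ?id)"
        using fun_cong[OF fun_cong[OF lab, of p], of ?id] id by simp
      moreover have "act K m p f (k p ?id) = act K m p f (k' p ?id)"
        if "m \<le> 1" "f \<in> Hom box m p" for m f
      proof -
        have "f \<in> cells (boundary p) m" using that p by (simp add: boundary_simps)
        then have "k m f = k' m f"
          using fun_cong[OF fun_cong[OF bd, of m], of f] by simp
        with faces[OF hom(1) that(2)] faces[OF hom(2) that(2)] show ?thesis by simp
      qed
      ultimately show "same_shape X p (k p ?id) (k' p ?id)" by (auto simp: same_shape_def XK)
    qed
    then show ?thesis
      by (intro psh_hom_eqI[OF hom]) (simp add: std_cube_simps faces[OF hom(1)] faces[OF hom(2)])
  qed
  then show ?thesis by (auto simp: HDA_paradigm_def XK)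
qed

text \<open>
  Induction on the dimension. If two \<open>n\<close>-cubes have the same shape, so have their faces under any given
  map, whence their proper faces coincide by induction. For \<open>n \<ge> 2\<close> the two cubes are then two lifts in
  the square formed by their common boundary and their common label.
\<close>

lemma HDA_paradigm_imp_separated:
  assumes X: "labelled \<Sigma> X" and HDA: "HDA_paradigm \<Sigma> X"
  shows "separated X"
proof -
  obtain K lab where XK: "X = (K, lab)" by (cases X)
  have "x = y" if "x \<in> cell X n" "y \<in> cell X n" "same_shape X n x y" for n x y
    using that
  proof (induction n arbitrary: x y rule: less_induct)
    case (less n)
    show ?case
    proof (cases "n \<le> 1")
      case True
      then have "pull X n n (Ide box n) x = pull X n n (Ide box n) y"
        using less.prems(3) Ide_box by (auto simp: same_shape_def)
      then show ?thesis using less.prems pull_Ide[OF X] by simp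
    next
      case False
      let ?x = "cube_map X n x" and ?y = "cube_map X n y"
      let ?b = "psh_comp (boundary n) ?x (psh_incl (boundary n))"
      let ?t = "psh_comp (std_cube n) lab ?x"
      have hom: "?x \<in> psh_hom (std_cube n) K" "?y \<in> psh_hom (std_cube n) K"
        using cube_map_psh_hom[OF X] less.prems by (auto simp: XK)
      have lab: "lab \<in> psh_hom K (bang \<Sigma>)" using X by (simp add: labelled_def XK)
      have t: "?t \<in> psh_hom (std_cube n) (bang \<Sigma>)"
        by (rule psh_hom_comp[OF hom(1) lab sym_precubical_set_std_cube])
      have b: "?b \<in> psh_hom (boundary n) K" by (rule boundary_restrict[OF hom(1)])
      have square: "psh_comp (boundary n) lab ?b = psh_comp (boundary n) ?t (psh_incl (boundary n))"
        by (rule ext, rule extensionalityI, rule psh_comp_extensional, rule psh_comp_extensional)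
          (simp add: boundary_simps std_cube_simps split: if_splits)
      have faces: "pull X m n f x = pull X m n f y" if "m < n" "f \<in> Hom box m n" for m f
        using less that by (auto intro!: less.IH pull_in[OF X] same_shape_pull[OF X])
      have bd: "psh_comp (boundary n) ?y (psh_incl (boundary n)) = ?b"
        by (rule ext, rule extensionalityI, rule psh_comp_extensional, rule psh_comp_extensional)
          (auto simp: boundary_simps cube_map_def faces split: if_splits)
      have labels: "lab m (pull X m n f x) = lab m (pull X m n f y)" if "f \<in> Hom box m n" for m f
        using label_pull[OF X that] less.prems by (simp add: XK same_shape_def)
      have ty: "psh_comp (std_cube n) lab ?y = ?t"
        by (rule ext, rule extensionalityI, rule psh_comp_extensional, rule psh_comp_extensional)
          (simp add: std_cube_simps cube_map_def labels)
      have "?x \<in> lifts (K, lab) n ?b ?t" "?y \<in> lifts (K, lab) n ?b ?t"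
        using hom bd ty by (auto simp: lifts_def)
      moreover have "2 \<le> n" using False by simp
      ultimately have "?x = ?y"
        using HDA b t square unfolding HDA_paradigm_def XK by blast
      then have "?x n (Ide box n) = ?y n (Ide box n)" by simp
      then show ?thesis using less.prems by (simp add: cube_map_def Ide_box pull_Ide[OF X])
    qed
  qed
  then show ?thesis by (auto simp: separated_def)
qed

lemma Obj_HDA: "Obj (HDA U \<Sigma>) = {X. labelled \<Sigma> X \<and> (\<forall>n. small U (cell X n)) \<and> separated X}"
  unfolding HDA_simps using separated_imp_HDA_paradigm HDA_paradigm_imp_separated by blast

section \<open>Quotients and the reflection\<close>

text \<open>
  Quotients are taken along a family of functions \<open>q n\<close> whose kernels form a congruence, and the cells
  of the quotient are the values of \<open>q\<close>. So the choice of \<open>q\<close> also decides in which type, and in which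
  part of it, the quotient lives.
\<close>

definition congruent :: "('a, 'l) lpsh \<Rightarrow> (nat \<Rightarrow> 'a \<Rightarrow> 'b) \<Rightarrow> bool" where
  "congruent X q \<longleftrightarrow>
     (\<forall>n. \<forall>x\<in>cell X n. \<forall>y\<in>cell X n. q n x = q n y \<longrightarrow>
        snd X n x = snd X n y \<and>
        (\<forall>m. \<forall>f\<in>Hom box m n. q m (pull X m n f x) = q m (pull X m n f y)))"

definition quot :: "('a, 'l) lpsh \<Rightarrow> (nat \<Rightarrow> 'a \<Rightarrow> 'b) \<Rightarrow> ('b, 'l) lpsh" where
  "quot X q =
     (\<lparr> cells = (\<lambda>n. q n ` cell X n),
        act = (\<lambda>m n. \<lambda>f\<in>Hom box m n. \<lambda>z\<in>q n ` cell X n.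
                 q m (pull X m n f (inv_into (cell X n) (q n) z))) \<rparr>,
      \<lambda>n. \<lambda>z\<in>q n ` cell X n. snd X n (inv_into (cell X n) (q n) z))"

definition quot_map :: "('a, 'l) lpsh \<Rightarrow> (nat \<Rightarrow> 'a \<Rightarrow> 'b) \<Rightarrow> nat \<Rightarrow> 'a \<Rightarrow> 'b" where
  "quot_map X q = (\<lambda>n. \<lambda>x\<in>cell X n. q n x)"

lemma quot_map_apply [simp]: "x \<in> cell X n \<Longrightarrow> quot_map X q n x = q n x"
  by (simp add: quot_map_def)

lemma cell_quot: "cell (quot X q) n = q n ` cell X n"
  by (simp add: quot_def)

lemma
  assumes "congruent X q" "x \<in> cell X n"
  shows pull_quot: "f \<in> Hom box m n \<Longrightarrow> pull (quot X q) m n f (q n x) = q m (pull X m n f x)"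
    and label_quot: "snd (quot X q) n (q n x) = snd X n x"
proof -
  let ?y = "inv_into (cell X n) (q n) (q n x)"
  have y: "?y \<in> cell X n" "q n ?y = q n x"
    using assms(2) by (auto intro: inv_into_into f_inv_into_f)
  then have "snd X n ?y = snd X n x"
    and "f \<in> Hom box m n \<Longrightarrow> q m (pull X m n f ?y) = q m (pull X m n f x)"
    using assms unfolding congruent_def by blast+
  then show "f \<in> Hom box m n \<Longrightarrow> pull (quot X q) m n f (q n x) = q m (pull X m n f x)"
    and "snd (quot X q) n (q n x) = snd X n x"
    using assms(2) by (simp_all add: quot_def)
qed

lemma labelled_quot:
  assumes X: "labelled \<Sigma> X" and q: "congruent X q"
  shows "labelled \<Sigma> (quot X q)"
  unfolding labelled_iff
proof (intro conjI allI ballI)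
  fix m n
  have "pull (quot X q) m n f z \<in> cell (quot X q) m" if "f \<in> Hom box m n" "z \<in> cell (quot X q) n" for f z
    using that pull_in[OF X] by (auto simp: cell_quot pull_quot[OF q])
  then show "pull (quot X q) m n \<in> Hom box m n \<rightarrow>\<^sub>E (cell (quot X q) n \<rightarrow>\<^sub>E cell (quot X q) m)"
    by (intro PiE_I) (auto simp: quot_def)
next
  fix n
  show "snd (quot X q) n \<in> cell (quot X q) n \<rightarrow>\<^sub>E words \<Sigma> n"
  proof (rule PiE_I)
    show "snd (quot X q) n z \<in> words \<Sigma> n" if "z \<in> cell (quot X q) n" for z
      using that label_in[OF X] by (auto simp: cell_quot label_quot[OF q])
  qed (simp add: quot_def)
next
  fix n z assume "z \<in> cell (quot X q) n"
  then obtain x where "x \<in> cell X n" "z = q n x" by (auto simp: cell_quot)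
  then show "pull (quot X q) n n (Ide box n) z = z"
    by (simp add: pull_quot[OF q] Ide_box pull_Ide[OF X])
next
  fix l m n f g z
  assume f: "f \<in> Hom box l m" and g: "g \<in> Hom box m n" and "z \<in> cell (quot X q) n"
  then obtain x where x: "x \<in> cell X n" "z = q n x" by (auto simp: cell_quot)
  then show "pull (quot X q) l n (Comp box l m n g f) z =
      pull (quot X q) l m f (pull (quot X q) m n g z)"
    by (simp add: pull_quot[OF q] f g Comp_box[OF f g] pull_in[OF X g] pull_Comp[OF X f g])
next
  fix m n f z assume f: "f \<in> Hom box m n" and "z \<in> cell (quot X q) n"
  then obtain x where "x \<in> cell X n" "z = q n x" by (auto simp: cell_quot)
  then show "snd (quot X q) m (pull (quot X q) m n f z) = act (bang \<Sigma>) m n f (snd (quot X q) n z)"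
    by (simp add: pull_quot[OF q] label_quot[OF q] f pull_in[OF X f] label_pull[OF X f])
qed

lemma quot_map_lhom:
  assumes "labelled \<Sigma> X" "congruent X q"
  shows "quot_map X q \<in> lhom X (quot X q)"
  by (rule lhomI[OF assms(1)])
    (auto simp: quot_map_def cell_quot pull_quot[OF assms(2)] label_quot[OF assms(2)]
      pull_in[OF assms(1)])

lemma quot_factor:
  assumes X: "labelled \<Sigma> X" and q: "congruent X q" and \<phi>: "\<phi> \<in> lhom X Y"
    and compat: "\<And>n x y. x \<in> cell X n \<Longrightarrow> y \<in> cell X n \<Longrightarrow> q n x = q n y \<Longrightarrow> \<phi> n x = \<phi> n y"
  shows "\<exists>!u. u \<in> lhom (quot X q) Y \<and> psh_comp (fst X) u (quot_map X q) = \<phi>"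
proof (rule ex_ex1I)
  define u where "u n = (\<lambda>z\<in>cell (quot X q) n. \<phi> n (inv_into (cell X n) (q n) z))" for n
  have u: "u n (q n x) = \<phi> n x" if "x \<in> cell X n" for n x
  proof -
    have "inv_into (cell X n) (q n) (q n x) \<in> cell X n"
      "q n (inv_into (cell X n) (q n) (q n x)) = q n x"
      using that by (auto intro: inv_into_into f_inv_into_f)
    with that show ?thesis by (auto simp: u_def cell_quot intro: compat)
  qed
  have "u \<in> lhom (quot X q) Y"
    by (rule lhomI[OF labelled_quot[OF X q]])
      (auto simp: cell_quot u pull_quot[OF q] label_quot[OF q] lhom_in[OF \<phi>] lhom_pull[OF \<phi>]
        lhom_label[OF \<phi>] pull_in[OF X], simp add: u_def cell_quot)
  moreover have "psh_comp (fst X) u (quot_map X q) = \<phi>"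
    by (rule ext, rule extensionalityI, rule psh_comp_extensional, rule lhom_extensional[OF \<phi>])
      (simp add: u)
  ultimately show "\<exists>u. u \<in> lhom (quot X q) Y \<and> psh_comp (fst X) u (quot_map X q) = \<phi>" by blast
next
  fix u v
  assume u: "u \<in> lhom (quot X q) Y \<and> psh_comp (fst X) u (quot_map X q) = \<phi>"
    and v: "v \<in> lhom (quot X q) Y \<and> psh_comp (fst X) v (quot_map X q) = \<phi>"
  have "u n (q n x) = v n (q n x)" if "x \<in> cell X n" for n x
  proof -
    have "psh_comp (fst X) u (quot_map X q) n x = psh_comp (fst X) v (quot_map X q) n x"
      using u v by simp
    with that show ?thesis by simp
  qed
  then show "u = v" using u v by (intro lhom_eqI) (auto simp: cell_quot)
qed

lemma separated_quot:
  assumes X: "labelled \<Sigma> X" and q: "congruent X q"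
    and sep: "\<And>n x y. x \<in> cell X n \<Longrightarrow> y \<in> cell X n \<Longrightarrow> snd X n x = snd X n y \<Longrightarrow>
      (\<And>m f. m \<le> 1 \<Longrightarrow> f \<in> Hom box m n \<Longrightarrow> q m (pull X m n f x) = q m (pull X m n f y)) \<Longrightarrow>
      q n x = q n y"
  shows "separated (quot X q)"
  unfolding separated_def
proof (intro allI ballI impI)
  fix n w z assume "w \<in> cell (quot X q) n" "z \<in> cell (quot X q) n" and wz: "same_shape (quot X q) n w z"
  then obtain x y where x: "x \<in> cell X n" "w = q n x" and y: "y \<in> cell X n" "z = q n y"
    by (auto simp: cell_quot)
  have "q n x = q n y"
    by (rule sep[OF x(1) y(1)])
      (use wz x y in \<open>auto simp: same_shape_def pull_quot[OF q] label_quot[OF q]\<close>)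
  with x y show "w = z" by simp
qed

text \<open>
  A quotient of \<open>A\<close> is in bijection with a set of representatives, and so fits into every type into
  which \<open>A\<close> can be injected.
\<close>

lemma ex_quotient_map:
  fixes g :: "'a \<Rightarrow> 'b"
  assumes g: "inj_on g A"
    and refl: "\<And>x. x \<in> A \<Longrightarrow> E x x"
    and sym: "\<And>x y. x \<in> A \<Longrightarrow> y \<in> A \<Longrightarrow> E x y \<Longrightarrow> E y x"
    and trans: "\<And>x y z. x \<in> A \<Longrightarrow> y \<in> A \<Longrightarrow> z \<in> A \<Longrightarrow> E x y \<Longrightarrow> E y z \<Longrightarrow> E x z"
  shows "\<exists>q :: 'a \<Rightarrow> 'b. \<forall>x\<in>A. \<forall>y\<in>A. q x = q y \<longleftrightarrow> E x y"
proof -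
  define r where "r x = (SOME y. y \<in> A \<and> E x y)" for x
  have r: "r x \<in> A \<and> E x (r x)" if "x \<in> A" for x
    unfolding r_def by (rule someI[of _ x]) (simp add: that refl)
  have "r x = r y" if x: "x \<in> A" and y: "y \<in> A" and "E x y" for x y
  proof -
    have "(\<lambda>z. z \<in> A \<and> E x z) = (\<lambda>z. z \<in> A \<and> E y z)"
      using trans[OF y x] trans[OF x y] sym[OF x y] \<open>E x y\<close> by blast
    then show ?thesis by (simp add: r_def)
  qed
  then have "g (r x) = g (r y)" if "x \<in> A" "y \<in> A" "E x y" for x y
    using that by simp
  moreover have "E x y" if x: "x \<in> A" and y: "y \<in> A" and eq: "g (r x) = g (r y)" for x y
  proof -
    have "r x = r y" using inj_onD[OF g eq] r x y by blast
    with r[OF x] r[OF y] have "E x (r x)" "E (r x) y" "r x \<in> A" using sym[OF y] by auto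
    then show ?thesis using trans x y by blast
  qed
  ultimately have "\<forall>x\<in>A. \<forall>y\<in>A. g (r x) = g (r y) \<longleftrightarrow> E x y" by blast
  then show ?thesis by (intro exI[of _ "g \<circ> r"]) simp
qed

text \<open>
  The reflection is the quotient by \<open>same_shape\<close>. It is separated because \<open>same_shape\<close> identifies no two
  distinct cells of dimension at most one: the vertices and edges of a class are those of any of its
  members. It is universal because morphisms preserve \<open>same_shape\<close>, which is equality in a separated
  target.
\<close>

lemma ex_reflection:
  fixes X :: "('u, 'l) lpsh"
  assumes X: "X \<in> Obj (labelled_sets U \<Sigma>)"
  shows "\<exists>R \<eta>. R \<in> Obj (HDA U \<Sigma>) \<and> \<eta> \<in> lhom X R \<and>
    (\<forall>Y\<in>Obj (HDA U \<Sigma>). \<forall>\<phi>\<in>lhom X Y. \<exists>!u. u \<in> lhom R Y \<and> psh_comp (fst X) u \<eta> = \<phi>)"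
proof -
  have lX: "labelled \<Sigma> X" and small: "small U (cell X n)" for n
    using X by (auto simp: labelled_sets_simps)
  have "\<exists>r :: 'u \<Rightarrow> 'u. \<forall>x\<in>cell X n. \<forall>y\<in>cell X n. r x = r y \<longleftrightarrow> same_shape X n x y" for n
    by (rule ex_quotient_map[OF inj_on_id]) (auto simp: same_shape_def)
  then obtain q :: "nat \<Rightarrow> 'u \<Rightarrow> 'u" where
    q: "q n x = q n y \<longleftrightarrow> same_shape X n x y" if "x \<in> cell X n" "y \<in> cell X n" for n x y
    by metis
  have cong: "congruent X q"
    using same_shape_pull[OF lX] pull_in[OF lX]
    by (auto simp: congruent_def q) (auto simp: same_shape_def)
  have sep: "separated (quot X q)"
  proof (rule separated_quot[OF lX cong])
    fix n x y assume x: "x \<in> cell X n" and y: "y \<in> cell X n" and lab: "snd X n x = snd X n y"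
      and faces: "\<And>m f. m \<le> 1 \<Longrightarrow> f \<in> Hom box m n \<Longrightarrow> q m (pull X m n f x) = q m (pull X m n f y)"
    have "pull X m n f x = pull X m n f y" if m: "m \<le> 1" and f: "f \<in> Hom box m n" for m f
    proof -
      let ?x = "pull X m n f x" and ?y = "pull X m n f y"
      have xy: "?x \<in> cell X m" "?y \<in> cell X m" using pull_in[OF lX f] x y by auto
      then have "same_shape X m ?x ?y" using faces[OF m f] q by blast
      then have "pull X m m (Ide box m) ?x = pull X m m (Ide box m) ?y"
        using m Ide_box by (auto simp: same_shape_def)
      then show ?thesis using pull_Ide[OF lX] xy by simp
    qed
    with lab show "q n x = q n y" by (simp add: q[OF x y] same_shape_def)
  qed
  have R: "quot X q \<in> Obj (HDA U \<Sigma>)"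
    by (simp add: Obj_HDA labelled_quot[OF lX cong] sep cell_quot small_image small)
  have "\<exists>!u. u \<in> lhom (quot X q) Y \<and> psh_comp (fst X) u (quot_map X q) = \<phi>"
    if Y: "Y \<in> Obj (HDA U \<Sigma>)" and \<phi>: "\<phi> \<in> lhom X Y" for Y \<phi>
  proof (rule quot_factor[OF lX cong \<phi>])
    fix n x y assume x: "x \<in> cell X n" and y: "y \<in> cell X n" and "q n x = q n y"
    then have xy: "same_shape X n x y" by (simp add: q)
    then have "same_shape Y n (\<phi> n x) (\<phi> n y)"
      using x y by (auto simp: same_shape_def lhom_label[OF \<phi>] lhom_pull[OF \<phi>, symmetric])
    moreover have "separated Y" using Y by (simp add: Obj_HDA)
    ultimately show "\<phi> n x = \<phi> n y" using separatedD lhom_in[OF \<phi>] x y by metis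
  qed
  with R quot_map_lhom[OF lX cong] show ?thesis by blast
qed

lemma HDA_left_adjoint:
  "\<exists>Sh. left_adjoint (labelled_sets U \<Sigma>) (HDA U \<Sigma>) Sh inclusion"
proof (rule left_adjoint_of_universal_arrows[OF full_subcategory_HDA])
  fix X :: "('a, 'b) lpsh" assume "X \<in> Obj (labelled_sets U \<Sigma>)"
  from ex_reflection[OF this]
  show "\<exists>R \<eta>. R \<in> Obj (HDA U \<Sigma>) \<and> \<eta> \<in> Hom (labelled_sets U \<Sigma>) X R \<and>
    (\<forall>Y\<in>Obj (HDA U \<Sigma>). \<forall>\<phi>\<in>Hom (labelled_sets U \<Sigma>) X Y.
      \<exists>!u. u \<in> Hom (labelled_sets U \<Sigma>) R Y \<and> Comp (labelled_sets U \<Sigma>) X R Y u \<eta> = \<phi>)"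
    unfolding labelled_sets_simps .
qed

section \<open>Colimits of separated presheaves\<close>

definition coprod :: "'j set \<Rightarrow> ('j \<Rightarrow> ('a, 'l) lpsh) \<Rightarrow> ('j \<times> 'a, 'l) lpsh" where
  "coprod I F =
     (\<lparr> cells = (\<lambda>n. SIGMA j:I. cell (F j) n),
        act = (\<lambda>m n. \<lambda>f\<in>Hom box m n. \<lambda>p\<in>(SIGMA j:I. cell (F j) n).
                 (fst p, pull (F (fst p)) m n f (snd p))) \<rparr>,
      \<lambda>n. \<lambda>p\<in>(SIGMA j:I. cell (F j) n). snd (F (fst p)) n (snd p))"

lemma coprod_simps:
  "cell (coprod I F) n = (SIGMA j:I. cell (F j) n)"
  "f \<in> Hom box m n \<Longrightarrow> j \<in> I \<Longrightarrow> x \<in> cell (F j) n \<Longrightarrow>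
     pull (coprod I F) m n f (j, x) = (j, pull (F j) m n f x)"
  "j \<in> I \<Longrightarrow> x \<in> cell (F j) n \<Longrightarrow> snd (coprod I F) n (j, x) = snd (F j) n x"
  by (simp_all add: coprod_def)

lemma labelled_coprod:
  assumes F: "\<And>j. j \<in> I \<Longrightarrow> labelled \<Sigma> (F j)"
  shows "labelled \<Sigma> (coprod I F)"
  unfolding labelled_iff
proof (intro conjI allI ballI)
  fix m n
  show "pull (coprod I F) m n \<in> Hom box m n \<rightarrow>\<^sub>E (cell (coprod I F) n \<rightarrow>\<^sub>E cell (coprod I F) m)"
  proof (intro PiE_I)
    fix f p assume "f \<in> Hom box m n" "p \<in> cell (coprod I F) n"
    then show "pull (coprod I F) m n f p \<in> cell (coprod I F) m"
      by (cases p) (auto simp: coprod_simps pull_in[OF F])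
  qed (auto simp: coprod_def)
  show "snd (coprod I F) n \<in> cell (coprod I F) n \<rightarrow>\<^sub>E words \<Sigma> n"
  proof (intro PiE_I)
    fix p assume "p \<in> cell (coprod I F) n"
    then show "snd (coprod I F) n p \<in> words \<Sigma> n"
      by (cases p) (auto simp: coprod_simps label_in[OF F])
  qed (auto simp: coprod_def)
next
  fix n p assume "p \<in> cell (coprod I F) n"
  then show "pull (coprod I F) n n (Ide box n) p = p"
    by (cases p) (auto simp: coprod_simps pull_Ide[OF F] Ide_box)
next
  fix l m n f g p
  assume fg: "f \<in> Hom box l m" "g \<in> Hom box m n" and "p \<in> cell (coprod I F) n"
  then obtain j x where x: "j \<in> I" "x \<in> cell (F j) n" "p = (j, x)" by (auto simp: coprod_simps)
  then show "pull (coprod I F) l n (Comp box l m n g f) p =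
      pull (coprod I F) l m f (pull (coprod I F) m n g p)"
    using fg by (simp add: coprod_simps Comp_box pull_in[OF F] pull_Comp[OF F])
next
  fix m n f p assume f: "f \<in> Hom box m n" and "p \<in> cell (coprod I F) n"
  then obtain j x where x: "j \<in> I" "x \<in> cell (F j) n" "p = (j, x)" by (auto simp: coprod_simps)
  then show "snd (coprod I F) m (pull (coprod I F) m n f p) =
      act (bang \<Sigma>) m n f (snd (coprod I F) n p)"
    using f by (simp add: coprod_simps pull_in[OF F] label_pull[OF F])
qed

lemma is_cocone_HDA:
  "is_cocone J (HDA U \<Sigma>) D X c \<longleftrightarrow>
     X \<in> Obj (HDA U \<Sigma>) \<and> (\<forall>j\<in>Obj J. c j \<in> lhom (on_ob D j) X) \<and>
     (\<forall>i\<in>Obj J. \<forall>j\<in>Obj J. \<forall>f\<in>Hom J i j.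
        psh_comp (fst (on_ob D i)) (c j) (on_ar D i j f) = c i)"
  by (simp add: is_cocone_def HDA_simps(2-))

lemma cocone_HDA_arrow:
  assumes "is_cocone J (HDA U \<Sigma>) D X c" "i \<in> Obj J" "j \<in> Obj J" "f \<in> Hom J i j"
    "x \<in> cell (on_ob D i) n"
  shows "c j n (on_ar D i j f n x) = c i n x"
proof -
  have "psh_comp (fst (on_ob D i)) (c j) (on_ar D i j f) = c i"
    using assms by (simp add: is_cocone_HDA)
  then have "psh_comp (fst (on_ob D i)) (c j) (on_ar D i j f) n x = c i n x" by simp
  then show ?thesis using assms(5) by simp
qed

lemma diagram_HDA:
  assumes "is_functor J (HDA U \<Sigma>) D" "i \<in> Obj J"
  shows "labelled \<Sigma> (on_ob D i)" "small U (cell (on_ob D i) n)" "separated (on_ob D i)"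
    "j \<in> Obj J \<Longrightarrow> f \<in> Hom J i j \<Longrightarrow> on_ar D i j f \<in> lhom (on_ob D i) (on_ob D j)"
  using is_functorD(3)[OF assms] is_functorD(4)[OF assms(1,2)] by (simp_all add: Obj_HDA HDA_simps(2))

text \<open>
  A jointly surjective cocone is a colimit as soon as any other cocone identifies whatever it identifies:
  the comparison map is then well defined on cells, and it is compatible with faces and labels because
  both can be computed in the diagram.
\<close>

lemma is_colimit_HDA_I:
  assumes D: "is_functor J (HDA U \<Sigma>) D" and c: "is_cocone J (HDA U \<Sigma>) D X c"
    and surj: "\<And>n z. z \<in> cell X n \<Longrightarrow> \<exists>i\<in>Obj J. \<exists>x\<in>cell (on_ob D i) n. z = c i n x"
    and ident: "\<And>Y d n i j x y. is_cocone J (HDA U \<Sigma>) D Y d \<Longrightarrow> i \<in> Obj J \<Longrightarrow> j \<in> Obj J \<Longrightarrow>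
      x \<in> cell (on_ob D i) n \<Longrightarrow> y \<in> cell (on_ob D j) n \<Longrightarrow> c i n x = c j n y \<Longrightarrow> d i n x = d j n y"
  shows "is_colimit J (HDA U \<Sigma>) D X c"
  unfolding is_colimit_def HDA_simps(2-)
proof (intro conjI allI impI c)
  fix Y d assume d: "is_cocone J (HDA U \<Sigma>) D Y d"
  have X: "labelled \<Sigma> X" and cj: "\<And>j. j \<in> Obj J \<Longrightarrow> c j \<in> lhom (on_ob D j) X"
    using c by (auto simp: is_cocone_HDA Obj_HDA)
  have dj: "\<And>j. j \<in> Obj J \<Longrightarrow> d j \<in> lhom (on_ob D j) Y" using d by (simp add: is_cocone_HDA)
  \<comment> \<open>\<open>p n z\<close> is a preimage of \<open>z\<close>: a stage together with a cell of that stage.\<close>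
  define p where "p n z = (SOME p. fst p \<in> Obj J \<and> snd p \<in> cell (on_ob D (fst p)) n \<and>
      c (fst p) n (snd p) = z)" for n z
  have ex: "\<exists>p. fst p \<in> Obj J \<and> snd p \<in> cell (on_ob D (fst p)) n \<and> c (fst p) n (snd p) = z"
    if "z \<in> cell X n" for n z
    using surj[OF that] by force
  have p: "fst (p n z) \<in> Obj J \<and> snd (p n z) \<in> cell (on_ob D (fst (p n z))) n \<and>
      c (fst (p n z)) n (snd (p n z)) = z" if "z \<in> cell X n" for n z
    unfolding p_def using someI_ex[OF ex[OF that]] .
  define u where "u n = (\<lambda>z\<in>cell X n. d (fst (p n z)) n (snd (p n z)))" for n
  have u: "u n (c i n x) = d i n x" if i: "i \<in> Obj J" and x: "x \<in> cell (on_ob D i) n" for i n x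
  proof -
    have z: "c i n x \<in> cell X n" by (rule lhom_in[OF cj[OF i] x])
    then have "u n (c i n x) = d (fst (p n (c i n x))) n (snd (p n (c i n x)))" by (simp add: u_def)
    also have "\<dots> = d i n x" using p[OF z] by (intro ident[OF d _ i _ x]) auto
    finally show ?thesis .
  qed
  have "u \<in> lhom X Y"
  proof (rule lhomI[OF X])
    fix n z assume "z \<in> cell X n"
    from surj[OF this] obtain i x where x: "i \<in> Obj J" "x \<in> cell (on_ob D i) n" "z = c i n x" by blast
    then show "u n z \<in> cell Y n" "snd Y n (u n z) = snd X n z"
      using lhom_in[OF dj] by (simp_all add: u lhom_label[OF cj] lhom_label[OF dj])
    fix m f assume f: "f \<in> Hom box m n"
    have "pull (on_ob D i) m n f x \<in> cell (on_ob D i) m"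
      by (rule pull_in[OF diagram_HDA(1)[OF D x(1)] f x(2)])
    then show "u m (pull X m n f z) = pull Y m n f (u n z)"
      using x f by (simp add: u lhom_pull[OF cj, symmetric] lhom_pull[OF dj, symmetric])
  qed (simp add: u_def)
  moreover have "psh_comp (fst (on_ob D j)) u (c j) = d j" if "j \<in> Obj J" for j
    by (rule ext, rule extensionalityI, rule psh_comp_extensional,
        rule lhom_extensional[OF dj[OF that]]) (simp add: u that)
  moreover have "v = u" if v: "v \<in> lhom X Y" "\<forall>j\<in>Obj J. psh_comp (fst (on_ob D j)) v (c j) = d j" for v
  proof (rule lhom_eqI[OF v(1) \<open>u \<in> lhom X Y\<close>])
    fix n z assume "z \<in> cell X n"
    from surj[OF this] obtain i x where x: "i \<in> Obj J" "x \<in> cell (on_ob D i) n" "z = c i n x" by blast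
    have "psh_comp (fst (on_ob D i)) v (c i) n x = d i n x" using v x by simp
    then show "v n z = u n z" using x by (simp add: u)
  qed
  ultimately show "\<exists>!u. u \<in> lhom X Y \<and> (\<forall>j\<in>Obj J. psh_comp (fst (on_ob D j)) u (c j) = d j)"
    by blast
qed

text \<open>
  Cocones as quotients of the coproduct of the diagram. The last assumption, that \<open>E\<close> relates two cells
  with equal labels and related vertices and edges, is what makes the quotient separated.
\<close>

lemma ex_quotient_cocone:
  fixes J :: "('j, 'k) cat" and D :: "('j, 'k, ('u, 'l) lpsh, nat \<Rightarrow> 'u \<Rightarrow> 'u) fnctr"
    and E :: "nat \<Rightarrow> 'j \<times> 'u \<Rightarrow> 'j \<times> 'u \<Rightarrow> bool"
  defines "P \<equiv> coprod (Obj J) (on_ob D)"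
  assumes U: "size_universe TYPE('u)" and J: "small TYPE('u) (Obj J)"
    and D: "is_functor J (HDA TYPE('u) \<Sigma>) D"
    and refl: "\<And>n p. p \<in> cell P n \<Longrightarrow> E n p p"
    and sym: "\<And>n p q. p \<in> cell P n \<Longrightarrow> q \<in> cell P n \<Longrightarrow> E n p q \<Longrightarrow> E n q p"
    and trans: "\<And>n p q r. p \<in> cell P n \<Longrightarrow> q \<in> cell P n \<Longrightarrow> r \<in> cell P n \<Longrightarrow>
      E n p q \<Longrightarrow> E n q r \<Longrightarrow> E n p r"
    and label: "\<And>n p q. p \<in> cell P n \<Longrightarrow> q \<in> cell P n \<Longrightarrow> E n p q \<Longrightarrow> snd P n p = snd P n q"
    and pull: "\<And>m n f p q. f \<in> Hom box m n \<Longrightarrow> p \<in> cell P n \<Longrightarrow> q \<in> cell P n \<Longrightarrow> E n p q \<Longrightarrow>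
      E m (pull P m n f p) (pull P m n f q)"
    and arrow: "\<And>n i j f x. i \<in> Obj J \<Longrightarrow> j \<in> Obj J \<Longrightarrow> f \<in> Hom J i j \<Longrightarrow>
      x \<in> cell (on_ob D i) n \<Longrightarrow> E n (j, on_ar D i j f n x) (i, x)"
    and sep: "\<And>n p q. p \<in> cell P n \<Longrightarrow> q \<in> cell P n \<Longrightarrow> snd P n p = snd P n q \<Longrightarrow>
      (\<And>m f. m \<le> 1 \<Longrightarrow> f \<in> Hom box m n \<Longrightarrow> E m (pull P m n f p) (pull P m n f q)) \<Longrightarrow> E n p q"
  shows "\<exists>X c. is_cocone J (HDA TYPE('u) \<Sigma>) D X c \<and>
    (\<forall>n. \<forall>z\<in>cell X n. \<exists>i\<in>Obj J. \<exists>x\<in>cell (on_ob D i) n. z = c i n x) \<and>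
    (\<forall>n. \<forall>i\<in>Obj J. \<forall>j\<in>Obj J. \<forall>x\<in>cell (on_ob D i) n. \<forall>y\<in>cell (on_ob D j) n.
       c i n x = c j n y \<longleftrightarrow> E n (i, x) (j, y))"
proof -
  have lP: "labelled \<Sigma> P" unfolding P_def by (rule labelled_coprod) (rule diagram_HDA(1)[OF D])
  have cellP: "cell P n = (SIGMA j:Obj J. cell (on_ob D j) n)" for n
    by (simp add: P_def coprod_simps)
  have small: "small TYPE('u) (cell P n)" for n
    unfolding cellP by (rule small_Sigma[OF U J]) (rule diagram_HDA(2)[OF D])
  have "\<exists>q :: 'j \<times> 'u \<Rightarrow> 'u. \<forall>x\<in>cell P n. \<forall>y\<in>cell P n. q x = q y \<longleftrightarrow> E n x y" for n
  proof -
    obtain g :: "'j \<times> 'u \<Rightarrow> 'u" where "inj_on g (cell P n)" using small_imp_inj_on[OF small] by blast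
    from ex_quotient_map[OF this, of "E n"] show ?thesis using refl sym trans by blast
  qed
  then obtain q :: "nat \<Rightarrow> 'j \<times> 'u \<Rightarrow> 'u" where
    q: "q n x = q n y \<longleftrightarrow> E n x y" if "x \<in> cell P n" "y \<in> cell P n" for n x y
    by metis
  have cong: "congruent P q"
    using label pull pull_in[OF lP] by (auto simp: congruent_def q)
  define X where "X = quot P q"
  define c where "c j n = (\<lambda>x\<in>cell (on_ob D j) n. q n (j, x))" for j n
  have "separated X"
    unfolding X_def by (rule separated_quot[OF lP cong]) (simp add: q sep pull_in[OF lP])
  then have X: "X \<in> Obj (HDA TYPE('u) \<Sigma>)"
    by (simp add: Obj_HDA X_def labelled_quot[OF lP cong] cell_quot small_image small)
  have cj: "c j \<in> lhom (on_ob D j) X" if j: "j \<in> Obj J" for j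
  proof (rule lhomI[OF diagram_HDA(1)[OF D j]])
    fix n x assume x: "x \<in> cell (on_ob D j) n"
    then have jx: "(j, x) \<in> cell P n" using j by (simp add: cellP)
    then show "c j n x \<in> cell X n" using x by (simp add: c_def X_def cell_quot)
    show "snd X n (c j n x) = snd (on_ob D j) n x"
      using x j label_quot[OF cong jx] by (simp add: c_def X_def P_def coprod_simps)
    fix m f assume f: "f \<in> Hom box m n"
    then show "c j m (pull (on_ob D j) m n f x) = pull X m n f (c j n x)"
      using x j pull_quot[OF cong jx f] pull_in[OF diagram_HDA(1)[OF D j] f x]
      by (simp add: c_def X_def P_def coprod_simps)
  qed (simp add: c_def)
  have "psh_comp (fst (on_ob D i)) (c j) (on_ar D i j f) = c i"
    if i: "i \<in> Obj J" and j: "j \<in> Obj J" and f: "f \<in> Hom J i j" for i j f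
  proof (rule ext, rule extensionalityI, rule psh_comp_extensional, rule lhom_extensional[OF cj[OF i]])
    fix n x assume x: "x \<in> cell (on_ob D i) n"
    have "on_ar D i j f n x \<in> cell (on_ob D j) n"
      by (rule lhom_in[OF diagram_HDA(4)[OF D i j f] x])
    then show "psh_comp (fst (on_ob D i)) (c j) (on_ar D i j f) n x = c i n x"
      using arrow[OF i j f x] x i j by (simp add: c_def q cellP)
  qed
  then have "is_cocone J (HDA TYPE('u) \<Sigma>) D X c"
    using X cj by (simp add: is_cocone_HDA)
  moreover have "\<exists>i\<in>Obj J. \<exists>x\<in>cell (on_ob D i) n. z = c i n x" if "z \<in> cell X n" for n z
    using that by (auto simp: X_def cell_quot cellP c_def)
  moreover have "c i n x = c j n y \<longleftrightarrow> E n (i, x) (j, y)"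
    if "i \<in> Obj J" "j \<in> Obj J" "x \<in> cell (on_ob D i) n" "y \<in> cell (on_ob D j) n" for n i j x y
    using that by (simp add: c_def q cellP)
  ultimately show ?thesis by blast
qed

text \<open>
  The relation on the coproduct that defines the colimit is: every cocone identifies the two cells, and
  their labels agree. Universality is then immediate. The relation satisfies the separation condition of
  \<open>ex_quotient_cocone\<close> because the tips of all these cocones are separated. Labels are mentioned
  separately since they must agree even if there were no cocone.
\<close>

lemma HDA_has_colimit:
  fixes J :: "('j, 'k) cat" and D :: "('j, 'k, ('u, 'l) lpsh, nat \<Rightarrow> 'u \<Rightarrow> 'u) fnctr"
  assumes U: "size_universe TYPE('u)" and J: "small TYPE('u) (Obj J)"
    and D: "is_functor J (HDA TYPE('u) \<Sigma>) D"
  shows "\<exists>X c. is_colimit J (HDA TYPE('u) \<Sigma>) D X c"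
proof -
  let ?P = "coprod (Obj J) (on_ob D)"
  define E where "E n p q \<longleftrightarrow> snd ?P n p = snd ?P n q \<and>
      (\<forall>Y d. is_cocone J (HDA TYPE('u) \<Sigma>) D Y d \<longrightarrow> d (fst p) n (snd p) = d (fst q) n (snd q))" for n p q
  have dpull: "d (fst (pull ?P m n f p)) m (snd (pull ?P m n f p)) = pull Y m n f (d (fst p) n (snd p))"
    if d: "is_cocone J (HDA TYPE('u) \<Sigma>) D Y d" and f: "f \<in> Hom box m n" and p: "p \<in> cell ?P n"
    for Y d m n f p
  proof -
    obtain j x where x: "p = (j, x)" "j \<in> Obj J" "x \<in> cell (on_ob D j) n"
      using p by (auto simp: coprod_simps)
    have "d j \<in> lhom (on_ob D j) Y" using d x by (simp add: is_cocone_HDA)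
    from lhom_pull[OF this f x(3)] show ?thesis using x f by (simp add: coprod_simps)
  qed
  have lP: "labelled \<Sigma> ?P" by (rule labelled_coprod) (rule diagram_HDA(1)[OF D])
  have "\<exists>X c. is_cocone J (HDA TYPE('u) \<Sigma>) D X c \<and>
    (\<forall>n. \<forall>z\<in>cell X n. \<exists>i\<in>Obj J. \<exists>x\<in>cell (on_ob D i) n. z = c i n x) \<and>
    (\<forall>n. \<forall>i\<in>Obj J. \<forall>j\<in>Obj J. \<forall>x\<in>cell (on_ob D i) n. \<forall>y\<in>cell (on_ob D j) n.
       c i n x = c j n y \<longleftrightarrow> E n (i, x) (j, y))"
  proof (rule ex_quotient_cocone[OF U J D])
    fix m n f p q
    assume f: "f \<in> Hom box m n" and p: "p \<in> cell ?P n" and q: "q \<in> cell ?P n" and pq: "E n p q"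
    have "d (fst (pull ?P m n f p)) m (snd (pull ?P m n f p)) =
        d (fst (pull ?P m n f q)) m (snd (pull ?P m n f q))"
      if d: "is_cocone J (HDA TYPE('u) \<Sigma>) D Y d" for Y d
      using dpull[OF d f p] dpull[OF d f q] pq d unfolding E_def by metis
    with pq show "E m (pull ?P m n f p) (pull ?P m n f q)"
      unfolding E_def by (simp add: label_pull[OF lP f] p q)
  next
    fix n i j f x assume i: "i \<in> Obj J" and j: "j \<in> Obj J" and f: "f \<in> Hom J i j"
      and x: "x \<in> cell (on_ob D i) n"
    note Df = diagram_HDA(4)[OF D i j f]
    show "E n (j, on_ar D i j f n x) (i, x)"
      using i j x lhom_in[OF Df x] lhom_label[OF Df x] cocone_HDA_arrow[OF _ i j f x]
      by (auto simp: E_def coprod_simps)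
  next
    fix n p q assume p: "p \<in> cell ?P n" and q: "q \<in> cell ?P n" and lab: "snd ?P n p = snd ?P n q"
      and faces: "\<And>m f. m \<le> 1 \<Longrightarrow> f \<in> Hom box m n \<Longrightarrow> E m (pull ?P m n f p) (pull ?P m n f q)"
    have "d (fst p) n (snd p) = d (fst q) n (snd q)" if d: "is_cocone J (HDA TYPE('u) \<Sigma>) D Y d" for Y d
    proof -
      have dj: "d j \<in> lhom (on_ob D j) Y" if "j \<in> Obj J" for j using d that by (simp add: is_cocone_HDA)
      have Y: "separated Y" using d by (simp add: is_cocone_HDA Obj_HDA)
      have in_Y: "d (fst p) n (snd p) \<in> cell Y n \<and> snd Y n (d (fst p) n (snd p)) = snd ?P n p"
        if "p \<in> cell ?P n" for p
        using that lhom_in[OF dj] lhom_label[OF dj] by (auto simp: coprod_simps)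
      have "pull Y m n f (d (fst p) n (snd p)) = pull Y m n f (d (fst q) n (snd q))"
        if "m \<le> 1" and f: "f \<in> Hom box m n" for m f
        using faces[OF that] d dpull[OF d f p] dpull[OF d f q] unfolding E_def by metis
      then show ?thesis
        using in_Y[OF p] in_Y[OF q] lab by (intro separatedD[OF Y]) (auto simp: same_shape_def)
    qed
    with lab show "E n p q" by (simp add: E_def)
  next
    fix n p q assume "E n p q"
    then show "E n q p" unfolding E_def by metis
  next
    fix n p q r assume "E n p q" "E n q r"
    then show "E n p r" unfolding E_def by metis
  qed (auto simp: E_def)
  then obtain X c where c: "is_cocone J (HDA TYPE('u) \<Sigma>) D X c"
    and surj: "\<And>n z. z \<in> cell X n \<Longrightarrow> \<exists>i\<in>Obj J. \<exists>x\<in>cell (on_ob D i) n. z = c i n x"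
    and ident: "\<And>n i j x y. i \<in> Obj J \<Longrightarrow> j \<in> Obj J \<Longrightarrow> x \<in> cell (on_ob D i) n \<Longrightarrow>
      y \<in> cell (on_ob D j) n \<Longrightarrow> c i n x = c j n y \<Longrightarrow> E n (i, x) (j, y)"
    by blast
  have "is_colimit J (HDA TYPE('u) \<Sigma>) D X c"
  proof (rule is_colimit_HDA_I[OF D c surj])
    fix Y d n i j x y
    assume d: "is_cocone J (HDA TYPE('u) \<Sigma>) D Y d" and "i \<in> Obj J" "j \<in> Obj J"
      "x \<in> cell (on_ob D i) n" "y \<in> cell (on_ob D j) n" "c i n x = c j n y"
    then have "E n (i, x) (j, y)" using ident by blast
    with d show "d i n x = d j n y" unfolding E_def fst_conv snd_conv by blast
  qed
  then show ?thesis by blast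
qed

lemma cocomplete_HDA:
  assumes "size_universe TYPE('u)"
  shows "cocomplete TYPE('u) (HDA TYPE('u) \<Sigma>)"
  unfolding cocomplete_def
  using category_HDA HDA_has_colimit[OF assms] by (auto simp: small_category_def)

section \<open>Directed colimits of separated presheaves\<close>

text \<open>
  Directedness is stated through upper bounds of finite sets of indices, so that the results below apply
  to \<open>lam\<close>-directed diagrams for every infinite \<open>lam\<close>.
\<close>

locale directed_diagram =
  fixes I :: "'i set" and r :: "'i rel"
    and D :: "('i, unit, ('u, 'l) lpsh, nat \<Rightarrow> 'u \<Rightarrow> 'u) fnctr" and \<Sigma> :: "'l set"
  assumes universe: "size_universe TYPE('u)" and index_small: "small TYPE('u) I"
    and order: "partial_order_on I r"
    and bound: "\<And>S. finite S \<Longrightarrow> S \<subseteq> I \<Longrightarrow> \<exists>u\<in>I. \<forall>s\<in>S. (s, u) \<in> r"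
    and diagram: "is_functor (poset_cat I r) (HDA TYPE('u) \<Sigma>) D"
begin

abbreviation tr :: "'i \<Rightarrow> 'i \<Rightarrow> nat \<Rightarrow> 'u \<Rightarrow> 'u" where
  "tr i j \<equiv> on_ar D i j ()"

lemma poset_simps: "Obj (poset_cat I r) = I" "f \<in> Hom (poset_cat I r) i j \<longleftrightarrow> (i, j) \<in> r"
  by (simp_all add: poset_cat_def)

lemma order_refl: "i \<in> I \<Longrightarrow> (i, i) \<in> r"
  and order_trans: "(i, j) \<in> r \<Longrightarrow> (j, k) \<in> r \<Longrightarrow> (i, k) \<in> r"
  using order unfolding partial_order_on_def preorder_on_def refl_on_def trans_def by blast+

lemma
  assumes "i \<in> I"
  shows stage_labelled: "labelled \<Sigma> (on_ob D i)" and stage_separated: "separated (on_ob D i)"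
  using diagram_HDA[OF diagram, of i] assms by (simp_all add: poset_simps)

lemma tr_lhom: "i \<in> I \<Longrightarrow> j \<in> I \<Longrightarrow> (i, j) \<in> r \<Longrightarrow> tr i j \<in> lhom (on_ob D i) (on_ob D j)"
  using diagram_HDA(4)[OF diagram, of i j "()"] by (simp add: poset_simps)

lemma tr_refl:
  assumes "i \<in> I" "x \<in> cell (on_ob D i) n"
  shows "tr i i n x = x"
proof -
  have "on_ar D i i (Ide (poset_cat I r) i) = Ide (HDA TYPE('u) \<Sigma>) (on_ob D i)"
    by (rule is_functorD(5)[OF diagram]) (simp add: poset_simps assms(1))
  then show ?thesis using assms(2) by (simp add: poset_cat_def HDA_simps(3))
qed

lemma tr_trans:
  assumes "i \<in> I" "j \<in> I" "k \<in> I" "(i, j) \<in> r" "(j, k) \<in> r" "x \<in> cell (on_ob D i) n"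
  shows "tr j k n (tr i j n x) = tr i k n x"
proof -
  have "on_ar D i k (Comp (poset_cat I r) i j k () ()) =
      Comp (HDA TYPE('u) \<Sigma>) (on_ob D i) (on_ob D j) (on_ob D k) (tr j k) (tr i j)"
    by (rule is_functorD(6)[OF diagram]) (simp_all add: poset_simps assms)
  then have "tr i k = psh_comp (fst (on_ob D i)) (tr j k) (tr i j)"
    by (simp add: poset_cat_def HDA_simps(4))
  then show ?thesis using assms(6) by simp
qed

text \<open>
  Finitely many conditions, each of which holds at some stage and persists, hold together at some stage,
  which can be taken beyond two given ones.
\<close>

lemma eventually_all:
  assumes T: "finite T" and i: "i \<in> I" and j: "j \<in> I"
    and ex: "\<And>t. t \<in> T \<Longrightarrow> \<exists>k\<in>I. Q t k"
    and up: "\<And>t k l. t \<in> T \<Longrightarrow> k \<in> I \<Longrightarrow> l \<in> I \<Longrightarrow> (k, l) \<in> r \<Longrightarrow> Q t k \<Longrightarrow> Q t l"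
  shows "\<exists>k\<in>I. (i, k) \<in> r \<and> (j, k) \<in> r \<and> (\<forall>t\<in>T. Q t k)"
proof -
  obtain s where s: "\<And>t. t \<in> T \<Longrightarrow> s t \<in> I \<and> Q t (s t)" using ex by metis
  have "finite (insert i (insert j (s ` T)))" "insert i (insert j (s ` T)) \<subseteq> I"
    using T i j s by auto
  from bound[OF this] obtain k where k: "k \<in> I" "\<forall>u\<in>insert i (insert j (s ` T)). (u, k) \<in> r" by blast
  have "Q t k" if "t \<in> T" for t
    by (rule up[OF that, of "s t"]) (use k s that in auto)
  with k show ?thesis by blast
qed

text \<open>
  Colimits of directed diagrams are computed as for sets: every cell comes from some stage, and two cells
  become equal in the colimit only if they do so at some stage.

  Let \<open>E\<close> be the relation of becoming equal at some stage. If two cells have equal labels and their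
  vertices and edges are \<open>E\<close>-related, then they are \<open>E\<close>-related: a cube has only finitely many vertices
  and edges, so these agree at a common stage, which is separated. Hence the quotient of the coproduct by
  \<open>E\<close> is separated without any further identification. It is a colimit with the two properties, and any
  other colimit is isomorphic to it.
\<close>

lemma colimit_cover_and_identify:
  assumes X: "is_colimit (poset_cat I r) (HDA TYPE('u) \<Sigma>) D X c"
  shows "z \<in> cell X n \<Longrightarrow> \<exists>i\<in>I. \<exists>x\<in>cell (on_ob D i) n. z = c i n x"
    and "i \<in> I \<Longrightarrow> j \<in> I \<Longrightarrow> x \<in> cell (on_ob D i) n \<Longrightarrow> y \<in> cell (on_ob D j) n \<Longrightarrow>
      c i n x = c j n y \<Longrightarrow> \<exists>k\<in>I. (i, k) \<in> r \<and> (j, k) \<in> r \<and> tr i k n x = tr j k n y"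
proof -
  let ?J = "poset_cat I r" and ?P = "coprod I (on_ob D)"
  define E where "E n p q \<longleftrightarrow> (\<exists>k\<in>I. (fst p, k) \<in> r \<and> (fst q, k) \<in> r \<and>
      tr (fst p) k n (snd p) = tr (fst q) k n (snd q))" for n p q
  have later: "tr i l n x = tr j l n y"
    if "i \<in> I" "j \<in> I" "k \<in> I" "l \<in> I" "(i, k) \<in> r" "(j, k) \<in> r" "(k, l) \<in> r"
      "x \<in> cell (on_ob D i) n" "y \<in> cell (on_ob D j) n" "tr i k n x = tr j k n y" for i j k l n x y
    using tr_trans[of i k l x n] tr_trans[of j k l y n] that by simp
  have "\<exists>X c. is_cocone ?J (HDA TYPE('u) \<Sigma>) D X c \<and>
    (\<forall>n. \<forall>z\<in>cell X n. \<exists>i\<in>Obj ?J. \<exists>x\<in>cell (on_ob D i) n. z = c i n x) \<and>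
    (\<forall>n. \<forall>i\<in>Obj ?J. \<forall>j\<in>Obj ?J. \<forall>x\<in>cell (on_ob D i) n. \<forall>y\<in>cell (on_ob D j) n.
       c i n x = c j n y \<longleftrightarrow> E n (i, x) (j, y))"
  proof (rule ex_quotient_cocone[OF universe _ diagram], unfold poset_simps)
    show "small TYPE('u) I" by (rule index_small)
  next
    fix n p assume "p \<in> cell ?P n"
    then have "fst p \<in> I" by (auto simp: coprod_simps)
    then show "E n p p" using order_refl unfolding E_def by blast
  next
    fix n p q assume "E n p q"
    then show "E n q p" unfolding E_def by metis
  next
    fix n p q s assume "p \<in> cell ?P n" "q \<in> cell ?P n" "s \<in> cell ?P n" "E n p q" "E n q s"
    then obtain i x j y l w k k' where *: "p = (i, x)" "q = (j, y)" "s = (l, w)" "i \<in> I" "j \<in> I" "l \<in> I"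
      "x \<in> cell (on_ob D i) n" "y \<in> cell (on_ob D j) n" "w \<in> cell (on_ob D l) n"
      "k \<in> I" "(i, k) \<in> r" "(j, k) \<in> r" "tr i k n x = tr j k n y"
      "k' \<in> I" "(j, k') \<in> r" "(l, k') \<in> r" "tr j k' n y = tr l k' n w"
      unfolding E_def by (auto simp: coprod_simps)
    obtain u where u: "u \<in> I" "(k, u) \<in> r" "(k', u) \<in> r"
      using bound[of "{k, k'}"] * by auto
    have "tr i u n x = tr j u n y" by (rule later[of i j k]) (use * u in auto)
    also have "\<dots> = tr l u n w" by (rule later[of j l k']) (use * u in auto)
    finally show "E n p s" using * u order_trans unfolding E_def by auto
  next
    fix n p q assume "p \<in> cell ?P n" "q \<in> cell ?P n" "E n p q"
    then obtain i x j y k where *: "p = (i, x)" "q = (j, y)" "i \<in> I" "j \<in> I" "k \<in> I"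
      "x \<in> cell (on_ob D i) n" "y \<in> cell (on_ob D j) n"
      "(i, k) \<in> r" "(j, k) \<in> r" "tr i k n x = tr j k n y"
      unfolding E_def by (auto simp: coprod_simps)
    then have "snd (on_ob D i) n x = snd (on_ob D j) n y"
      using lhom_label[OF tr_lhom, of i k x n] lhom_label[OF tr_lhom, of j k y n] by simp
    with * show "snd ?P n p = snd ?P n q" by (simp add: coprod_simps)
  next
    fix m n f p q
    assume f: "f \<in> Hom box m n" and "p \<in> cell ?P n" "q \<in> cell ?P n" "E n p q"
    then obtain i x j y k where *: "p = (i, x)" "q = (j, y)" "i \<in> I" "j \<in> I" "k \<in> I"
      "x \<in> cell (on_ob D i) n" "y \<in> cell (on_ob D j) n"
      "(i, k) \<in> r" "(j, k) \<in> r" "tr i k n x = tr j k n y"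
      unfolding E_def by (auto simp: coprod_simps)
    then have "tr i k m (pull (on_ob D i) m n f x) = tr j k m (pull (on_ob D j) m n f y)"
      using lhom_pull[OF tr_lhom f, of i k x] lhom_pull[OF tr_lhom f, of j k y] by simp
    with * show "E m (pull ?P m n f p) (pull ?P m n f q)"
      unfolding E_def by (auto simp: coprod_simps f)
  next
    fix n i j and f :: unit and x
    assume i: "i \<in> I" and j: "j \<in> I" and ij: "(i, j) \<in> r" and x: "x \<in> cell (on_ob D i) n"
    have "tr j j n (tr i j n x) = tr i j n x"
      by (rule tr_refl[OF j lhom_in[OF tr_lhom[OF i j ij] x]])
    then show "E n (j, on_ar D i j f n x) (i, x)"
      using order_refl[OF j] ij j unfolding E_def by auto
  next
    fix n p q assume "p \<in> cell ?P n" "q \<in> cell ?P n" and lab: "snd ?P n p = snd ?P n q"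
      and faces: "\<And>m f. m \<le> 1 \<Longrightarrow> f \<in> Hom box m n \<Longrightarrow> E m (pull ?P m n f p) (pull ?P m n f q)"
    then obtain i x j y where p: "p = (i, x)" and q: "q = (j, y)" and i: "i \<in> I" and j: "j \<in> I"
      and x: "x \<in> cell (on_ob D i) n" and y: "y \<in> cell (on_ob D j) n"
      by (auto simp: coprod_simps)
    \<comment> \<open>The finitely many vertices and edges, at each of which \<open>p\<close> and \<open>q\<close> are to agree.\<close>
    define T where "T = (SIGMA m:{..1::nat}. Hom box m n)"
    define Q where "Q t k \<longleftrightarrow> (i, k) \<in> r \<and> (j, k) \<in> r \<and>
        tr i k (fst t) (pull (on_ob D i) (fst t) n (snd t) x) =
        tr j k (fst t) (pull (on_ob D j) (fst t) n (snd t) y)" for t k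
    have "finite T" by (simp add: T_def finite_Hom_box)
    moreover have "\<exists>k\<in>I. Q t k" if "t \<in> T" for t
      using faces[of "fst t" "snd t"] that i j x y
      by (auto simp: T_def Q_def E_def p q coprod_simps)
    moreover have "Q t l" if "t \<in> T" "k \<in> I" "l \<in> I" and kl: "(k, l) \<in> r" and Qk: "Q t k" for t k l
    proof -
      have t: "snd t \<in> Hom box (fst t) n" using that by (auto simp: T_def)
      have "tr i l (fst t) (pull (on_ob D i) (fst t) n (snd t) x) =
        tr j l (fst t) (pull (on_ob D j) (fst t) n (snd t) y)"
        by (rule later[of i j k])
          (use that i j x y t in \<open>auto simp: Q_def pull_in[OF stage_labelled]\<close>)
      then show ?thesis using Qk kl order_trans by (auto simp: Q_def)
    qed
    ultimately obtain k where k: "k \<in> I" "(i, k) \<in> r" "(j, k) \<in> r" "\<And>t. t \<in> T \<Longrightarrow> Q t k"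
      using eventually_all[OF _ i j, of T Q] by blast
    have ik: "tr i k \<in> lhom (on_ob D i) (on_ob D k)" and jk: "tr j k \<in> lhom (on_ob D j) (on_ob D k)"
      using k i j by (auto intro: tr_lhom)
    have "tr i k n x = tr j k n y"
    proof (rule separatedD[OF stage_separated[OF k(1)] lhom_in[OF ik x] lhom_in[OF jk y]])
      have "pull (on_ob D k) m n f (tr i k n x) = pull (on_ob D k) m n f (tr j k n y)"
        if "m \<le> 1" "f \<in> Hom box m n" for m f
        using k(4)[of "(m, f)"] that
        by (simp add: T_def Q_def lhom_pull[OF ik _ x] lhom_pull[OF jk _ y])
      moreover have "snd (on_ob D k) n (tr i k n x) = snd (on_ob D k) n (tr j k n y)"
        using lab x y i j by (simp add: lhom_label[OF ik] lhom_label[OF jk] p q coprod_simps)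
      ultimately show "same_shape (on_ob D k) n (tr i k n x) (tr j k n y)"
        by (simp add: same_shape_def)
    qed
    with k show "E n p q" by (auto simp: E_def p q)
  qed
  then obtain Y d where d: "is_cocone ?J (HDA TYPE('u) \<Sigma>) D Y d"
    and cover: "\<And>n z. z \<in> cell Y n \<Longrightarrow> \<exists>i\<in>I. \<exists>x\<in>cell (on_ob D i) n. z = d i n x"
    and ident: "\<And>n i j x y. i \<in> I \<Longrightarrow> j \<in> I \<Longrightarrow> x \<in> cell (on_ob D i) n \<Longrightarrow>
      y \<in> cell (on_ob D j) n \<Longrightarrow> d i n x = d j n y \<longleftrightarrow> E n (i, x) (j, y)"
    unfolding poset_simps by blast
  have colim: "is_colimit ?J (HDA TYPE('u) \<Sigma>) D Y d"
  proof (rule is_colimit_HDA_I[OF diagram d], unfold poset_simps)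
    fix Z e n i j x y
    assume e: "is_cocone ?J (HDA TYPE('u) \<Sigma>) D Z e" and *: "i \<in> I" "j \<in> I"
      "x \<in> cell (on_ob D i) n" "y \<in> cell (on_ob D j) n" "d i n x = d j n y"
    then obtain k where k: "k \<in> I" "(i, k) \<in> r" "(j, k) \<in> r" "tr i k n x = tr j k n y"
      using ident by (auto simp: E_def)
    then show "e i n x = e j n y"
      using cocone_HDA_arrow[OF e, of i k "()" x n] cocone_HDA_arrow[OF e, of j k "()" y n] *
      by (simp add: poset_simps)
  qed (rule cover)
  \<comment> \<open>\<open>v \<circ> u = id\<close> on \<open>X\<close> carries the two properties from \<open>Y\<close> over to \<open>X\<close>.\<close>
  have c: "is_cocone ?J (HDA TYPE('u) \<Sigma>) D X c" using X by (simp add: is_colimit_def)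
  obtain u where u: "u \<in> lhom X Y" "\<And>j. j \<in> I \<Longrightarrow> psh_comp (fst (on_ob D j)) u (c j) = d j"
    using X d unfolding is_colimit_def HDA_simps(2-) poset_simps by blast
  obtain v where v: "v \<in> lhom Y X" "\<And>j. j \<in> I \<Longrightarrow> psh_comp (fst (on_ob D j)) v (d j) = c j"
    using colim c unfolding is_colimit_def HDA_simps(2-) poset_simps by blast
  have lX: "labelled \<Sigma> X" and cj: "\<And>j. j \<in> I \<Longrightarrow> c j \<in> lhom (on_ob D j) X"
    using c by (simp_all add: is_cocone_HDA Obj_HDA poset_simps)
  have uc: "u n (c i n x) = d i n x" if "i \<in> I" "x \<in> cell (on_ob D i) n" for i n x
    using fun_cong[OF fun_cong[OF u(2)[OF that(1)], of n], of x] that(2) by simp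
  have vd: "v n (d i n x) = c i n x" if "i \<in> I" "x \<in> cell (on_ob D i) n" for i n x
    using fun_cong[OF fun_cong[OF v(2)[OF that(1)], of n], of x] that(2) by simp
  have retract: "psh_comp (fst X) v u = psh_incl (fst X)"
  proof -
    have "psh_comp (fst (on_ob D j)) (psh_comp (fst X) v u) (c j) = c j"
      "psh_comp (fst (on_ob D j)) (psh_incl (fst X)) (c j) = c j" if j: "j \<in> I" for j
      by (rule ext, rule extensionalityI, rule psh_comp_extensional,
          rule lhom_extensional[OF cj[OF j]],
          simp add: lhom_in[OF cj[OF j]] uc[OF j] vd[OF j])+
    moreover have "psh_comp (fst X) v u \<in> lhom X X" "psh_incl (fst X) \<in> lhom X X"
      using lhom_comp[OF lX u(1) v(1)] lhom_incl[OF lX] .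
    ultimately show ?thesis
      using X c unfolding is_colimit_def HDA_simps(2-) poset_simps by blast
  qed
  have vu: "v n (u n z) = z" if "z \<in> cell X n" for n z
  proof -
    have "psh_comp (fst X) v u n z = psh_incl (fst X) n z"
      by (simp only: retract)
    with that show ?thesis by simp
  qed
  show "\<exists>i\<in>I. \<exists>x\<in>cell (on_ob D i) n. z = c i n x" if "z \<in> cell X n"
    using cover[OF lhom_in[OF u(1) that]] vu[OF that] vd by metis
  show "\<exists>k\<in>I. (i, k) \<in> r \<and> (j, k) \<in> r \<and> tr i k n x = tr j k n y"
    if "i \<in> I" "j \<in> I" "x \<in> cell (on_ob D i) n" "y \<in> cell (on_ob D j) n" "c i n x = c j n y"
  proof -
    have "d i n x = d j n y" using uc[OF that(1,3)] uc[OF that(2,4)] that(5) by simp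
    then show ?thesis using ident[OF that(1-4)] by (auto simp: E_def)
  qed
qed

end

section \<open>Finite presheaves are finitely presentable\<close>

lemma is_cocone_sets:
  "is_cocone J sets_cat F A c \<longleftrightarrow>
     (\<forall>j\<in>Obj J. c j \<in> on_ob F j \<rightarrow>\<^sub>E A) \<and>
     (\<forall>i\<in>Obj J. \<forall>j\<in>Obj J. \<forall>f\<in>Hom J i j. compose (on_ob F i) (c j) (on_ar F i j f) = c i)"
  unfolding is_cocone_def sets_cat_def cat.simps by blast

lemma is_colimit_sets_I:
  assumes c: "is_cocone J sets_cat F A c"
    and surj: "\<And>z. z \<in> A \<Longrightarrow> \<exists>i\<in>Obj J. \<exists>x\<in>on_ob F i. z = c i x"
    and ident: "\<And>B d. is_cocone J sets_cat F B d \<Longrightarrow>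
      \<forall>i\<in>Obj J. \<forall>j\<in>Obj J. \<forall>x\<in>on_ob F i. \<forall>y\<in>on_ob F j. c i x = c j y \<longrightarrow> d i x = d j y"
  shows "is_colimit J sets_cat F A c"
  unfolding is_colimit_def
proof (intro conjI allI impI c)
  fix B d assume d: "is_cocone J sets_cat F B d"
  have dj: "d j \<in> on_ob F j \<rightarrow>\<^sub>E B" and cj: "c j \<in> on_ob F j \<rightarrow>\<^sub>E A" if "j \<in> Obj J" for j
    using c d that unfolding is_cocone_sets by blast+
  define p where "p z = (SOME p. fst p \<in> Obj J \<and> snd p \<in> on_ob F (fst p) \<and> c (fst p) (snd p) = z)" for z
  have ex: "\<exists>p. fst p \<in> Obj J \<and> snd p \<in> on_ob F (fst p) \<and> c (fst p) (snd p) = z" if "z \<in> A" for z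
  proof -
    from surj[OF that] obtain i x where "i \<in> Obj J" "x \<in> on_ob F i" "z = c i x" by blast
    then show ?thesis by (intro exI[of _ "(i, x)"]) simp
  qed
  have p: "fst (p z) \<in> Obj J \<and> snd (p z) \<in> on_ob F (fst (p z)) \<and> c (fst (p z)) (snd (p z)) = z"
    if "z \<in> A" for z
    unfolding p_def using someI_ex[OF ex[OF that]] .
  define u where "u = (\<lambda>z\<in>A. d (fst (p z)) (snd (p z)))"
  have u: "u (c i x) = d i x" if i: "i \<in> Obj J" and x: "x \<in> on_ob F i" for i x
  proof -
    have z: "c i x \<in> A" by (rule PiE_mem[OF cj[OF i] x])
    then have "u (c i x) = d (fst (p (c i x))) (snd (p (c i x)))" by (simp add: u_def)
    also have "\<dots> = d i x" using p[OF z] i x ident[OF d] by blast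
    finally show ?thesis .
  qed
  have uB: "u \<in> A \<rightarrow>\<^sub>E B"
  proof (rule PiE_I)
    fix z assume "z \<in> A"
    then show "u z \<in> B" using p[of z] PiE_mem[OF dj, of "fst (p z)" "snd (p z)"] by (simp add: u_def)
  qed (simp add: u_def)
  have uc: "compose (on_ob F j) u (c j) = d j" if "j \<in> Obj J" for j
    by (rule extensionalityI[of _ "on_ob F j"])
      (use dj[OF that] that in \<open>auto simp: compose_def u PiE_iff\<close>)
  have unique: "v = u" if v: "v \<in> A \<rightarrow>\<^sub>E B" "\<forall>j\<in>Obj J. compose (on_ob F j) v (c j) = d j" for v
  proof (rule PiE_ext[OF v(1) uB])
    fix z assume "z \<in> A"
    from surj[OF this] obtain i x where x: "i \<in> Obj J" "x \<in> on_ob F i" "z = c i x" by blast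
    have "compose (on_ob F i) v (c i) x = d i x" using v x by simp
    then show "v z = u z" using x u by (simp add: compose_def)
  qed
  show "\<exists>!u. u \<in> Hom sets_cat A B \<and> (\<forall>j\<in>Obj J. Comp sets_cat (on_ob F j) A B u (c j) = d j)"
    unfolding sets_cat_def cat.simps
  proof (rule ex1I[of _ u], intro conjI ballI)
    show "u \<in> A \<rightarrow>\<^sub>E B" by (rule uB)
    show "compose (on_ob F j) u (c j) = d j" if "j \<in> Obj J" for j by (rule uc[OF that])
    show "v = u" if "v \<in> A \<rightarrow>\<^sub>E B \<and> (\<forall>j\<in>Obj J. compose (on_ob F j) v (c j) = d j)" for v
      by (rule unique[OF conjunct1[OF that] conjunct2[OF that]])
  qed
qed

lemma is_cocone_hom_functor:
  assumes P: "P \<in> Obj C" and D: "is_functor J C D" and c: "is_cocone J C D X c"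
  shows "is_cocone J sets_cat (functor_comp (hom_functor C P) D) (Hom C P X)
    (\<lambda>i. on_ar (hom_functor C P) (on_ob D i) X (c i))"
  unfolding is_cocone_sets
proof (intro conjI ballI)
  have C: "category C" by (rule is_functorD(2)[OF D])
  have X: "X \<in> Obj C" and cj: "\<And>j. j \<in> Obj J \<Longrightarrow> c j \<in> Hom C (on_ob D j) X"
    and comm: "\<And>i j f. i \<in> Obj J \<Longrightarrow> j \<in> Obj J \<Longrightarrow> f \<in> Hom J i j \<Longrightarrow>
      Comp C (on_ob D i) (on_ob D j) X (c j) (on_ar D i j f) = c i"
    using c unfolding is_cocone_def by blast+
  fix i assume i: "i \<in> Obj J"
  note Di = is_functorD(3)[OF D i]
  show "on_ar (hom_functor C P) (on_ob D i) X (c i)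
      \<in> on_ob (functor_comp (hom_functor C P) D) i \<rightarrow>\<^sub>E Hom C P X"
    using category_Comp[OF C P Di X _ cj[OF i]] by (auto simp: hom_functor_def functor_comp_def)
  fix j f assume j: "j \<in> Obj J" and f: "f \<in> Hom J i j"
  note Dj = is_functorD(3)[OF D j] and Df = is_functorD(4)[OF D i j f]
  have "Comp C P (on_ob D j) X (c j) (Comp C P (on_ob D i) (on_ob D j) (on_ar D i j f) g) =
      Comp C P (on_ob D i) X (c i) g" if g: "g \<in> Hom C P (on_ob D i)" for g
    using category_assoc[OF C P Di Dj X g Df cj[OF j]] comm[OF i j f] by simp
  then show "compose (on_ob (functor_comp (hom_functor C P) D) i)
      (on_ar (hom_functor C P) (on_ob D j) X (c j))
      (on_ar (functor_comp (hom_functor C P) D) i j f) =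
      on_ar (hom_functor C P) (on_ob D i) X (c i)"
    using category_Comp[OF C P Di Dj _ Df]
    by (simp add: compose_def hom_functor_def functor_comp_def cong: restrict_cong)
qed

context directed_diagram
begin

text \<open>
  The finitely many values of \<open>g\<close> lift to a common stage \<open>k\<close>. The lifts \<open>h\<close> need not be compatible with
  faces, but compatibility amounts to finitely many equations that hold in the colimit, hence at a later
  stage \<open>l\<close>.
\<close>

lemma finite_lhom_factors:
  assumes X: "is_colimit (poset_cat I r) (HDA TYPE('u) \<Sigma>) D X c"
    and P: "labelled \<Sigma> P" and fin: "finite (SIGMA n:UNIV. cell P n)" and g: "g \<in> lhom P X"
  shows "\<exists>i\<in>I. \<exists>h\<in>lhom P (on_ob D i). psh_comp (fst P) (c i) h = g"
proof -
  note cover = colimit_cover_and_identify(1)[OF X] and ident = colimit_cover_and_identify(2)[OF X]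
  have c: "is_cocone (poset_cat I r) (HDA TYPE('u) \<Sigma>) D X c" using X by (simp add: is_colimit_def)
  then have cj: "\<And>j. j \<in> I \<Longrightarrow> c j \<in> lhom (on_ob D j) X" by (simp add: is_cocone_HDA poset_simps)
  have c_tr: "c k n (tr i k n x) = c i n x"
    if "i \<in> I" "k \<in> I" "(i, k) \<in> r" "x \<in> cell (on_ob D i) n" for i k n x
    using cocone_HDA_arrow[OF c, of i k "()" x n] that by (simp add: poset_simps)
  define T where "T = (SIGMA n:UNIV. cell P n)"
  obtain i0 where i0: "i0 \<in> I" using bound[of "{}"] by auto
  have "\<exists>k\<in>I. (i0, k) \<in> r \<and> (i0, k) \<in> r \<and>
      (\<forall>t\<in>T. \<exists>x\<in>cell (on_ob D k) (fst t). c k (fst t) x = g (fst t) (snd t))"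
  proof (rule eventually_all[OF fin[folded T_def] i0 i0])
    fix t assume "t \<in> T"
    then have "g (fst t) (snd t) \<in> cell X (fst t)" using lhom_in[OF g] by (auto simp: T_def)
    from cover[OF this]
    show "\<exists>k\<in>I. \<exists>x\<in>cell (on_ob D k) (fst t). c k (fst t) x = g (fst t) (snd t)" by metis
  next
    fix t k l assume k: "k \<in> I" and l: "l \<in> I" and kl: "(k, l) \<in> r"
      and "\<exists>x\<in>cell (on_ob D k) (fst t). c k (fst t) x = g (fst t) (snd t)"
    then show "\<exists>x\<in>cell (on_ob D l) (fst t). c l (fst t) x = g (fst t) (snd t)"
      using c_tr[OF k l kl] lhom_in[OF tr_lhom[OF k l kl]] by metis
  qed
  then obtain k where k: "k \<in> I"
    and "\<forall>t\<in>T. \<exists>x\<in>cell (on_ob D k) (fst t). c k (fst t) x = g (fst t) (snd t)" by blast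
  then have "\<forall>n. \<forall>p\<in>cell P n. \<exists>x\<in>cell (on_ob D k) n. c k n x = g n p" by (auto simp: T_def)
  then obtain h where h: "h n p \<in> cell (on_ob D k) n" "c k n (h n p) = g n p"
    if "p \<in> cell P n" for n p
    by metis
  \<comment> \<open>One equation for each cell \<open>p\<close> of \<open>P\<close> and each of its faces.\<close>
  define T' where "T' = (SIGMA t:T. SIGMA m:{..fst t}. Hom box m (fst t))"
  have fin': "finite T'"
    unfolding T'_def by (intro finite_SigmaI) (auto simp: T_def fin finite_Hom_box)
  have "\<exists>l\<in>I. (k, l) \<in> r \<and> (k, l) \<in> r \<and> (\<forall>t\<in>T'. (case t of ((n, p), m, f) \<Rightarrow> (k, l) \<in> r \<and>
      tr k l m (h m (pull P m n f p)) = tr k l m (pull (on_ob D k) m n f (h n p))))"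
  proof (rule eventually_all[OF fin' k k])
    fix t assume "t \<in> T'"
    then obtain n p m f where t: "t = ((n, p), m, f)" and p: "p \<in> cell P n" and f: "f \<in> Hom box m n"
      by (auto simp: T'_def T_def)
    have Pf: "pull P m n f p \<in> cell P m" by (rule pull_in[OF P f p])
    have Df: "pull (on_ob D k) m n f (h n p) \<in> cell (on_ob D k) m"
      by (rule pull_in[OF stage_labelled[OF k] f h(1)[OF p]])
    have "c k m (h m (pull P m n f p)) = c k m (pull (on_ob D k) m n f (h n p))"
      by (simp add: h Pf p lhom_pull[OF g f p] lhom_pull[OF cj[OF k] f h(1)[OF p]])
    from ident[OF k k h(1)[OF Pf] Df this]
    show "\<exists>l\<in>I. case t of ((n, p), m, f) \<Rightarrow> (k, l) \<in> r \<and>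
        tr k l m (h m (pull P m n f p)) = tr k l m (pull (on_ob D k) m n f (h n p))"
      by (auto simp: t)
  next
    fix t l l' assume "t \<in> T'" and l: "l \<in> I" "l' \<in> I" "(l, l') \<in> r"
      and eq: "case t of ((n, p), m, f) \<Rightarrow> (k, l) \<in> r \<and>
        tr k l m (h m (pull P m n f p)) = tr k l m (pull (on_ob D k) m n f (h n p))"
    then obtain n p m f where t: "t = ((n, p), m, f)" and p: "p \<in> cell P n" and f: "f \<in> Hom box m n"
      by (auto simp: T'_def T_def)
    have kl: "(k, l) \<in> r" using eq by (simp add: t)
    have "h m (pull P m n f p) \<in> cell (on_ob D k) m" by (rule h(1)[OF pull_in[OF P f p]])
    moreover have "pull (on_ob D k) m n f (h n p) \<in> cell (on_ob D k) m"
      by (rule pull_in[OF stage_labelled[OF k] f h(1)[OF p]])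
    ultimately show "case t of ((n, p), m, f) \<Rightarrow> (k, l') \<in> r \<and>
        tr k l' m (h m (pull P m n f p)) = tr k l' m (pull (on_ob D k) m n f (h n p))"
      using eq order_trans[OF kl l(3)] tr_trans[OF k l(1,2) kl l(3), symmetric] by (simp add: t)
  qed
  then obtain l where l: "l \<in> I" "(k, l) \<in> r" and T': "\<forall>t\<in>T'. (case t of ((n, p), m, f) \<Rightarrow> (k, l) \<in> r \<and>
      tr k l m (h m (pull P m n f p)) = tr k l m (pull (on_ob D k) m n f (h n p)))"
    by blast
  have nat: "tr k l m (h m (pull P m n f p)) = tr k l m (pull (on_ob D k) m n f (h n p))"
    if "f \<in> Hom box m n" "p \<in> cell P n" for m n f p
    using T' that Hom_box_le[OF that(1)] by (auto simp: T'_def T_def)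
  note kl = tr_lhom[OF k l]
  define h' where "h' n = (\<lambda>p\<in>cell P n. tr k l n (h n p))" for n
  have ch': "c l n (h' n p) = g n p" if "p \<in> cell P n" for n p
    using that by (simp add: h'_def c_tr[OF k l] h)
  have h': "h' \<in> lhom P (on_ob D l)"
  proof (rule lhomI[OF P])
    fix n p assume p: "p \<in> cell P n"
    show in_l: "h' n p \<in> cell (on_ob D l) n"
      using p lhom_in[OF kl h(1)[OF p]] by (simp add: h'_def)
    show "snd (on_ob D l) n (h' n p) = snd P n p"
      using lhom_label[OF cj[OF l(1)] in_l] lhom_label[OF g p] ch'[OF p] by simp
    fix m f assume f: "f \<in> Hom box m n"
    show "h' m (pull P m n f p) = pull (on_ob D l) m n f (h' n p)"
      using nat[OF f p] lhom_pull[OF kl f h(1)[OF p]] p pull_in[OF P f p] by (simp add: h'_def)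
  qed (simp add: h'_def)
  moreover have "psh_comp (fst P) (c l) h' = g"
    by (rule ext, rule extensionalityI, rule psh_comp_extensional, rule lhom_extensional[OF g])
      (simp add: ch')
  ultimately show ?thesis using l(1) by blast
qed

text \<open>
  Two morphisms out of \<open>P\<close> that agree in the colimit agree on each of the finitely many cells of \<open>P\<close> at
  some stage, hence on all of them at a common stage.
\<close>

lemma finite_lhom_identified:
  assumes X: "is_colimit (poset_cat I r) (HDA TYPE('u) \<Sigma>) D X c"
    and fin: "finite (SIGMA n:UNIV. cell P n)" and i: "i \<in> I" and j: "j \<in> I"
    and g: "g \<in> lhom P (on_ob D i)" and h: "h \<in> lhom P (on_ob D j)"
    and eq: "psh_comp (fst P) (c i) g = psh_comp (fst P) (c j) h"
  shows "\<exists>k\<in>I. (i, k) \<in> r \<and> (j, k) \<in> r \<and>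
    psh_comp (fst P) (tr i k) g = psh_comp (fst P) (tr j k) h"
proof -
  note ident = colimit_cover_and_identify(2)[OF X]
  define T where "T = (SIGMA n:UNIV. cell P n)"
  have "\<exists>k\<in>I. (i, k) \<in> r \<and> (j, k) \<in> r \<and> (\<forall>t\<in>T. (i, k) \<in> r \<and> (j, k) \<in> r \<and>
      tr i k (fst t) (g (fst t) (snd t)) = tr j k (fst t) (h (fst t) (snd t)))"
  proof (rule eventually_all[OF fin[folded T_def] i j])
    fix t assume "t \<in> T"
    then have t: "snd t \<in> cell P (fst t)" by (auto simp: T_def)
    have "psh_comp (fst P) (c i) g (fst t) (snd t) = psh_comp (fst P) (c j) h (fst t) (snd t)"
      by (simp only: eq)
    then have "c i (fst t) (g (fst t) (snd t)) = c j (fst t) (h (fst t) (snd t))" using t by simp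
    from ident[OF i j lhom_in[OF g t] lhom_in[OF h t] this]
    show "\<exists>k\<in>I. (i, k) \<in> r \<and> (j, k) \<in> r \<and>
        tr i k (fst t) (g (fst t) (snd t)) = tr j k (fst t) (h (fst t) (snd t))" .
  next
    fix t k l assume "t \<in> T" and k: "k \<in> I" and l: "l \<in> I" and kl: "(k, l) \<in> r"
      and eq: "(i, k) \<in> r \<and> (j, k) \<in> r \<and>
        tr i k (fst t) (g (fst t) (snd t)) = tr j k (fst t) (h (fst t) (snd t))"
    then have t: "snd t \<in> cell P (fst t)" by (auto simp: T_def)
    have ik: "(i, k) \<in> r" and jk: "(j, k) \<in> r" using eq by auto
    show "(i, l) \<in> r \<and> (j, l) \<in> r \<and>
        tr i l (fst t) (g (fst t) (snd t)) = tr j l (fst t) (h (fst t) (snd t))"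
      using eq order_trans[OF ik kl] order_trans[OF jk kl]
        tr_trans[OF i k l ik kl lhom_in[OF g t]] tr_trans[OF j k l jk kl lhom_in[OF h t]] by simp
  qed
  then obtain k where k: "k \<in> I" "(i, k) \<in> r" "(j, k) \<in> r"
    and eq': "\<forall>t\<in>T. tr i k (fst t) (g (fst t) (snd t)) = tr j k (fst t) (h (fst t) (snd t))"
    by blast
  have "psh_comp (fst P) (tr i k) g = psh_comp (fst P) (tr j k) h"
    by (rule ext, rule extensionalityI, rule psh_comp_extensional, rule psh_comp_extensional)
      (use eq' in \<open>simp add: T_def\<close>)
  with k show ?thesis by blast
qed

lemma hom_functor_preserves_colimit:
  assumes X: "is_colimit (poset_cat I r) (HDA TYPE('u) \<Sigma>) D X c"
    and P: "P \<in> Obj (HDA TYPE('u) \<Sigma>)" and fin: "finite (SIGMA n:UNIV. cell P n)"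
  shows "is_colimit (poset_cat I r) sets_cat (functor_comp (hom_functor (HDA TYPE('u) \<Sigma>) P) D)
    (Hom (HDA TYPE('u) \<Sigma>) P X) (\<lambda>i. on_ar (hom_functor (HDA TYPE('u) \<Sigma>) P) (on_ob D i) X (c i))"
proof -
  define H where "H = functor_comp (hom_functor (HDA TYPE('u) \<Sigma>) P) D"
  define leg where "leg i = on_ar (hom_functor (HDA TYPE('u) \<Sigma>) P) (on_ob D i) X (c i)" for i
  have c: "is_cocone (poset_cat I r) (HDA TYPE('u) \<Sigma>) D X c" using X by (simp add: is_colimit_def)
  have lP: "labelled \<Sigma> P" using P by (simp add: Obj_HDA)
  have ob: "on_ob H i = lhom P (on_ob D i)" for i
    by (simp add: H_def functor_comp_def hom_functor_def HDA_simps(2))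
  have ar: "on_ar H i k f = (\<lambda>g\<in>lhom P (on_ob D i). psh_comp (fst P) (on_ar D i k f) g)" for i k f
    by (simp add: H_def functor_comp_def hom_functor_def HDA_simps(2-))
  have leg: "leg i g = psh_comp (fst P) (c i) g" if "g \<in> lhom P (on_ob D i)" for i g
    using that by (simp add: leg_def hom_functor_def HDA_simps(2-))
  have "is_colimit (poset_cat I r) sets_cat H (lhom P X) leg"
  proof (rule is_colimit_sets_I)
    show "is_cocone (poset_cat I r) sets_cat H (lhom P X) leg"
      using is_cocone_hom_functor[OF P diagram c] unfolding H_def leg_def HDA_simps(2) .
  next
    fix g assume "g \<in> lhom P X"
    from finite_lhom_factors[OF X lP fin this] obtain i h
      where "i \<in> I" "h \<in> lhom P (on_ob D i)" "psh_comp (fst P) (c i) h = g" by blast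
    then show "\<exists>i\<in>Obj (poset_cat I r). \<exists>h\<in>on_ob H i. g = leg i h"
      unfolding poset_simps ob using leg by metis
  next
    fix B d assume d: "is_cocone (poset_cat I r) sets_cat H B d"
    have d_tr: "d k (psh_comp (fst P) (tr i k) g) = d i g"
      if "i \<in> I" "k \<in> I" "(i, k) \<in> r" "g \<in> lhom P (on_ob D i)" for i k g
    proof -
      have "() \<in> Hom (poset_cat I r) i k" using that(3) by (simp add: poset_simps)
      then have "compose (on_ob H i) (d k) (on_ar H i k ()) = d i"
        using d that(1,2) unfolding is_cocone_sets poset_simps(1) by blast
      then have "compose (on_ob H i) (d k) (on_ar H i k ()) g = d i g" by (rule fun_cong)
      then show ?thesis using that(4) by (simp add: compose_def ar ob)
    qed
    show "\<forall>i\<in>Obj (poset_cat I r). \<forall>j\<in>Obj (poset_cat I r). \<forall>g\<in>on_ob H i. \<forall>h\<in>on_ob H j.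
        leg i g = leg j h \<longrightarrow> d i g = d j h"
    proof (intro ballI impI, unfold poset_simps ob)
      fix i j g h
      assume i: "i \<in> I" and j: "j \<in> I" and g: "g \<in> lhom P (on_ob D i)"
        and h: "h \<in> lhom P (on_ob D j)" and eq: "leg i g = leg j h"
      have "psh_comp (fst P) (c i) g = psh_comp (fst P) (c j) h"
        using eq leg[OF g] leg[OF h] by simp
      from finite_lhom_identified[OF X fin i j g h this] obtain k
        where k: "k \<in> I" "(i, k) \<in> r" "(j, k) \<in> r"
          and later: "psh_comp (fst P) (tr i k) g = psh_comp (fst P) (tr j k) h" by blast
      have "d i g = d k (psh_comp (fst P) (tr i k) g)" by (rule d_tr[OF i k(1,2) g, symmetric])
      also have "\<dots> = d j h" unfolding later by (rule d_tr[OF j k(1,3) h])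
      finally show "d i g = d j h" .
    qed
  qed
  then show ?thesis unfolding H_def leg_def HDA_simps(2) .
qed

end

lemma directed_poset_bound:
  assumes lam: "small_regular_cardinal lam" and I: "directed_poset lam I r"
    and S: "finite S" "S \<subseteq> I"
  shows "\<exists>u\<in>I. \<forall>s\<in>S. (s, u) \<in> r"
proof -
  have lam': "infinite (Field lam)" "Card_order lam"
    using lam unfolding small_regular_cardinal_def by blast+
  have "|S| <o lam"
    using finite_ordLess_infinite[OF card_of_Well_order, of lam S] lam' S(1)
    by (simp add: card_order_on_def Field_card_of)
  with I S(2) show ?thesis unfolding directed_poset_def by blast
qed

lemma finite_presentable:
  fixes P :: "('u, 'l) lpsh"
  assumes U: "size_universe TYPE('u)" and lam: "small_regular_cardinal (lam :: 'u rel)"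
    and P: "P \<in> Obj (HDA TYPE('u) \<Sigma>)" and fin: "finite (SIGMA n:UNIV. cell P n)"
  shows "presentable lam (HDA TYPE('u) \<Sigma>) P"
  unfolding presentable_def
proof (intro conjI allI impI P)
  fix I :: "'u set" and r D X c
  assume *: "small TYPE('u) I \<and> directed_poset lam I r \<and>
    is_functor (poset_cat I r) (HDA TYPE('u) \<Sigma>) D \<and> is_colimit (poset_cat I r) (HDA TYPE('u) \<Sigma>) D X c"
  then interpret directed_diagram I r D \<Sigma>
    using U directed_poset_bound[OF lam, of I r]
    by unfold_locales (simp_all add: directed_poset_def)
  show "is_colimit (poset_cat I r) sets_cat (functor_comp (hom_functor (HDA TYPE('u) \<Sigma>) P) D)
    (Hom (HDA TYPE('u) \<Sigma>) P X) (\<lambda>i. on_ar (hom_functor (HDA TYPE('u) \<Sigma>) P) (on_ob D i) X (c i))"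
    using hom_functor_preserves_colimit[OF _ P fin] * by blast
qed

section \<open>Generation by finite presheaves\<close>

text \<open>
  A morphism is determined by its graph, a subset of a small set.
\<close>

lemma locally_small_HDA:
  fixes \<Sigma> :: "'l set"
  assumes U: "size_universe TYPE('u)" and pow: "power_closed TYPE('u)"
  shows "locally_small TYPE('u) (HDA TYPE('u) \<Sigma>)"
  unfolding locally_small_def HDA_simps(2)
proof (intro ballI)
  fix X Y :: "('u, 'l) lpsh"
  assume X: "X \<in> Obj (HDA TYPE('u) \<Sigma>)" and Y: "Y \<in> Obj (HDA TYPE('u) \<Sigma>)"
  define W where "W = (SIGMA n:UNIV. cell X n \<times> cell Y n)"
  define graph where "graph \<phi> = (\<lambda>(n, x). (n, x, \<phi> n x)) ` (SIGMA n:UNIV. cell X n)"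
    for \<phi> :: "nat \<Rightarrow> 'u \<Rightarrow> 'u"
  have "small TYPE('u) W"
    unfolding W_def using X Y
    by (intro small_Sigma[OF U] small_nat[OF U]) (simp_all add: Obj_HDA)
  then have "small TYPE('u) (Pow W)" by (rule small_Pow[OF pow])
  moreover have "graph ` lhom X Y \<subseteq> Pow W"
    by (auto simp: graph_def W_def lhom_in)
  ultimately have "small TYPE('u) (graph ` lhom X Y)" by (rule small_subset)
  moreover have "inj_on graph (lhom X Y)"
  proof (rule inj_onI)
    fix \<phi> \<psi> assume \<phi>: "\<phi> \<in> lhom X Y" and \<psi>: "\<psi> \<in> lhom X Y" and eq: "graph \<phi> = graph \<psi>"
    show "\<phi> = \<psi>"
    proof (rule lhom_eqI[OF \<phi> \<psi>])
      fix n x assume "x \<in> cell X n"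
      then have "(n, x, \<phi> n x) \<in> graph \<phi>" by (force simp: graph_def)
      then have "(n, x, \<phi> n x) \<in> graph \<psi>" by (simp only: eq)
      then show "\<phi> n x = \<psi> n x" by (auto simp: graph_def)
    qed
  qed
  ultimately show "small TYPE('u) (lhom X Y)" by (rule small_inj_on)
qed

definition closed_cells :: "('a, 'l) lpsh \<Rightarrow> (nat \<times> 'a) set \<Rightarrow> bool" where
  "closed_cells X F \<longleftrightarrow> F \<subseteq> (SIGMA n:UNIV. cell X n) \<and>
     (\<forall>n x. (n, x) \<in> F \<longrightarrow> (\<forall>m. \<forall>f\<in>Hom box m n. (m, pull X m n f x) \<in> F))"

definition sub :: "('a, 'l) lpsh \<Rightarrow> (nat \<times> 'a) set \<Rightarrow> ('a, 'l) lpsh" where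
  "sub X F =
     (\<lparr> cells = (\<lambda>n. F `` {n}),
        act = (\<lambda>m n. \<lambda>f\<in>Hom box m n. \<lambda>x\<in>F `` {n}. pull X m n f x) \<rparr>,
      \<lambda>n. \<lambda>x\<in>F `` {n}. snd X n x)"

lemma sub_simps:
  "cell (sub X F) n = F `` {n}"
  "f \<in> Hom box m n \<Longrightarrow> (n, x) \<in> F \<Longrightarrow> pull (sub X F) m n f x = pull X m n f x"
  "(n, x) \<in> F \<Longrightarrow> snd (sub X F) n x = snd X n x"
  by (simp_all add: sub_def)

lemma closed_cellsD:
  assumes "closed_cells X F" "(n, x) \<in> F"
  shows "x \<in> cell X n" and "f \<in> Hom box m n \<Longrightarrow> (m, pull X m n f x) \<in> F"
  using assms by (auto simp: closed_cells_def)

lemma labelled_sub: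
  assumes X: "labelled \<Sigma> X" and F: "closed_cells X F"
  shows "labelled \<Sigma> (sub X F)"
  unfolding labelled_iff
proof (intro conjI allI ballI)
  fix m n
  show "pull (sub X F) m n \<in> Hom box m n \<rightarrow>\<^sub>E (cell (sub X F) n \<rightarrow>\<^sub>E cell (sub X F) m)"
    by (intro PiE_I) (auto simp: sub_def closed_cellsD[OF F])
  show "snd (sub X F) n \<in> cell (sub X F) n \<rightarrow>\<^sub>E words \<Sigma> n"
    by (intro PiE_I) (auto simp: sub_def closed_cellsD[OF F] label_in[OF X])
next
  fix n x assume "x \<in> cell (sub X F) n"
  then have x: "(n, x) \<in> F" by (simp add: sub_simps)
  then show "pull (sub X F) n n (Ide box n) x = x"
    by (simp add: sub_simps Ide_box pull_Ide[OF X] closed_cellsD(1)[OF F])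
next
  fix l m n f g x
  assume f: "f \<in> Hom box l m" and g: "g \<in> Hom box m n" and "x \<in> cell (sub X F) n"
  then have x: "(n, x) \<in> F" by (simp add: sub_simps)
  have "(m, pull X m n g x) \<in> F" by (rule closed_cellsD(2)[OF F x g])
  then show "pull (sub X F) l n (Comp box l m n g f) x =
      pull (sub X F) l m f (pull (sub X F) m n g x)"
    using x f g by (simp add: sub_simps Comp_box pull_Comp[OF X f g] closed_cellsD(1)[OF F])
next
  fix m n f x assume f: "f \<in> Hom box m n" and "x \<in> cell (sub X F) n"
  then have x: "(n, x) \<in> F" by (simp add: sub_simps)
  then show "snd (sub X F) m (pull (sub X F) m n f x) = act (bang \<Sigma>) m n f (snd (sub X F) n x)"
    using f closed_cellsD(2)[OF F x f]
    by (simp add: sub_simps label_pull[OF X f] closed_cellsD(1)[OF F])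
qed

lemma separated_of_injective:
  assumes X: "separated X" and j: "j \<in> lhom A X" and inj: "\<And>n. inj_on (j n) (cell A n)"
  shows "separated A"
  unfolding separated_def
proof (intro allI ballI impI)
  fix n x y assume x: "x \<in> cell A n" and y: "y \<in> cell A n" and "same_shape A n x y"
  then have "same_shape X n (j n x) (j n y)"
    by (simp add: same_shape_def lhom_label[OF j] lhom_pull[OF j, symmetric])
  then have "j n x = j n y" by (rule separatedD[OF X lhom_in[OF j x] lhom_in[OF j y]])
  then show "x = y" by (rule inj_onD[OF inj _ x y])
qed

definition finite_objects :: "'u set \<Rightarrow> 'l set \<Rightarrow> ('u, 'l) lpsh set" where
  "finite_objects N \<Sigma> = {X \<in> Obj (HDA TYPE('u) \<Sigma>).
     finite (SIGMA n:UNIV. cell X n) \<and> (\<forall>n. cell X n \<subseteq> N)}"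

text \<open>
  A finite subpresheaf of \<open>X\<close> is isomorphic to one whose cells are elements of the fixed infinite set
  \<open>N\<close>. Passing to such copies keeps the collection of generators small: the finite presheaves with cells
  anywhere in \<open>'u\<close> are at least as numerous as the elements of \<open>'u\<close>.
\<close>

lemma ex_finite_object:
  fixes X :: "('u, 'l) lpsh"
  assumes U: "size_universe TYPE('u)" and N: "infinite (N :: 'u set)"
    and X: "X \<in> Obj (HDA TYPE('u) \<Sigma>)" and F: "closed_cells X F" and fin: "finite F"
  shows "\<exists>A j. A \<in> finite_objects N \<Sigma> \<and> j \<in> lhom A X \<and> (\<forall>n. inj_on (j n) (cell A n)) \<and>
    (\<forall>n. j n ` cell A n = F `` {n})"
proof -
  have lX: "labelled \<Sigma> X" and sX: "separated X" using X by (simp_all add: Obj_HDA)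
  have "\<exists>g :: 'u \<Rightarrow> 'u. inj_on g (F `` {n}) \<and> g ` (F `` {n}) \<subseteq> N" for n
  proof -
    have fin_n: "finite (F `` {n})" using fin by (rule finite_Image)
    obtain B where B: "finite B" "card B = card (F `` {n})" "B \<subseteq> N"
      using infinite_arbitrarily_large[OF N, of "card (F `` {n})"] by blast
    obtain g where "bij_betw g (F `` {n}) B"
      using finite_same_card_bij[OF fin_n B(1)] B(2) by metis
    with B(3) show ?thesis by (auto simp: bij_betw_def)
  qed
  then obtain g :: "nat \<Rightarrow> 'u \<Rightarrow> 'u" where g: "\<And>n. inj_on (g n) (F `` {n})" "\<And>n. g n ` (F `` {n}) \<subseteq> N"
    by metis
  have lS: "labelled \<Sigma> (sub X F)" by (rule labelled_sub[OF lX F])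
  have cong: "congruent (sub X F) g"
    unfolding congruent_def sub_simps(1)
  proof (intro allI ballI impI)
    fix n x y assume "x \<in> F `` {n}" "y \<in> F `` {n}" "g n x = g n y"
    then have "x = y" by (metis g(1) inj_onD)
    then show "snd (sub X F) n x = snd (sub X F) n y \<and>
        (\<forall>m. \<forall>f\<in>Hom box m n. g m (pull (sub X F) m n f x) = g m (pull (sub X F) m n f y))" by simp
  qed
  define A where "A = quot (sub X F) g"
  have incl: "psh_incl (fst (sub X F)) \<in> lhom (sub X F) X"
    by (rule lhomI[OF lS]) (auto simp: psh_incl_def sub_simps closed_cellsD[OF F])
  have "\<exists>!u. u \<in> lhom (quot (sub X F) g) X \<and>
      psh_comp (fst (sub X F)) u (quot_map (sub X F) g) = psh_incl (fst (sub X F))"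
    by (rule quot_factor[OF lS cong incl]) (metis g(1) inj_onD sub_simps(1))
  then obtain j where j: "j \<in> lhom A X"
    and comp: "psh_comp (fst (sub X F)) j (quot_map (sub X F) g) = psh_incl (fst (sub X F))"
    unfolding A_def by blast
  have jg: "j n (g n x) = x" if "(n, x) \<in> F" for n x
  proof -
    have "psh_comp (fst (sub X F)) j (quot_map (sub X F) g) n x = psh_incl (fst (sub X F)) n x"
      by (simp only: comp)
    then show ?thesis using that by (simp add: sub_simps)
  qed
  have cellA: "cell A n = g n ` (F `` {n})" for n by (simp add: A_def cell_quot sub_simps)
  have inj: "inj_on (j n) (cell A n)" for n
    by (rule inj_onI) (auto simp: cellA jg)
  have img: "j n ` cell A n = F `` {n}" for n
    by (auto simp: cellA image_image jg)
  have "(SIGMA n:UNIV. cell A n) = (\<lambda>(n, x). (n, g n x)) ` F"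
    by (auto simp: cellA image_iff Bex_def)
  then have "finite (SIGMA n:UNIV. cell A n)" using fin by simp
  moreover have "small TYPE('u) (cell A n)" for n
    unfolding cellA using fin by (intro small_finite[OF U] finite_imageI finite_Image)
  moreover have "separated A" by (rule separated_of_injective[OF sX j inj])
  moreover have "labelled \<Sigma> A" unfolding A_def by (rule labelled_quot[OF lS cong])
  moreover have "cell A n \<subseteq> N" for n unfolding cellA by (rule g(2))
  ultimately have "A \<in> finite_objects N \<Sigma>" by (simp add: finite_objects_def Obj_HDA)
  with j inj img show ?thesis by blast
qed

text \<open>
  \<open>X\<close> is the colimit of any directed family of subobjects that covers it. The subobjects are given by
  monomorphisms \<open>j i\<close> and not by inclusions, so the transition maps are obtained by factoring \<open>j i\<close>
  through \<open>j k\<close>; their functoriality holds because \<open>j k\<close> is injective.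
\<close>

lemma is_colimit_of_subobjects:
  fixes X :: "('u, 'l) lpsh" and A :: "'i \<Rightarrow> ('u, 'l) lpsh"
  assumes X: "X \<in> Obj (HDA U \<Sigma>)" and A: "\<And>i. i \<in> I \<Longrightarrow> A i \<in> Obj (HDA U \<Sigma>)"
    and j: "\<And>i. i \<in> I \<Longrightarrow> j i \<in> lhom (A i) X"
    and inj: "\<And>i n. i \<in> I \<Longrightarrow> inj_on (j i n) (cell (A i) n)"
    and order: "partial_order_on I r"
    and image: "\<And>i k n. (i, k) \<in> r \<Longrightarrow> j i n ` cell (A i) n \<subseteq> j k n ` cell (A k) n"
    and cover: "\<And>n z. z \<in> cell X n \<Longrightarrow> \<exists>i\<in>I. z \<in> j i n ` cell (A i) n"
    and bound: "\<And>i k. i \<in> I \<Longrightarrow> k \<in> I \<Longrightarrow> \<exists>l\<in>I. (i, l) \<in> r \<and> (k, l) \<in> r"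
  shows "\<exists>D. on_ob D = A \<and> is_functor (poset_cat I r) (HDA U \<Sigma>) D \<and>
    is_colimit (poset_cat I r) (HDA U \<Sigma>) D X j"
proof -
  define t where "t i k n = (\<lambda>x\<in>cell (A i) n. inv_into (cell (A k) n) (j k n) (j i n x))" for i k n
  have lA: "labelled \<Sigma> (A i)" if "i \<in> I" for i using A[OF that] by (simp add: Obj_HDA)
  have rI: "i \<in> I" "k \<in> I" if "(i, k) \<in> r" for i k
    using order that by (auto simp: partial_order_on_def preorder_on_def)
  have refl: "(i, i) \<in> r" if "i \<in> I" for i
    using order that unfolding partial_order_on_def preorder_on_def refl_on_def by blast
  have trans: "(i, l) \<in> r" if "(i, k) \<in> r" "(k, l) \<in> r" for i k l
    using order that unfolding partial_order_on_def preorder_on_def trans_def by blast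
  have t_in: "t i k n x \<in> cell (A k) n" and jt: "j k n (t i k n x) = j i n x"
    if "(i, k) \<in> r" "x \<in> cell (A i) n" for i k n x
  proof -
    have "j i n x \<in> j k n ` cell (A k) n" using image[OF that(1)] that(2) by blast
    then show "t i k n x \<in> cell (A k) n" "j k n (t i k n x) = j i n x"
      using that(2) by (simp_all add: t_def inv_into_into f_inv_into_f)
  qed
  have t_eqI: "t i k n x = y"
    if "(i, k) \<in> r" "x \<in> cell (A i) n" "y \<in> cell (A k) n" "j i n x = j k n y" for i k n x y
    using inj_onD[OF inj[OF rI(2)[OF that(1)]], of n "t i k n x" y] t_in[OF that(1,2)]
      jt[OF that(1,2)] that(3,4) by simp
  have t: "t i k \<in> lhom (A i) (A k)" if ik: "(i, k) \<in> r" for i k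
  proof (rule lhomI[OF lA[OF rI(1)[OF ik]]])
    note ji = j[OF rI(1)[OF ik]] and jk = j[OF rI(2)[OF ik]]
    fix n x assume x: "x \<in> cell (A i) n"
    show tx: "t i k n x \<in> cell (A k) n" by (rule t_in[OF ik x])
    show "snd (A k) n (t i k n x) = snd (A i) n x"
      using lhom_label[OF jk tx] lhom_label[OF ji x] jt[OF ik x] by simp
    fix m f assume f: "f \<in> Hom box m n"
    show "t i k m (pull (A i) m n f x) = pull (A k) m n f (t i k n x)"
    proof (rule t_eqI[OF ik])
      show "pull (A i) m n f x \<in> cell (A i) m" by (rule pull_in[OF lA[OF rI(1)[OF ik]] f x])
      show "pull (A k) m n f (t i k n x) \<in> cell (A k) m"
        by (rule pull_in[OF lA[OF rI(2)[OF ik]] f tx])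
      show "j i m (pull (A i) m n f x) = j k m (pull (A k) m n f (t i k n x))"
        by (simp add: lhom_pull[OF ji f x] lhom_pull[OF jk f tx] jt[OF ik x])
    qed
  qed (simp add: t_def)
  have t_id: "t i i = psh_incl (fst (A i))" if "i \<in> I" for i
    by (rule lhom_eqI[OF t[OF refl[OF that]] lhom_incl[OF lA[OF that]]])
      (simp add: t_eqI[OF refl[OF that]])
  have t_comp: "t i l = psh_comp (fst (A i)) (t k l) (t i k)" if "(i, k) \<in> r" "(k, l) \<in> r" for i k l
    by (rule lhom_eqI[OF t[OF trans[OF that]] lhom_comp[OF lA[OF rI(1)[OF that(1)]] t[OF that(1)] t[OF that(2)]]])
      (simp add: t_eqI[OF trans[OF that]] t_in[OF that(2)] t_in[OF that(1)] jt[OF that(2)] jt[OF that(1)])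
  define D where "D = \<lparr>on_ob = A, on_ar = (\<lambda>i k (_ :: unit). t i k)\<rparr>"
  have Dsimps: "on_ob D = A" "on_ar D i k f = t i k" for i k f by (simp_all add: D_def)
  have poset: "Obj (poset_cat I r) = I" "f \<in> Hom (poset_cat I r) i k \<longleftrightarrow> (i, k) \<in> r" for f i k
    by (simp_all add: poset_cat_def)
  have "category (poset_cat I r)"
    unfolding category_def by (auto simp: poset_cat_def refl intro: trans)
  then have D: "is_functor (poset_cat I r) (HDA U \<Sigma>) D"
    unfolding is_functor_def
    by (intro conjI ballI category_HDA)
      (simp_all add: poset Dsimps A t HDA_simps(2-) t_id t_comp)
  have cocone: "is_cocone (poset_cat I r) (HDA U \<Sigma>) D X j"
    unfolding is_cocone_HDA
  proof (intro conjI ballI X)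
    fix i k f assume "i \<in> Obj (poset_cat I r)" "f \<in> Hom (poset_cat I r) i k"
    then have i: "i \<in> I" and ik: "(i, k) \<in> r" by (simp_all add: poset)
    show "psh_comp (fst (on_ob D i)) (j k) (on_ar D i k f) = j i"
      unfolding Dsimps
      by (rule ext, rule extensionalityI, rule psh_comp_extensional, rule lhom_extensional[OF j[OF i]])
        (simp add: jt[OF ik])
  qed (simp add: poset Dsimps j)
  have "is_colimit (poset_cat I r) (HDA U \<Sigma>) D X j"
  proof (rule is_colimit_HDA_I[OF D cocone])
    show "\<exists>i\<in>Obj (poset_cat I r). \<exists>x\<in>cell (on_ob D i) n. z = j i n x" if "z \<in> cell X n" for n z
      using cover[OF that] unfolding poset Dsimps by blast
  next
    fix Y d n i k x y
    assume d: "is_cocone (poset_cat I r) (HDA U \<Sigma>) D Y d" and "i \<in> Obj (poset_cat I r)"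
      "k \<in> Obj (poset_cat I r)" "x \<in> cell (on_ob D i) n" "y \<in> cell (on_ob D k) n"
      and eq: "j i n x = j k n y"
    then have i: "i \<in> I" and k: "k \<in> I" and x: "x \<in> cell (A i) n" and y: "y \<in> cell (A k) n"
      by (simp_all add: poset Dsimps)
    obtain l where l: "l \<in> I" "(i, l) \<in> r" "(k, l) \<in> r" using bound[OF i k] by blast
    have d_t: "d l n (t i l n x) = d i n x" if "i \<in> I" "(i, l) \<in> r" "x \<in> cell (A i) n" for i x
      using cocone_HDA_arrow[OF d, of i l "()" x n] that l(1) by (simp add: poset Dsimps)
    have "t i l n x = t k l n y"
      by (rule t_eqI[OF l(2) x t_in[OF l(3) y]]) (simp add: jt[OF l(3) y] eq)
    then show "d i n x = d k n y" using d_t[OF i l(2) x] d_t[OF k l(3) y] by simp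
  qed
  with D Dsimps(1) show ?thesis by blast
qed

lemma labelled_eqI:
  assumes X: "labelled \<Sigma> X" and Y: "labelled \<Sigma> Y" and cell: "\<And>n. cell X n = cell Y n"
    and pull: "\<And>m n f x. f \<in> Hom box m n \<Longrightarrow> x \<in> cell X n \<Longrightarrow> pull X m n f x = pull Y m n f x"
    and label: "\<And>n x. x \<in> cell X n \<Longrightarrow> snd X n x = snd Y n x"
  shows "X = Y"
proof -
  have pX: "pull X m n \<in> Hom box m n \<rightarrow>\<^sub>E (cell X n \<rightarrow>\<^sub>E cell X m)" and lX: "snd X n \<in> cell X n \<rightarrow>\<^sub>E words \<Sigma> n"
    and pY: "pull Y m n \<in> Hom box m n \<rightarrow>\<^sub>E (cell X n \<rightarrow>\<^sub>E cell X m)" and lY: "snd Y n \<in> cell X n \<rightarrow>\<^sub>E words \<Sigma> n"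
    for m n
    using X Y by (simp_all only: labelled_iff cell)
  have "pull X m n = pull Y m n" for m n
  proof (rule PiE_ext[OF pX pY])
    fix f assume f: "f \<in> Hom box m n"
    show "pull X m n f = pull Y m n f"
      by (rule PiE_ext[OF PiE_mem[OF pX f] PiE_mem[OF pY f]]) (rule pull[OF f])
  qed
  then have "fst X = fst Y" using cell by (intro psh.equality) (auto simp: fun_eq_iff)
  moreover have "snd X = snd Y" by (rule ext, rule PiE_ext[OF lX lY]) (rule label)
  ultimately show ?thesis by (rule prod_eqI)
qed

text \<open>
  A finite object is determined by the graphs of its structure maps, which are finite subsets of small
  sets.
\<close>

lemma small_finite_objects:
  fixes \<Sigma> :: "'l set" and N :: "'u set"
  assumes U: "size_universe TYPE('u)" and \<Sigma>: "small TYPE('u) \<Sigma>" and N: "small TYPE('u) N"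
  shows "small TYPE('u) (finite_objects N \<Sigma>)"
proof -
  define B where "B = (\<Union>m. \<Union>n. Hom box m n)"
  have B: "small TYPE('u) B"
    unfolding B_def by (intro small_UNION[OF U] small_nat[OF U] small_finite[OF U] finite_Hom_box)
  have nat: "small TYPE('u) (UNIV :: nat set)" by (rule small_nat[OF U])
  define G1 where "G1 X = (SIGMA n:UNIV. cell X n)" for X :: "('u, 'l) lpsh"
  define G2 where "G2 X = (\<lambda>(p, m, f). (p, m, f, pull X m (fst p) f (snd p))) `
      (SIGMA p:G1 X. SIGMA m:{..fst p}. Hom box m (fst p))" for X :: "('u, 'l) lpsh"
  define G3 where "G3 X = (\<lambda>p. (p, snd X (fst p) (snd p))) ` G1 X" for X :: "('u, 'l) lpsh"
  define code where "code X = (G1 X, G2 X, G3 X)" for X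
  let ?M = "(UNIV :: nat set) \<times> N"
  let ?T = "Fpow ?M \<times> Fpow (?M \<times> (UNIV :: nat set) \<times> B \<times> N) \<times> Fpow (?M \<times> lists \<Sigma>)"
  have "small TYPE('u) ?T"
    by (intro small_Sigma[OF U] small_Fpow[OF U] small_lists[OF U] nat N B \<Sigma>)
  moreover have "code ` finite_objects N \<Sigma> \<subseteq> ?T"
  proof (rule image_subsetI)
    fix X assume "X \<in> finite_objects N \<Sigma>"
    then have X: "labelled \<Sigma> X" and fin: "finite (G1 X)" and N: "\<And>n. cell X n \<subseteq> N"
      by (simp_all add: finite_objects_def Obj_HDA G1_def)
    have cellN: "x \<in> N" if "x \<in> cell X n" for n x using N that by blast
    have "finite (SIGMA p:G1 X. SIGMA m:{..fst p}. Hom box m (fst p))"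
      by (intro finite_SigmaI fin finite_Hom_box) auto
    then have "finite (G2 X)" "finite (G3 X)" using fin by (simp_all add: G2_def G3_def)
    moreover have "G1 X \<subseteq> UNIV \<times> N" using cellN by (auto simp: G1_def)
    moreover have "G2 X \<subseteq> (UNIV \<times> N) \<times> UNIV \<times> B \<times> N"
      using cellN pull_in[OF X] unfolding G2_def G1_def B_def by fastforce
    moreover have "G3 X \<subseteq> (UNIV \<times> N) \<times> lists \<Sigma>"
    proof -
      have "w \<in> \<Sigma>" if "x \<in> cell X n" "w \<in> set (snd X n x)" for n x w
        using label_in[OF X that(1)] that(2) by (auto simp: words_def)
      then show ?thesis using cellN unfolding G3_def G1_def by auto
    qed
    ultimately show "code X \<in> ?T" using fin by (simp add: code_def Fpow_def)
  qed
  ultimately have "small TYPE('u) (code ` finite_objects N \<Sigma>)" by (rule small_subset)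
  moreover have "inj_on code (finite_objects N \<Sigma>)"
  proof (rule inj_onI)
    fix X Y assume "X \<in> finite_objects N \<Sigma>" "Y \<in> finite_objects N \<Sigma>" and eq: "code X = code Y"
    then have X: "labelled \<Sigma> X" and Y: "labelled \<Sigma> Y" by (simp_all add: finite_objects_def Obj_HDA)
    have G1: "G1 X = G1 Y" and G2: "G2 X = G2 Y" and G3: "G3 X = G3 Y"
      using eq by (simp_all add: code_def)
    show "X = Y"
    proof (rule labelled_eqI[OF X Y])
      show "cell X n = cell Y n" for n
      proof -
        have "cell X n = {x. (n, x) \<in> G1 X}" "cell Y n = {x. (n, x) \<in> G1 Y}" by (auto simp: G1_def)
        then show ?thesis using G1 by simp
      qed
      show "pull X m n f x = pull Y m n f x" if f: "f \<in> Hom box m n" and x: "x \<in> cell X n" for m n f x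
      proof -
        have "((n, x), m, f, pull X m n f x) \<in> G2 X"
          unfolding G2_def by (rule image_eqI[of _ _ "((n, x), m, f)"])
            (use f x Hom_box_le[OF f] in \<open>simp_all add: G1_def\<close>)
        then have "((n, x), m, f, pull X m n f x) \<in> G2 Y" by (simp only: G2)
        then show ?thesis unfolding G2_def by auto
      qed
      show "snd X n x = snd Y n x" if x: "x \<in> cell X n" for n x
      proof -
        have "((n, x), snd X n x) \<in> G3 X"
          unfolding G3_def by (rule image_eqI[of _ _ "(n, x)"]) (use x in \<open>simp_all add: G1_def\<close>)
        then have "((n, x), snd X n x) \<in> G3 Y" by (simp only: G3)
        then show ?thesis unfolding G3_def by auto
      qed
    qed
  qed
  ultimately show ?thesis by (rule small_inj_on)
qed

text \<open>
  A cell has only finitely many faces, as there are no cube maps \<open>[m] \<rightarrow> [n]\<close> for \<open>m > n\<close> and finitely many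
  for each \<open>m \<le> n\<close>. So finitely generated subpresheaves are finite.
\<close>

lemma generated_cells:
  assumes X: "labelled \<Sigma> X" and x: "x \<in> cell X n"
  shows "\<exists>F. closed_cells X F \<and> finite F \<and> (n, x) \<in> F"
proof -
  define F where "F = (\<lambda>(m, f). (m, pull X m n f x)) ` (SIGMA m:{..n}. Hom box m n)"
  have F_iff: "(m, y) \<in> F \<longleftrightarrow> (\<exists>f\<in>Hom box m n. y = pull X m n f x)" for m y
    by (auto simp: F_def image_iff Bex_def dest: Hom_box_le)
  have "finite F" unfolding F_def by (intro finite_imageI finite_SigmaI finite_Hom_box) auto
  moreover have "(n, x) \<in> F"
    unfolding F_iff by (rule bexI[OF _ Ide_box]) (simp add: pull_Ide[OF X x])
  moreover have "closed_cells X F"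
    unfolding closed_cells_def
  proof (intro conjI subsetI allI impI ballI)
    fix p assume "p \<in> F"
    then show "p \<in> (SIGMA n:UNIV. cell X n)"
      by (cases p) (auto simp: F_iff pull_in[OF X _ x])
  next
    fix m y l g assume "(m, y) \<in> F" and g: "g \<in> Hom box l m"
    then obtain f where f: "f \<in> Hom box m n" "y = pull X m n f x" unfolding F_iff by blast
    show "(l, pull X l m g y) \<in> F"
      unfolding F_iff by (rule bexI[OF _ Comp_box[OF g f(1)]]) (simp add: pull_Comp[OF X g f(1) x] f(2))
  qed
  ultimately show ?thesis by blast
qed

lemma closed_cells_Union:
  assumes "\<And>F. F \<in> \<F> \<Longrightarrow> closed_cells X F"
  shows "closed_cells X (\<Union>\<F>)"
  unfolding closed_cells_def
proof (intro conjI subsetI allI impI ballI)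
  fix p assume "p \<in> \<Union>\<F>"
  then show "p \<in> (SIGMA n:UNIV. cell X n)" using closed_cellsD(1)[OF assms] by (cases p) auto
next
  fix n x m f assume "(n, x) \<in> \<Union>\<F>" "f \<in> Hom box m n"
  then show "(m, pull X m n f x) \<in> \<Union>\<F>" using closed_cellsD(2)[OF assms] by blast
qed

text \<open>
  \<open>X\<close> is the directed union of its finite subpresheaves. They are indexed by their sets of cells, which are
  encoded as elements of \<open>'u\<close>. By the condition on \<open>lam\<close>, directed sets are \<open>lam\<close>-directed.
\<close>

lemma directed_colimit_of_finite_objects:
  fixes X :: "('u, 'l) lpsh"
  assumes U: "size_universe TYPE('u)" and N: "infinite (N :: 'u set)"
    and X: "X \<in> Obj (HDA TYPE('u) \<Sigma>)" and lam: "\<And>S :: 'u set. |S| <o lam \<Longrightarrow> finite S"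
  shows "\<exists>(I :: 'u set) r D c. small TYPE('u) I \<and> directed_poset lam I r \<and>
    is_functor (poset_cat I r) (HDA TYPE('u) \<Sigma>) D \<and> (\<forall>i\<in>I. on_ob D i \<in> finite_objects N \<Sigma>) \<and>
    is_colimit (poset_cat I r) (HDA TYPE('u) \<Sigma>) D X c"
proof -
  have lX: "labelled \<Sigma> X" and smallX: "\<And>n. small TYPE('u) (cell X n)"
    using X by (simp_all add: Obj_HDA)
  define \<F> where "\<F> = {F. closed_cells X F \<and> finite F}"
  have "\<F> \<subseteq> Fpow (SIGMA n:UNIV. cell X n)"
    by (auto simp: \<F>_def Fpow_def closed_cells_def)
  then have small: "small TYPE('u) \<F>"
    by (rule small_subset[rotated]) (intro small_Fpow[OF U] small_Sigma[OF U] small_nat[OF U] smallX)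
  then obtain enc :: "(nat \<times> 'u) set \<Rightarrow> 'u" where enc: "inj_on enc \<F>" using small_imp_inj_on by blast
  define dec where "dec = inv_into \<F> enc"
  have dec_enc: "dec (enc F) = F" if "F \<in> \<F>" for F
    using enc that by (simp add: dec_def)
  define I where "I = enc ` \<F>"
  have dec: "dec i \<in> \<F>" "enc (dec i) = i" if "i \<in> I" for i
    using that by (auto simp: I_def dec_enc)
  define r where "r = {(i, k). i \<in> I \<and> k \<in> I \<and> dec i \<subseteq> dec k}"
  have order: "partial_order_on I r"
    unfolding partial_order_on_def preorder_on_def
  proof (intro conjI)
    show "antisym r"
    proof (rule antisymI)
      fix i k assume "(i, k) \<in> r" "(k, i) \<in> r"
      then have "i \<in> I" "k \<in> I" "dec i = dec k" by (auto simp: r_def)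
      then show "i = k" using dec(2) by metis
    qed
  qed (auto simp: r_def refl_on_def trans_def)
  have bound: "\<exists>u\<in>I. \<forall>s\<in>S. (s, u) \<in> r" if S: "finite S" "S \<subseteq> I" for S
  proof -
    have "closed_cells X (\<Union>(dec ` S))"
      by (rule closed_cells_Union) (use S dec(1) in \<open>auto simp: \<F>_def\<close>)
    moreover have "finite (\<Union>(dec ` S))" using S dec(1) by (auto simp: \<F>_def)
    ultimately have F: "\<Union>(dec ` S) \<in> \<F>" by (simp add: \<F>_def)
    show ?thesis
    proof (intro bexI ballI)
      show "enc (\<Union>(dec ` S)) \<in> I" using F by (simp add: I_def)
      then show "(s, enc (\<Union>(dec ` S))) \<in> r" if "s \<in> S" for s
        using that S(2) by (auto simp: r_def dec_enc[OF F])
    qed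
  qed
  have directed: "directed_poset lam I r"
    unfolding directed_poset_def using order bound lam by blast
  have "\<exists>A j. A \<in> finite_objects N \<Sigma> \<and> j \<in> lhom A X \<and> (\<forall>n. inj_on (j n) (cell A n)) \<and>
      (\<forall>n. j n ` cell A n = dec i `` {n})" if "i \<in> I" for i
    using dec(1)[OF that] by (intro ex_finite_object[OF U N X]) (simp_all add: \<F>_def)
  then obtain A j where A: "\<And>i. i \<in> I \<Longrightarrow> A i \<in> finite_objects N \<Sigma>"
    and j: "\<And>i. i \<in> I \<Longrightarrow> j i \<in> lhom (A i) X"
    and inj: "\<And>i n. i \<in> I \<Longrightarrow> inj_on (j i n) (cell (A i) n)"
    and img: "\<And>i n. i \<in> I \<Longrightarrow> j i n ` cell (A i) n = dec i `` {n}"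
    by metis
  have "\<exists>D. on_ob D = A \<and> is_functor (poset_cat I r) (HDA TYPE('u) \<Sigma>) D \<and>
      is_colimit (poset_cat I r) (HDA TYPE('u) \<Sigma>) D X j"
  proof (rule is_colimit_of_subobjects[OF X _ j inj order])
    show "A i \<in> Obj (HDA TYPE('u) \<Sigma>)" if "i \<in> I" for i
      using A[OF that] by (simp add: finite_objects_def)
    show "j i n ` cell (A i) n \<subseteq> j k n ` cell (A k) n" if "(i, k) \<in> r" for i k n
      using that img by (auto simp: r_def)
    show "\<exists>i\<in>I. z \<in> j i n ` cell (A i) n" if z: "z \<in> cell X n" for n z
    proof -
      obtain F where F: "F \<in> \<F>" "(n, z) \<in> F" using generated_cells[OF lX z] by (auto simp: \<F>_def)
      then have "enc F \<in> I" "z \<in> dec (enc F) `` {n}" by (simp_all add: I_def dec_enc)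
      then show ?thesis using img by blast
    qed
    show "\<exists>l\<in>I. (i, l) \<in> r \<and> (k, l) \<in> r" if "i \<in> I" "k \<in> I" for i k
      using bound[of "{i, k}"] that by simp
  qed
  then obtain D where "on_ob D = A" "is_functor (poset_cat I r) (HDA TYPE('u) \<Sigma>) D"
    "is_colimit (poset_cat I r) (HDA TYPE('u) \<Sigma>) D X j" by blast
  moreover have "small TYPE('u) I" unfolding I_def by (rule small_image[OF small])
  ultimately show ?thesis using directed A by metis
qed

text \<open>
  The cardinal \<open>\<aleph>\<^sub>0\<close>, represented on a countable subset of \<open>'u\<close>. No larger regular cardinal need exist
  below that of \<open>'u\<close>, which may be \<open>\<aleph>\<^sub>1\<close>.
\<close>

lemma ex_countable_cardinal:
  assumes U: "size_universe TYPE('u)"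
  shows "\<exists>N :: 'u set. infinite N \<and> small TYPE('u) N \<and> small_regular_cardinal |N| \<and>
    (\<forall>S :: 'u set. |S| <o |N| \<longrightarrow> finite S)"
proof -
  have "infinite (UNIV :: 'u set)"
    using U unfolding size_universe_def by (metis infinite_iff_natLeq_ordLeq ordLess_imp_ordLeq)
  then obtain e :: "nat \<Rightarrow> 'u" where e: "inj e" using infinite_countable_subset by blast
  let ?N = "range e"
  have inf: "infinite ?N" using e by (simp add: finite_image_iff)
  have small: "small TYPE('u) ?N" by (rule small_image[OF small_nat[OF U]])
  have "|UNIV :: nat set| =o |?N|" by (rule card_of_ordIsoI[OF inj_on_imp_bij_betw[OF e]])
  then have iso: "natLeq =o |?N|" using card_of_nat ordIso_symmetric ordIso_transitive by blast
  have "regularCard |?N|" by (rule regularCard_ordIso[OF iso natLeq_Cinfinite regularCard_natLeq])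
  then have "small_regular_cardinal |?N|"
    using inf small by (simp add: small_regular_cardinal_def Field_card_of card_of_card_order_on small_def)
  moreover have "finite S" if "|S| <o |?N|" for S :: "'u set"
    using ordLess_ordIso_trans[OF that ordIso_symmetric[OF iso]] by (simp add: finite_iff_ordLess_natLeq)
  ultimately show ?thesis using inf small by blast
qed

theorem locally_presentable_HDA:
  fixes \<Sigma> :: "'l set"
  assumes U: "size_universe TYPE('u)" and \<Sigma>: "small TYPE('u) \<Sigma>"
  shows "locally_presentable TYPE('u) (HDA TYPE('u) \<Sigma>)"
proof -
  obtain N :: "'u set" where N: "infinite N" "small TYPE('u) N" and lam: "small_regular_cardinal |N|"
    and fin: "\<And>S :: 'u set. |S| <o |N| \<Longrightarrow> finite S"
    using ex_countable_cardinal[OF U] by blast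
  have "finite_objects N \<Sigma> \<subseteq> Obj (HDA TYPE('u) \<Sigma>)"
    by (auto simp: finite_objects_def)
  moreover have "presentable |N| (HDA TYPE('u) \<Sigma>) P" if "P \<in> finite_objects N \<Sigma>" for P
    using that by (intro finite_presentable[OF U lam]) (simp_all add: finite_objects_def)
  ultimately show ?thesis
    unfolding locally_presentable_def
    using category_HDA locally_small_HDA[OF U] cocomplete_HDA[OF U] lam
      small_finite_objects[OF U \<Sigma> N(2)] directed_colimit_of_finite_objects[OF U N(1) _ fin]
    by (intro conjI impI exI[of _ "|N|"] exI[of _ "finite_objects N \<Sigma>"]) blast+
qed

theorem corollary7p4:
  fixes \<Sigma> :: "'l set"
  assumes "size_universe TYPE('u)"
    and "\<Sigma> \<noteq> {}" and "small TYPE('u) \<Sigma>"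
  shows "full_subcategory (HDA TYPE('u) \<Sigma>) (labelled_sets TYPE('u) \<Sigma>) \<and>
    (\<exists>Sh. left_adjoint (labelled_sets TYPE('u) \<Sigma>) (HDA TYPE('u) \<Sigma>) Sh inclusion) \<and>
    locally_presentable TYPE('u) (HDA TYPE('u) \<Sigma>)"
  using full_subcategory_HDA HDA_left_adjoint locally_presentable_HDA[OF assms(1,3)] by blast

end
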